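(* Let $v$ be a finite place of $k$, fix an embedding $\bar k\hookrightarrow\mathbb{C}_v$, let $\mathfrak{s}\in\mathbb{N}^r$ and $n=\operatorname{wt}(\mathfrak{s})$. Let $a\in\mathbb{F}_q[t]$ be nonzero with $|[a]\mathbf v_{\mathfrak{s}}|_v<1$ (so that $\log_{G_{\mathfrak{s}}}([a]\mathbf v_{\mathfrak{s}})_v$ converges). Then the $n$-th coordinate of $\log_{G_{\mathfrak{s}}}([a]\mathbf v_{\mathfrak{s}})_v$ equals $a(\theta)\,\Gamma_{\mathfrak{s}}\,\zeta_A(\mathfrak{s})_v$.
   Context: Notation: $A=\mathbb{F}_q[\theta]$, $k=\mathbb{F}_q(\theta)$, $\bar k$ an algebraic closure, $t$ a variable; for $f\in A$, $f(t)$ is $f$ with $\theta$ replaced by $t$ and for $a\in\mathbb{F}_q[t]$, $a(\theta)$ is $a$ with $t$ replaced by $\theta$. A finite place $v$ corresponds to a monic irreducible $v\in A$; $\mathbb{C}_v$ is the completion of an algebraic closure of $k_v$, with normalized absolute value $|\cdot|_v$; $|\gamma|_v$ is the max over entries. A $t$-module is $(\mathbb{G}_a^d,\rho)$, $\rho:\mathbb{F}_q[t]\to\mathrm{Mat}_d(\bar k[\tau])$ ($\tau c=c^q\tau$) an $\mathbb{F}_q$-linear ring homomorphism with $\partial\rho_t-\theta I$ nilpotent ($\partial\rho_a$ = $\tau^0$-coefficient), $[a]=\rho_a$. Its logarithm $\log_G=\sum_iP_i\tau^i$ is the formal inverse of the exponential (the unique power series $\equiv\mathbf z$ mod degree $q$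 with $\rho_a\circ\exp_G=\exp_G\circ\partial\rho_a$); $\log_G(\mathbf x)_v$ denotes the $v$-adic limit of $\sum_iP_i\mathbf x^{(i)}$ when it converges. Carlitz factorials $D_0=1$, $D_i=\prod_{j=0}^{i-1}(\theta^{q^i}-\theta^{q^j})$, $\Gamma_{m+1}=\prod_iD_i^{m_i}$ ($m=\sum m_iq^i$ base $q$), $\Gamma_{\mathfrak{s}}=\Gamma_{s_1}\cdots\Gamma_{s_r}$. Anderson–Thakur polynomials $H_m\in A[t]$: $F_0=1$, $F_i=\prod_{j=1}^i(t^{q^i}-\theta^{q^j})$, $\bigl(1-\sum_{i\ge0}\frac{F_i}{D_i|_{\theta=t}}x^{q^i}\bigr)^{-1}=\sum_{m\ge0}\frac{H_m}{\Gamma_{m+1}|_{\theta=t}}x^m$. Write $H_{s_i-1}=\sum_{j=0}^{m_i}u_{ij}t^j$ ($u_{im_i}\ne0$); $J_{\mathfrak{s}}=\prod_i\{0,\dots,m_i\}$; $\mathbf u_{\mathbf j}=(u_{1j_1},\dots,u_{rj_r})$, $a_{\mathbf j}(t)=t^{j_1+\cdots+j_r}$. $S^{r-1}$: $(r-1)$-tuples $P$ of `,' or `+'; $P(\mathfrak{s})$ adds adjacent entries joined by `+'; $P^\times(\mathbf u)$ multiplies them ($S^0$ trivial). $\operatorname{dep}$ = length, $\operatorname{wt}$ = sum; $\widetilde{(w_1,\dots,w_m)}=(w_m,\dots,w_1)$. $G_{\mathfrak{s}',\mathbf u'}$ for $\mathfrak{s}'\in\mathbb{N}^m$, $\mathbf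 u'\in\bar k^m$: $(\mathbb{G}_a^d,\rho)$ with $d_\ell=s'_\ell+\cdots+s'_m$, $d=\sum d_\ell$, $\rho_t=\theta I_d+N+E\tau$, $N$ block diagonal with $d_\ell\times d_\ell$ blocks with $1$'s on the superdiagonal, $E$ with $(\ell,m')$ block zero for $\ell>m'$ and otherwise with the single entry in row $d_\ell$, column $1$ equal to $1$ ($\ell=m'$) or $(-1)^{m'-\ell}\prod_{e=\ell}^{m'-1}u'_e$ ($\ell<m'$); $\mathbf v_{\mathfrak{s}',\mathbf u'}$ has $(d_1+\cdots+d_\ell)$-th coordinate $(-1)^{m-\ell}u'_\ell\cdots u'_m$, others $0$. $v$-adic CMSPL value: for $\mathfrak{t}\in\mathbb{N}^m$ and $\mathbf w\in A^m$, with $G=G_{\widetilde{\mathfrak{t}},\widetilde{\mathbf w}}$, $\mathbf v=\mathbf v_{\widetilde{\mathfrak{t}},\widetilde{\mathbf w}}$, it is known that there is nonzero $c\in\mathbb{F}_q[t]$ with $|[c]\mathbf v|_v<1$ and $\log_G([c]\mathbf v)_v$ convergent; $\operatorname{Li}^\star_{\mathfrak{t}}(\mathbf w)_v:=\frac{(-1)^{m-1}}{c(\theta)}\times$(the $\operatorname{wt}(\mathfrak{t})$-th coordinate of $\log_G([c]\mathbf v)_v$), which is independent of $c$, lies in $k_v$, and is the value at $\mathbf w$ of the $v$-adic analytic continuation to the closed unit polydisc of $\operatorname{Li}^\star_{\mathfrak{t}}(z)=\sum_{i_1\ge\cdots\ge i_m\ge0}z_1^{q^{i_1}}\cdots z_m^{q^{i_m}}/(L_{i_1}^{t_1}\cdots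 L_{i_m}^{t_m})$, $L_0=1$, $L_i=\prod_{e=1}^i(\theta-\theta^{q^e})$. $v$-adic MZV: $\zeta_A(\mathfrak{s})_v:=\Gamma_{\mathfrak{s}}^{-1}\sum_{\mathbf j\in J_{\mathfrak{s}}}\sum_{P\in S^{r-1}}(-1)^{r-1}a_{\mathbf j}(\theta)(-1)^{\operatorname{dep}(P(\mathfrak{s}))-1}\operatorname{Li}^\star_{P(\mathfrak{s})}(P^\times(\mathbf u_{\mathbf j}))_v\in k_v$. $G_{\mathfrak{s}},\mathbf v_{\mathfrak{s}}$: index $(\mathbf j,P)\in J_{\mathfrak{s}}\times S^{r-1}$ as $\ell=1,\dots,T$; $\mathfrak{s}_\ell=P(\mathfrak{s})$, $\mathbf u_\ell=P^\times(\mathbf u_{\mathbf j})$, $b_\ell=(-1)^{r-1}a_{\mathbf j}(\theta)$, $G_\ell=G_{\widetilde{\mathfrak{s}_\ell},\widetilde{\mathbf u_\ell}}$, $\mathbf v_\ell=\mathbf v_{\widetilde{\mathfrak{s}_\ell},\widetilde{\mathbf u_\ell}}$; $\dim G_\ell=n+h_\ell$, $\rho_{\ell,t}=\begin{pmatrix}R&X_\ell\\0&Y_\ell\end{pmatrix}$ with $R\in\mathrm{Mat}_n(k[\tau])$ independent of $\ell$. $G_{\mathfrak{s}}=(\mathbb{G}_a^{n+\sum h_\ell},\rho)$, $\rho_t=\begin{pmatrix}R&X_1&\cdots&X_T\\&Y_1&&\\&&\ddots&\\&&&Y_T\end{pmatrix}$; $\pi(\mathbf z_1,\dots,\mathbf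 z_T)=(\sum_\ell\hat{\mathbf z}_\ell,\mathbf z_{1-},\dots,\mathbf z_{T-})$ ($\hat{\mathbf z}$ first $n$ coordinates, $\mathbf z_-$ rest); $\mathbf v_{\mathfrak{s}}=\pi(([b_\ell(t)]\mathbf v_\ell)_\ell)\in G_{\mathfrak{s}}(k)$. *)

theory Defs
  imports
    "HOL-Analysis.Elementary_Topology"
    "HOL-Algebra.Algebraic_Closure_Type"
    "HOL-Library.Cardinality"
    "Jordan_Normal_Form.Matrix"
begin

unbundle no fps_syntax

text \<open>
  The finite field is a type \<open>'f :: finite_field\<close>, with \<open>q = CARD('f)\<close>. The type \<open>'f poly\<close> serves both
  as \<open>A = F\<^sub>q[\<theta>]\<close> and as \<open>F\<^sub>q[t]\<close>, so the substitutions \<open>f \<mapsto> f(t)\<close> and \<open>a \<mapsto> a(\<theta>)\<close> are the identity at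
  the level of \<open>'f poly\<close>. In \<open>A[t] = 'f poly poly\<close> the outer variable is \<open>t\<close>. Vectors, matrices and
  lists are indexed from 0.
\<close>

type_synonym 'f kbar = "'f poly fract alg_closure"

definition A_to_kbar :: "'f::finite_field poly \<Rightarrow> 'f kbar" where
  "A_to_kbar f = to_ac (to_fract f)"

definition theta :: "'f::finite_field kbar" where
  "theta = A_to_kbar [:0, 1:]"


section \<open>The field \<open>C\<^sub>v\<close>\<close>

definition vabs :: "'c::{zero,metric_space} \<Rightarrow> real" where
  "vabs x = dist x 0"

definition vabs_vec :: "'c::{zero,metric_space} vec \<Rightarrow> real" where
  "vabs_vec x = Max ((\<lambda>j. vabs (x $ j)) ` {..<dim_vec x})"

text \<open>As the ambient metric is complete, the completion \<open>k\<^sub>v\<close> is the topological closure of the image of \<open>k\<close>.\<close>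

definition local_field :: "('f::finite_field kbar \<Rightarrow> 'c::{field,complete_space}) \<Rightarrow> 'c set" where
  "local_field \<iota> = closure (range (\<lambda>x. \<iota> (to_ac x)))"

definition algebraic_elements :: "'c::field set \<Rightarrow> 'c set" where
  "algebraic_elements K = {x. \<exists>p. p \<noteq> 0 \<and> (\<forall>i. coeff p i \<in> K) \<and> poly p x = 0}"

text \<open>
  \<open>Cv_embedding v \<iota>\<close> states that \<open>'c\<close>, with absolute value \<open>vabs\<close>, is a model of \<open>C\<^sub>v\<close>, the completion of
  an algebraic closure of \<open>k\<^sub>v\<close>, and that \<open>\<iota>\<close> is an embedding of \<open>kbar\<close> into it. The absolute value is
  normalized by \<open>|v| = q\<^sup>-\<^sup>d\<close> with \<open>d = deg v\<close>; multiplicativity fixes it on all of \<open>k\<close> by its values on \<open>A\<close>.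
\<close>

locale Cv_embedding = field_hom \<iota>
  for v :: "'f::finite_field poly" and \<iota> :: "'f kbar \<Rightarrow> 'c::{field,complete_space}" +
  assumes dist_eq_vabs: "dist x y = vabs (x - y :: 'c)"
    and vabs_mult: "vabs (x * y :: 'c) = vabs x * vabs y"
    and vabs_ultrametric: "vabs (x + y :: 'c) \<le> max (vabs x) (vabs y)"
    and vabs_normalized: "v ^ n dvd f \<Longrightarrow> \<not> v ^ Suc n dvd f \<Longrightarrow>
          vabs (\<iota> (A_to_kbar f)) = 1 / real CARD('f) ^ (degree v * n)"
    and algebraic_closure_closed: "\<lbrakk>\<forall>i. coeff p i \<in> algebraic_elements (local_field \<iota>); degree p > 0\<rbrakk>
          \<Longrightarrow> \<exists>x \<in> algebraic_elements (local_field \<iota>). poly p x = 0"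
    and algebraic_closure_dense: "closure (algebraic_elements (local_field \<iota>)) = (UNIV :: 'c set)"


section \<open>Twisted power series with matrix coefficients\<close>

text \<open>
  A function \<open>P :: nat \<Rightarrow> 'f kbar mat\<close> with values in the \<open>d \<times> d\<close> matrices stands for \<open>\<Sum>\<^sub>i P\<^sub>i \<tau>\<^sup>i\<close>.
  Finitely supported functions are the elements of \<open>Mat\<^sub>d(kbar[\<tau>])\<close>.
\<close>

type_synonym 'f twisted = "nat \<Rightarrow> 'f kbar mat"

definition tw_const :: "nat \<Rightarrow> 'f::finite_field kbar mat \<Rightarrow> 'f twisted" where
  "tw_const d M = (\<lambda>i. if i = 0 then M else 0\<^sub>m d d)"

definition tw_mult :: "nat \<Rightarrow> 'f::finite_field twisted \<Rightarrow> 'f twisted \<Rightarrow> 'f twisted" where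
  "tw_mult d P Q = (\<lambda>n. mat d d (\<lambda>ij.
     \<Sum>m\<le>n. (P m * map_mat (\<lambda>z. z ^ (CARD('f) ^ m)) (Q (n - m))) $$ ij))"

primrec tw_power :: "nat \<Rightarrow> 'f::finite_field twisted \<Rightarrow> nat \<Rightarrow> 'f twisted" where
  "tw_power d P 0 = tw_const d (1\<^sub>m d)"
| "tw_power d P (Suc k) = tw_mult d P (tw_power d P k)"

definition tw_apply :: "nat \<Rightarrow> 'f::finite_field twisted \<Rightarrow> 'f kbar vec \<Rightarrow> 'f kbar vec" where
  "tw_apply d P x = vec d (\<lambda>j.
     \<Sum>i | P i \<noteq> 0\<^sub>m d d. (P i *\<^sub>v map_vec (\<lambda>z. z ^ (CARD('f) ^ i)) x) $ j)"


section \<open>t-modules, exponential and logarithm\<close>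

record (overloaded) 'f tmodule =
  tm_dim :: nat
  tm_rho :: "'f poly \<Rightarrow> 'f twisted"

text \<open>The \<open>F\<^sub>q\<close>-linear ring homomorphism \<open>\<rho>\<close> with \<open>\<rho>\<^sub>t = T\<close>: \<open>\<rho>\<^sub>a = \<Sum>\<^sub>k a\<^sub>k T\<^sup>k\<close> for \<open>a = \<Sum>\<^sub>k a\<^sub>k t\<^sup>k\<close>.\<close>

definition tmodule_of :: "nat \<Rightarrow> 'f::finite_field twisted \<Rightarrow> 'f tmodule" where
  "tmodule_of d T = \<lparr> tm_dim = d,
     tm_rho = (\<lambda>a i. mat d d (\<lambda>rc. \<Sum>k\<le>degree a. A_to_kbar [:coeff a k:] * tw_power d T k i $$ rc)) \<rparr>"

definition tm_act :: "'f::finite_field tmodule \<Rightarrow> 'f poly \<Rightarrow> 'f kbar vec \<Rightarrow> 'f kbar vec" where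
  "tm_act G a x = tw_apply (tm_dim G) (tm_rho G a) x"

definition tm_exp :: "'f::finite_field tmodule \<Rightarrow> 'f twisted" where
  "tm_exp G = (let d = tm_dim G in THE Q.
     (\<forall>i. Q i \<in> carrier_mat d d) \<and> Q 0 = 1\<^sub>m d \<and>
     (\<forall>a. tw_mult d (tm_rho G a) Q = tw_mult d Q (tw_const d (tm_rho G a 0))))"

definition tm_log :: "'f::finite_field tmodule \<Rightarrow> 'f twisted" where
  "tm_log G = (let d = tm_dim G in THE P.
     (\<forall>i. P i \<in> carrier_mat d d) \<and>
     tw_mult d P (tm_exp G) = tw_const d (1\<^sub>m d) \<and>
     tw_mult d (tm_exp G) P = tw_const d (1\<^sub>m d))"

definition log_term ::
  "('f::finite_field kbar \<Rightarrow> 'c::{field,complete_space}) \<Rightarrow> 'f tmodule \<Rightarrow> 'c vec \<Rightarrow> nat \<Rightarrow> 'c vec" where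
  "log_term \<iota> G x i = map_mat \<iota> (tm_log G i) *\<^sub>v map_vec (\<lambda>z. z ^ (CARD('f) ^ i)) x"

definition log_converges ::
  "('f::finite_field kbar \<Rightarrow> 'c::{field,complete_space}) \<Rightarrow> 'f tmodule \<Rightarrow> 'c vec \<Rightarrow> bool" where
  "log_converges \<iota> G x \<longleftrightarrow> (\<forall>j < tm_dim G. summable (\<lambda>i. log_term \<iota> G x i $ j))"

definition log_value ::
  "('f::finite_field kbar \<Rightarrow> 'c::{field,complete_space}) \<Rightarrow> 'f tmodule \<Rightarrow> 'c vec \<Rightarrow> 'c vec" where
  "log_value \<iota> G x = vec (tm_dim G) (\<lambda>j. \<Sum>i. log_term \<iota> G x i $ j)"


section \<open>Carlitz factorials and Anderson--Thakur polynomials\<close>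

definition carlitz_D :: "nat \<Rightarrow> 'f::finite_field poly" where
  "carlitz_D i = (\<Prod>j<i. monom 1 (CARD('f) ^ i) - monom 1 (CARD('f) ^ j))"

text \<open>The base-\<open>q\<close> digits of \<open>m = n - 1\<close> in positions above \<open>m\<close> vanish. Only \<open>n \<ge> 1\<close> is meaningful.\<close>

definition carlitz_Gamma :: "nat \<Rightarrow> 'f::finite_field poly" where
  "carlitz_Gamma n = (let m = n - 1 in
     \<Prod>i\<le>m. carlitz_D i ^ ((m div CARD('f) ^ i) mod CARD('f)))"

definition Gamma_list :: "nat list \<Rightarrow> 'f::finite_field poly" where
  "Gamma_list s = prod_list (map carlitz_Gamma s)"

text \<open>\<open>f(t)\<close> as an element of \<open>A[t]\<close>\<close>

definition at_t :: "'f::finite_field poly \<Rightarrow> 'f poly poly" where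
  "at_t f = map_poly (\<lambda>c. [:c:]) f"

definition AT_F :: "nat \<Rightarrow> 'f::finite_field poly poly" where
  "AT_F i = (\<Prod>j=1..i. monom 1 (CARD('f) ^ i) - [:monom 1 (CARD('f) ^ j):])"

definition AT_series :: "'f::finite_field poly poly fract fps" where
  "AT_series = inverse (1 - Abs_fps (\<lambda>n. \<Sum>i | CARD('f) ^ i = n.
     to_fract (AT_F i) / to_fract (at_t (carlitz_D i))))"

text \<open>Anderson and Thakur proved that the coefficients in question do lie in \<open>A[t]\<close>.\<close>

definition AT_H :: "nat \<Rightarrow> 'f::finite_field poly poly" where
  "AT_H m = (THE H. to_fract H / to_fract (at_t (carlitz_Gamma (m + 1))) = fps_nth AT_series m)"


section \<open>The t-modules \<open>G\<close> attached to a composition and a tuple\<close>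

definition block_dim :: "nat list \<Rightarrow> nat \<Rightarrow> nat" where
  "block_dim s l = sum_list (drop l s)"

definition block_offset :: "nat list \<Rightarrow> nat \<Rightarrow> nat" where
  "block_offset s l = (\<Sum>e<l. block_dim s e)"

definition total_dim :: "nat list \<Rightarrow> nat" where
  "total_dim s = block_offset s (length s)"

definition superdiag :: "nat \<Rightarrow> 'a::zero_neq_one mat" where
  "superdiag d = mat d d (\<lambda>(i, j). if j = i + 1 then 1 else 0)"

definition G_N :: "nat list \<Rightarrow> 'f::finite_field kbar mat" where
  "G_N s = diag_block_mat (map (\<lambda>l. superdiag (block_dim s l)) [0..<length s])"

text \<open>Block \<open>(l, m)\<close> has its nonzero entry in its last row and first column.\<close>

definition G_E :: "nat list \<Rightarrow> 'f::finite_field kbar list \<Rightarrow> 'f kbar mat" where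
  "G_E s u = mat (total_dim s) (total_dim s) (\<lambda>(i, j).
     \<Sum>l<length s. \<Sum>m\<in>{l..<length s}.
       if i = block_offset s l + block_dim s l - 1 \<and> j = block_offset s m
       then (-1) ^ (m - l) * (\<Prod>e\<in>{l..<m}. u ! e) else 0)"

definition G_rho_t :: "nat list \<Rightarrow> 'f::finite_field kbar list \<Rightarrow> 'f twisted" where
  "G_rho_t s u i =
     (if i = 0 then theta \<cdot>\<^sub>m 1\<^sub>m (total_dim s) + G_N s
      else if i = 1 then G_E s u else 0\<^sub>m (total_dim s) (total_dim s))"

definition G_mod :: "nat list \<Rightarrow> 'f::finite_field kbar list \<Rightarrow> 'f tmodule" where
  "G_mod s u = tmodule_of (total_dim s) (G_rho_t s u)"

definition v_point :: "nat list \<Rightarrow> 'f::finite_field kbar list \<Rightarrow> 'f kbar vec" where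
  "v_point s u = vec (total_dim s) (\<lambda>i.
     \<Sum>l<length s. if i = block_offset s l + block_dim s l - 1
       then (-1) ^ (length s - 1 - l) * (\<Prod>e\<in>{l..<length s}. u ! e) else 0)"


section \<open>v-adic CMSPLs and v-adic MZVs\<close>

definition tilde_G :: "nat list \<Rightarrow> 'f::finite_field poly list \<Rightarrow> 'f tmodule" where
  "tilde_G t w = G_mod (rev t) (rev (map A_to_kbar w))"

definition tilde_v :: "nat list \<Rightarrow> 'f::finite_field poly list \<Rightarrow> 'f kbar vec" where
  "tilde_v t w = v_point (rev t) (rev (map A_to_kbar w))"

text \<open>A multiplier \<open>c\<close> as required exists, and the value does not depend on its choice.\<close>

definition Li_star ::
  "('f::finite_field kbar \<Rightarrow> 'c::{field,complete_space}) \<Rightarrow> nat list \<Rightarrow> 'f poly list \<Rightarrow> 'c" where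
  "Li_star \<iota> t w =
     (let G = tilde_G t w;
          x = (\<lambda>c. map_vec \<iota> (tm_act G c (tilde_v t w)));
          c = (SOME c. c \<noteq> 0 \<and> vabs_vec (x c) < 1 \<and> log_converges \<iota> G (x c))
      in (-1) ^ (length t - 1) / \<iota> (A_to_kbar c) * log_value \<iota> G (x c) $ (sum_list t - 1))"

datatype separator = Comma | Plus

text \<open>\<open>join_adjacent (+) P s\<close> is \<open>P(s)\<close>, and \<open>join_adjacent (*) P u\<close> is \<open>P\<^sup>\<times>(u)\<close>.\<close>

fun join_adjacent :: "('a \<Rightarrow> 'a \<Rightarrow> 'a) \<Rightarrow> separator list \<Rightarrow> 'a list \<Rightarrow> 'a list" where
  "join_adjacent f (Comma # P) (x # y # xs) = x # join_adjacent f P (y # xs)"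
| "join_adjacent f (Plus # P) (x # y # xs) = join_adjacent f P (f x y # xs)"
| "join_adjacent f _ xs = xs"

definition S_set :: "nat \<Rightarrow> separator list set" where
  "S_set n = {P. length P = n}"

definition AT_entry :: "'f::finite_field itself \<Rightarrow> nat list \<Rightarrow> nat \<Rightarrow> 'f poly poly" where
  "AT_entry _ s i = AT_H (s ! i - 1)"

definition J_set :: "'f::finite_field itself \<Rightarrow> nat list \<Rightarrow> nat list set" where
  "J_set F s = {j. length j = length s \<and> (\<forall>i<length s. j ! i \<le> degree (AT_entry F s i))}"

definition u_tuple :: "nat list \<Rightarrow> nat list \<Rightarrow> 'f::finite_field poly list" where
  "u_tuple s j = map (\<lambda>i. coeff (AT_entry TYPE('f) s i) (j ! i)) [0..<length s]"

definition a_mono :: "nat list \<Rightarrow> 'f::finite_field poly" where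
  "a_mono j = monom 1 (sum_list j)"

definition zeta_v ::
  "('f::finite_field kbar \<Rightarrow> 'c::{field,complete_space}) \<Rightarrow> nat list \<Rightarrow> 'c" where
  "zeta_v \<iota> s = inverse (\<iota> (A_to_kbar (Gamma_list s))) *
     (\<Sum>j \<in> J_set TYPE('f) s. \<Sum>P \<in> S_set (length s - 1).
        (-1) ^ (length s - 1) * \<iota> (A_to_kbar (a_mono j)) *
        (-1) ^ (length (join_adjacent (+) P s) - 1) *
        Li_star \<iota> (join_adjacent (+) P s) (join_adjacent (*) P (u_tuple s j)))"


section \<open>Gluing: the t-module and point attached to \<open>s\<close>\<close>

definition summand_G :: "nat list \<Rightarrow> nat list \<times> separator list \<Rightarrow> 'f::finite_field tmodule" where
  "summand_G s = (\<lambda>(j, P). tilde_G (join_adjacent (+) P s) (join_adjacent (*) P (u_tuple s j)))"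

definition summand_v :: "nat list \<Rightarrow> nat list \<times> separator list \<Rightarrow> 'f::finite_field kbar vec" where
  "summand_v s = (\<lambda>(j, P). tilde_v (join_adjacent (+) P s) (join_adjacent (*) P (u_tuple s j)))"

definition summand_b :: "nat list \<Rightarrow> nat list \<times> separator list \<Rightarrow> 'f::finite_field poly" where
  "summand_b s = (\<lambda>(j, P). (-1) ^ (length s - 1) * a_mono j)"

text \<open>
  For \<open>d \<times> d\<close> matrices \<open>M\<^sub>l\<close> whose upper left \<open>n \<times> n\<close> blocks all agree and whose lower left blocks vanish,
  \<open>glue_mat n [M\<^sub>1, \<dots>, M\<^sub>T]\<close> has the common block, the upper right blocks side by side, and the lower
  right blocks on the diagonal.
\<close>

definition right_block :: "nat \<Rightarrow> 'a mat \<Rightarrow> 'a mat" where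
  "right_block n M = mat n (dim_col M - n) (\<lambda>(i, j). M $$ (i, n + j))"

definition lower_block :: "nat \<Rightarrow> 'a mat \<Rightarrow> 'a mat" where
  "lower_block n M = mat (dim_row M - n) (dim_col M - n) (\<lambda>(i, j). M $$ (n + i, n + j))"

definition hconcat :: "nat \<Rightarrow> 'a::zero mat list \<Rightarrow> 'a mat" where
  "hconcat n Xs = mat_of_cols n (concat (map cols Xs))"

definition glue_mat :: "nat \<Rightarrow> 'a::zero mat list \<Rightarrow> 'a mat" where
  "glue_mat n Ms =
     (let R = mat n n (\<lambda>ij. hd Ms $$ ij);
          U = hconcat n (map (right_block n) Ms);
          L = diag_block_mat (map (lower_block n) Ms)
      in four_block_mat R U (0\<^sub>m (dim_row L) n) L)"

definition glue_tmodule :: "nat \<Rightarrow> 'f::finite_field tmodule list \<Rightarrow> 'f tmodule" where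
  "glue_tmodule n Gs =
     tmodule_of (n + (\<Sum>G\<leftarrow>Gs. tm_dim G - n))
       (\<lambda>i. glue_mat n (map (\<lambda>G. tm_rho G [:0, 1:] i) Gs))"

definition glue_vec :: "nat \<Rightarrow> 'a::comm_monoid_add vec list \<Rightarrow> 'a vec" where
  "glue_vec n zs = vec n (\<lambda>i. \<Sum>z\<leftarrow>zs. z $ i) @\<^sub>v
     vec_of_list (concat (map (\<lambda>z. drop n (list_of_vec z)) zs))"

text \<open>\<open>ix\<close> lists the indices \<open>(j, P)\<close> in the order \<open>l = 1, \<dots>, T\<close>.\<close>

definition MZV_module :: "nat list \<Rightarrow> (nat list \<times> separator list) list \<Rightarrow> 'f::finite_field tmodule" where
  "MZV_module s ix = glue_tmodule (sum_list s) (map (summand_G s) ix)"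

definition MZV_point :: "nat list \<Rightarrow> (nat list \<times> separator list) list \<Rightarrow> 'f::finite_field kbar vec" where
  "MZV_point s ix = glue_vec (sum_list s)
     (map (\<lambda>l. tm_act (summand_G s l) (summand_b s l) (summand_v s l)) ix)"

end

theory Submission
  imports Defs
begin

text \<open>
  Write \<open>\<lambda>(x)\<close> for the \<open>n\<close>-th coordinate of \<open>log\<^sub>G(x)\<^sub>v\<close>, where \<open>|x|\<^sub>v < 1\<close>. Comparing coefficients in
  \<open>log\<^sub>G \<rho>\<^sub>t = \<partial>\<rho>\<^sub>t log\<^sub>G\<close> gives a Sylvester equation for each coefficient of the logarithm, with a
  nilpotent part and the scalar \<open>\<theta>\<^sup>q\<^sup>^\<^sup>i - \<theta>\<close>. As this scalar is divisible by \<open>v\<close> at most once, the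
  coefficients grow at most geometrically, so the series converges for \<open>|x|\<^sub>v < 1\<close>; and as the \<open>n\<close>-th row of
  \<open>\<partial>\<rho>\<^sub>t\<close> is \<open>\<theta>\<close> times a unit vector, \<open>\<lambda>([a] x) = a(\<theta>) \<lambda>(x)\<close>.

  The coordinate embeddings of the summands \<open>G\<^sub>l\<close> into the glued module are morphisms of t-modules, and
  \<open>\<lambda>\<close> restricts along them to \<open>\<lambda>\<^sub>l\<close>. Multiplying the glued point by some \<open>c\<close> that makes all \<open>[c] v\<^sub>l\<close> small
  (it exists because the points reduce to torsion modulo \<open>v\<close>) therefore gives
  \<open>c(\<theta>) \<lambda>([a] v\<^sub>s) = a(\<theta>) \<Sum>\<^sub>l b\<^sub>l \<lambda>\<^sub>l([c] v\<^sub>l)\<close>, and the right-hand side is the defining sum of \<open>\<zeta>\<^sub>A(s)\<^sub>v\<close>.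
\<close>

text \<open>Exponential and logarithm are given only by definite descriptions. Both are intertwiners
  between \<open>\<theta> + N + E \<tau>\<close> and its constant part \<open>\<theta> + N\<close>,
  in opposite directions, so one existence and uniqueness result for intertwiners with constant term
  1 yields both series and makes them mutually inverse. The growth is geometric because in the
  recursion for the logarithm the Frobenius falls on E, whose entries lie in A, and never on the
  preceding coefficient, as it does for the exponential. Each coefficient costs at most 2 d
  divisions by theta^(q^n) - theta, whence the constant \<open>\<beta> ^ (2 * d)\<close>; the
  exponent q^n of the coordinates of x beats any such rate. The number n is the size of the first
  Jordan block of every summand. On that block neither N nor E depends on the tuple u, which is why
  the summands can be glued along it, and its last row is where N vanishes.\<close>

lemma card_finite_field_gt_1: "CARD('f::finite_field) > 1"
proof -
  have "card {0, 1 :: 'f} \<le> CARD('f)"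
    by (rule card_mono) auto
  then show ?thesis by simp
qed

text \<open>\<open>(X + 1)\<^sup>q - X\<^sup>q - 1\<close> has degree less than \<open>q\<close> and vanishes at all \<open>q\<close> elements of the field.\<close>

lemma of_nat_choose_card_eq_0:
  assumes "0 < k" "k < CARD('f::finite_field)"
  shows "of_nat (CARD('f) choose k) = (0 :: 'f)"
proof -
  define q where "q = CARD('f)"
  have q: "q > 1" unfolding q_def by (rule card_finite_field_gt_1)
  define p :: "'f poly" where "p = [:1, 1:] ^ q - monom 1 q - 1"
  have cX: "coeff ([:1, 1:] ^ q :: 'f poly) i = of_nat (q choose i)" for i
  proof -
    have "([:1, 1:] ^ q :: 'f poly) = (monom 1 1 + 1) ^ q"
      by (simp add: monom_altdef one_pCons)
    also have "\<dots> = (\<Sum>k\<le>q. of_nat (q choose k) * monom 1 k)"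
      by (simp add: binomial_ring monom_power)
    also have "coeff \<dots> i = (\<Sum>k\<le>q. if k = i then of_nat (q choose k) else 0)"
      unfolding coeff_sum by (rule sum.cong) (auto simp: of_nat_poly)
    also have "\<dots> = of_nat (q choose i)" by (auto simp: binomial_eq_0)
    finally show ?thesis .
  qed
  have root: "poly p x = 0" for x
  proof -
    have "(1 + x) ^ q = 1 + x" "x ^ q = x"
      unfolding q_def by (rule finite_field_power_card_eq_same)+
    then show ?thesis by (simp add: p_def poly_monom)
  qed
  have "p = 0"
  proof (rule ccontr)
    assume p0: "p \<noteq> 0"
    have "coeff p i = 0" if "i \<ge> q" for i
      using that q by (cases "i = q") (auto simp: p_def cX binomial_eq_0)
    then have "degree p < q" using p0 by (metis leading_coeff_neq_0 not_le)
    moreover have "card {x. poly p x = 0} \<le> degree p"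
      using p0 by (rule card_poly_roots_bound)
    ultimately show False using root by (simp add: q_def)
  qed
  then have "coeff p k = 0" by simp
  then show ?thesis using assms unfolding p_def q_def[symmetric] by (simp add: cX)
qed

section \<open>The embedding of A and Frobenius powers on \<open>kbar\<close>\<close>

lemma A_to_kbar_hom [simp]:
  "A_to_kbar 0 = 0" "A_to_kbar 1 = 1" "A_to_kbar (f + g) = A_to_kbar f + A_to_kbar g"
  "A_to_kbar (f - g) = A_to_kbar f - A_to_kbar g" "A_to_kbar (- f) = - A_to_kbar f"
  "A_to_kbar (f * g) = A_to_kbar f * A_to_kbar g"
  by (simp_all add: A_to_kbar_def)

lemma A_to_kbar_power [simp]: "A_to_kbar (f ^ n) = A_to_kbar f ^ n"
  by (induction n) simp_all

lemma A_to_kbar_of_nat: "A_to_kbar (of_nat n) = of_nat n"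
  by (induction n) simp_all

lemma A_to_kbar_eq_iff [simp]: "A_to_kbar f = A_to_kbar g \<longleftrightarrow> f = g"
  by (simp add: A_to_kbar_def)

lemma A_to_kbar_eq_0_iff [simp]: "A_to_kbar f = 0 \<longleftrightarrow> f = 0"
  using A_to_kbar_eq_iff[of f 0] by simp

text \<open>Binomial theorem at exponent q, then iteration. The middle binomial coefficients vanish
  in F_q; \<open>c0\<close> carries this over to \<open>kbar\<close> through constant
  polynomials.\<close>

lemma frob_add:
  fixes x y :: "'f::finite_field kbar"
  shows "(x + y) ^ (CARD('f) ^ i) = x ^ (CARD('f) ^ i) + y ^ (CARD('f) ^ i)"
proof (induction i)
  case (Suc i)
  define q where "q = CARD('f)"
  have q: "q > 1" unfolding q_def by (rule card_finite_field_gt_1)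
  have c0: "of_nat (q choose k) = (0 :: 'f kbar)" if "0 < k" "k < q" for k
  proof -
    have "of_nat (q choose k) = [:of_nat (q choose k) :: 'f:]" by (simp add: of_nat_poly)
    also have "\<dots> = 0" using of_nat_choose_card_eq_0[where 'f = 'f] that unfolding q_def by simp
    finally show ?thesis by (metis A_to_kbar_of_nat A_to_kbar_hom(1))
  qed
  have one: "(x + y) ^ q = x ^ q + y ^ q" for x y :: "'f kbar"
  proof -
    have "(x + y) ^ q = (\<Sum>k\<le>q. of_nat (q choose k) * x ^ k * y ^ (q - k))"
      by (rule binomial_ring)
    also have "\<dots> = (\<Sum>k\<in>{0, q}. of_nat (q choose k) * x ^ k * y ^ (q - k))"
      by (rule sum.mono_neutral_right) (use c0 in auto)
    finally show ?thesis using q by (simp add: add.commute)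
  qed
  have "(x + y) ^ (q ^ Suc i) = ((x + y) ^ (q ^ i)) ^ q"
    by (metis power_Suc2 power_mult)
  also have "\<dots> = (x ^ (q ^ i)) ^ q + (y ^ (q ^ i)) ^ q"
    using Suc one by (simp add: q_def)
  also have "\<dots> = x ^ (q ^ Suc i) + y ^ (q ^ Suc i)"
    by (metis power_Suc2 power_mult)
  finally show ?case by (simp add: q_def)
qed simp

lemma frob_zero [simp]: "(0 :: 'f::finite_field kbar) ^ (CARD('f) ^ i) = 0"
  using card_finite_field_gt_1[where 'f = 'f] by (simp add: power_0_left)

lemma frob_zero_1 [simp]: "(0 :: 'f::finite_field kbar) ^ CARD('f) = 0"
  using frob_zero[of 1] by simp

lemma frob_sum:
  fixes f :: "'a \<Rightarrow> 'f::finite_field kbar"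
  shows "(\<Sum>x\<in>A. f x) ^ (CARD('f) ^ i) = (\<Sum>x\<in>A. f x ^ (CARD('f) ^ i))"
  by (induction A rule: infinite_finite_induct) (simp_all add: frob_add)

lemma frob_sum_1:
  fixes f :: "'a \<Rightarrow> 'f::finite_field kbar"
  shows "(\<Sum>x\<in>A. f x) ^ CARD('f) = (\<Sum>x\<in>A. f x ^ CARD('f))"
  using frob_sum[of f A 1] by simp

lemma frob_frob:
  fixes x :: "'f::finite_field kbar"
  shows "(x ^ (CARD('f) ^ i)) ^ (CARD('f) ^ j) = x ^ (CARD('f) ^ (i + j))"
  by (simp add: power_add power_mult)

text \<open>Elements of F_q are fixed by the Frobenius, hence commute with \<open>\<tau>\<close>.
  This lets the coefficients of an acting polynomial pass through twisted products and
  logarithms.\<close>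

lemma frob_scalar [simp]:
  "A_to_kbar [:c::'f::finite_field:] ^ (CARD('f) ^ i) = A_to_kbar [:c:]"
proof -
  have "[:c:] ^ (CARD('f) ^ i) = [:c ^ (CARD('f) ^ i):]" by (simp add: poly_const_pow)
  also have "\<dots> = [:c:]" by (simp add: finite_field_power_card_power_eq_same)
  finally show ?thesis by (metis A_to_kbar_power)
qed

lemma frob_0_1:
  fixes x :: "'f::finite_field kbar"
  assumes "x \<in> {0, 1}"
  shows "x ^ (CARD('f) ^ i) = x"
  using assms by auto

text \<open>Places the scalar of the Sylvester equation in A, where its nonvanishing and its
  divisibility by v can be read off.\<close>

lemma theta_frob_sub: "theta ^ (CARD('f) ^ i) - theta = A_to_kbar (monom 1 (CARD('f) ^ i) - monom (1::'f::finite_field) 1)"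
  by (simp add: theta_def monom_altdef)

text \<open>Fixed points are the solutions of \<open>\<delta> U = N U - U N - C\<close>. Matrices
  are given by their entry functions, so that iterates carry no dimension conditions.\<close>

definition sylv :: "nat \<Rightarrow> (nat \<Rightarrow> nat \<Rightarrow> 'a::field) \<Rightarrow> 'a \<Rightarrow> (nat \<Rightarrow> nat \<Rightarrow> 'a) \<Rightarrow> (nat \<Rightarrow> nat \<Rightarrow> 'a) \<Rightarrow> nat \<Rightarrow> nat \<Rightarrow> 'a" where
  "sylv d N \<delta> C U = (\<lambda>i j. ((\<Sum>k<d. N i k * U k j) - (\<Sum>k<d. U i k * N k j) - C i j) / \<delta>)"

text \<open>By strict triangularity of N, entry (i, j) reads U only below it in its column and to
  its left in its row. At these places \<open>d - i + j\<close> is smaller; this is the measure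
  behind the next two inductions.\<close>

lemma sylv_cong:
  assumes up: "\<And>i j. i < d \<Longrightarrow> j \<le> i \<Longrightarrow> N i j = 0"
    and ij: "i < d" "j < d"
    and eq: "\<And>k. i < k \<Longrightarrow> k < d \<Longrightarrow> U k j = Y k j" "\<And>k. k < j \<Longrightarrow> U i k = Y i k"
  shows "sylv d N \<delta> C U i j = sylv d N \<delta> C Y i j"
proof -
  have "N i k * U k j = N i k * Y k j" if "k < d" for k
    using that up[of i k] eq(1)[of k] ij by (cases "k \<le> i") auto
  then have 1: "(\<Sum>k<d. N i k * U k j) = (\<Sum>k<d. N i k * Y k j)" by (intro sum.cong) auto
  have "U i k * N k j = Y i k * N k j" if "k < d" for k
    using that up[of k j] eq(2)[of k] ij by (cases "j \<le> k") auto
  then have 2: "(\<Sum>k<d. U i k * N k j) = (\<Sum>k<d. Y i k * N k j)" by (intro sum.cong) auto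
  show ?thesis by (simp only: sylv_def 1 2)
qed

lemma sylv_iter_stable:
  assumes up: "\<And>i j. i < d \<Longrightarrow> j \<le> i \<Longrightarrow> N i j = 0"
  shows "i < d \<Longrightarrow> j < d \<Longrightarrow> d - i + j \<le> m \<Longrightarrow>
    (sylv d N \<delta> C ^^ Suc m) Z i j = (sylv d N \<delta> C ^^ m) Z i j"
proof (induction m arbitrary: i j)
  case (Suc m)
  have "sylv d N \<delta> C ((sylv d N \<delta> C ^^ Suc m) Z) i j = sylv d N \<delta> C ((sylv d N \<delta> C ^^ m) Z) i j"
    by (rule sylv_cong[OF up]) (use Suc in auto)
  then show ?case by simp
qed auto

lemma sylv_unique:
  assumes up: "\<And>i j. i < d \<Longrightarrow> j \<le> i \<Longrightarrow> N i j = 0"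
    and U: "\<And>i j. i < d \<Longrightarrow> j < d \<Longrightarrow> U i j = sylv d N \<delta> C U i j"
    and Y: "\<And>i j. i < d \<Longrightarrow> j < d \<Longrightarrow> Y i j = sylv d N \<delta> C Y i j"
  shows "i < d \<Longrightarrow> j < d \<Longrightarrow> U i j = Y i j"
proof (induction "d - i + j" arbitrary: i j rule: less_induct)
  case less
  have "sylv d N \<delta> C U i j = sylv d N \<delta> C Y i j"
    by (rule sylv_cong[OF up]) (use less in auto)
  then show ?case using U[of i j] Y[of i j] less.prems by simp
qed

text \<open>As \<open>N\<close> is strictly upper triangular, the iteration is stationary after \<open>2 d\<close> steps.\<close>

definition sylv_sol :: "nat \<Rightarrow> (nat \<Rightarrow> nat \<Rightarrow> 'a::field) \<Rightarrow> 'a \<Rightarrow> (nat \<Rightarrow> nat \<Rightarrow> 'a) \<Rightarrow> nat \<Rightarrow> nat \<Rightarrow> 'a" where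
  "sylv_sol d N \<delta> C = (sylv d N \<delta> C ^^ (2 * d)) (\<lambda>_ _. 0)"

text \<open>For i, j < d the measure \<open>d - i + j\<close> is less than 2 d, so
  \<open>sylv_iter_stable\<close> applies to the last iterate.\<close>

lemma sylv_sol:
  assumes up: "\<And>i j. i < d \<Longrightarrow> j \<le> i \<Longrightarrow> N i j = 0" and "i < d" "j < d"
  shows "sylv_sol d N \<delta> C i j = sylv d N \<delta> C (sylv_sol d N \<delta> C) i j"
  using sylv_iter_stable[of d N i j "2 * d" \<delta> C "\<lambda>_ _. 0"] assms by (simp add: sylv_sol_def)

section \<open>Twisted series\<close>

abbreviation tw_carrier :: "nat \<Rightarrow> 'f::finite_field twisted \<Rightarrow> bool" where
  "tw_carrier d P \<equiv> (\<forall>n. P n \<in> carrier_mat d d)"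

lemma tw_carrier_mult [simp]: "tw_mult d P Q n \<in> carrier_mat d d"
  by (simp add: tw_mult_def)

lemma tw_carrier_const [simp]: "M \<in> carrier_mat d d \<Longrightarrow> tw_const d M n \<in> carrier_mat d d"
  by (simp add: tw_const_def)

lemma tw_carrier_power [simp]: "tw_power d P k n \<in> carrier_mat d d"
  by (cases k) simp_all

lemma tw_mult_index:
  fixes P Q :: "'f::finite_field twisted"
  assumes "tw_carrier d P" "tw_carrier d Q" "i < d" "j < d"
  shows "tw_mult d P Q n $$ (i, j) = (\<Sum>m\<le>n. \<Sum>k<d. P m $$ (i, k) * Q (n - m) $$ (k, j) ^ (CARD('f) ^ m))"
proof -
  have "(P m * map_mat (\<lambda>z. z ^ (CARD('f) ^ m)) (Q (n - m))) $$ (i, j)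
      = (\<Sum>k<d. P m $$ (i, k) * Q (n - m) $$ (k, j) ^ (CARD('f) ^ m))" for m
  proof -
    have "P m \<in> carrier_mat d d" "Q (n - m) \<in> carrier_mat d d" using assms by auto
    then show ?thesis
      using assms(3,4) by (auto simp: scalar_prod_def lessThan_atLeast0 intro!: sum.cong)
  qed
  then show ?thesis using assms(3,4) by (simp add: tw_mult_def)
qed

lemma tw_eqI:
  assumes "tw_carrier d P" "tw_carrier d Q"
    and "\<And>n i j. i < d \<Longrightarrow> j < d \<Longrightarrow> P n $$ (i, j) = Q n $$ (i, j)"
  shows "P = Q"
proof
  fix n
  have "P n \<in> carrier_mat d d" "Q n \<in> carrier_mat d d" using assms by auto
  then show "P n = Q n" using assms(3) by (intro eq_matI) auto
qed

text \<open>Twists compose, so both sides are the sum of the same expression \<open>g l m\<close>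
  over l + m \<le> n, taken in different orders.\<close>

lemma tw_mult_assoc:
  fixes P Q R :: "'f::finite_field twisted"
  assumes c: "tw_carrier d P" "tw_carrier d Q" "tw_carrier d R"
  shows "tw_mult d (tw_mult d P Q) R = tw_mult d P (tw_mult d Q R)"
proof (rule tw_eqI)
  fix n i j assume ij: "i < d" "j < d"
  define g where "g l m = (\<Sum>h<d. \<Sum>k<d. P l $$ (i, h) * Q m $$ (h, k) ^ (CARD('f) ^ l)
      * R (n - (l + m)) $$ (k, j) ^ (CARD('f) ^ (l + m)))" for l m
  have "tw_mult d (tw_mult d P Q) R n $$ (i, j) = (\<Sum>m\<le>n. \<Sum>k<d.
      (\<Sum>l\<le>m. \<Sum>h<d. P l $$ (i, h) * Q (m - l) $$ (h, k) ^ (CARD('f) ^ l)) * R (n - m) $$ (k, j) ^ (CARD('f) ^ m))"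
    using c ij by (subst tw_mult_index) (simp_all add: tw_mult_index[OF c(1,2)])
  also have "\<dots> = (\<Sum>m\<le>n. \<Sum>l\<le>m. g l (m - l))"
  proof (rule sum.cong[OF refl])
    fix m
    have "(\<Sum>k<d. (\<Sum>l\<le>m. \<Sum>h<d. P l $$ (i, h) * Q (m - l) $$ (h, k) ^ (CARD('f) ^ l)) * R (n - m) $$ (k, j) ^ (CARD('f) ^ m))
       = (\<Sum>k<d. \<Sum>l\<le>m. \<Sum>h<d. P l $$ (i, h) * Q (m - l) $$ (h, k) ^ (CARD('f) ^ l) * R (n - m) $$ (k, j) ^ (CARD('f) ^ m))"
      by (simp add: sum_distrib_right)
    also have "\<dots> = (\<Sum>l\<le>m. \<Sum>k<d. \<Sum>h<d. P l $$ (i, h) * Q (m - l) $$ (h, k) ^ (CARD('f) ^ l) * R (n - m) $$ (k, j) ^ (CARD('f) ^ m))"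
      by (rule sum.swap)
    also have "\<dots> = (\<Sum>l\<le>m. g l (m - l))"
      unfolding g_def by (rule sum.cong[OF refl], subst sum.swap) simp
    finally show "(\<Sum>k<d. (\<Sum>l\<le>m. \<Sum>h<d. P l $$ (i, h) * Q (m - l) $$ (h, k) ^ (CARD('f) ^ l)) * R (n - m) $$ (k, j) ^ (CARD('f) ^ m))
      = (\<Sum>l\<le>m. g l (m - l))" .
  qed
  also have "\<dots> = (\<Sum>(l, m)\<in>{(l, m). l + m \<le> n}. g l m)"
    by (rule sum.triangle_reindex_eq[symmetric])
  also have "{(l, m). l + m \<le> n} = Sigma {..n} (\<lambda>l. {..n - l})"
    by auto
  also have "(\<Sum>(l, m)\<in>Sigma {..n} (\<lambda>l. {..n - l}). g l m) = (\<Sum>l\<le>n. \<Sum>m\<le>n - l. g l m)"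
    by (rule sum.Sigma[symmetric]) auto
  also have "\<dots> = tw_mult d P (tw_mult d Q R) n $$ (i, j)"
  proof -
    have "(\<Sum>m\<le>n - l. g l m) = (\<Sum>h<d. P l $$ (i, h) * tw_mult d Q R (n - l) $$ (h, j) ^ (CARD('f) ^ l))" for l
    proof -
      have "(\<Sum>m\<le>n - l. g l m) = (\<Sum>h<d. \<Sum>m\<le>n - l. \<Sum>k<d. P l $$ (i, h) * Q m $$ (h, k) ^ (CARD('f) ^ l)
      * R (n - (l + m)) $$ (k, j) ^ (CARD('f) ^ (l + m)))"
        unfolding g_def by (rule sum.swap)
      also have "\<dots> = (\<Sum>h<d. P l $$ (i, h) * tw_mult d Q R (n - l) $$ (h, j) ^ (CARD('f) ^ l))"
        using ij by (intro sum.cong refl)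
          (simp add: tw_mult_index[OF c(2,3)] frob_sum power_mult_distrib frob_frob sum_distrib_left mult.assoc add.commute)
      finally show ?thesis .
    qed
    then show ?thesis using c ij by (subst tw_mult_index) simp_all
  qed
  finally show "tw_mult d (tw_mult d P Q) R n $$ (i, j) = tw_mult d P (tw_mult d Q R) n $$ (i, j)" .
qed simp_all

lemma tw_const_mult_index:
  fixes Q :: "'f::finite_field twisted"
  assumes "M \<in> carrier_mat d d" "tw_carrier d Q" "i < d" "j < d"
  shows "tw_mult d (tw_const d M) Q n $$ (i, j) = (\<Sum>k<d. M $$ (i, k) * Q n $$ (k, j))"
proof -
  have "tw_mult d (tw_const d M) Q n $$ (i, j)
     = (\<Sum>m\<le>n. \<Sum>k<d. tw_const d M m $$ (i, k) * Q (n - m) $$ (k, j) ^ (CARD('f) ^ m))"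
    using assms by (subst tw_mult_index) simp_all
  also have "\<dots> = (\<Sum>m\<in>{0}. \<Sum>k<d. tw_const d M m $$ (i, k) * Q (n - m) $$ (k, j) ^ (CARD('f) ^ m))"
    by (rule sum.mono_neutral_right) (use assms in \<open>auto simp: tw_const_def\<close>)
  finally show ?thesis by (simp add: tw_const_def)
qed

lemma tw_mult_const_index:
  fixes Q :: "'f::finite_field twisted"
  assumes "M \<in> carrier_mat d d" "tw_carrier d Q" "i < d" "j < d"
  shows "tw_mult d Q (tw_const d M) n $$ (i, j) = (\<Sum>k<d. Q n $$ (i, k) * M $$ (k, j) ^ (CARD('f) ^ n))"
proof -
  have "tw_mult d Q (tw_const d M) n $$ (i, j)
     = (\<Sum>m\<le>n. \<Sum>k<d. Q m $$ (i, k) * tw_const d M (n - m) $$ (k, j) ^ (CARD('f) ^ m))"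
    using assms by (subst tw_mult_index) simp_all
  also have "\<dots> = (\<Sum>m\<in>{n}. \<Sum>k<d. Q m $$ (i, k) * tw_const d M (n - m) $$ (k, j) ^ (CARD('f) ^ m))"
    by (rule sum.mono_neutral_right) (use assms in \<open>auto simp: tw_const_def\<close>)
  finally show ?thesis by (simp add: tw_const_def)
qed

lemma tw_one_mult [simp]: "tw_carrier d Q \<Longrightarrow> tw_mult d (tw_const d (1\<^sub>m d)) Q = Q"
proof (rule tw_eqI)
  fix n i j assume a: "tw_carrier d Q" "i < d" "j < d"
  have "tw_mult d (tw_const d (1\<^sub>m d)) Q n $$ (i, j) = (\<Sum>k<d. 1\<^sub>m d $$ (i, k) * Q n $$ (k, j))"
    using a by (simp add: tw_const_mult_index)
  also have "\<dots> = (\<Sum>k<d. if k = i then Q n $$ (k, j) else 0)"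
    using a by (intro sum.cong) auto
  finally show "tw_mult d (tw_const d (1\<^sub>m d)) Q n $$ (i, j) = Q n $$ (i, j)" using a by simp
qed simp_all

lemma tw_mult_one [simp]:
  fixes Q :: "'f::finite_field twisted"
  shows "tw_carrier d Q \<Longrightarrow> tw_mult d Q (tw_const d (1\<^sub>m d)) = Q"
proof (rule tw_eqI)
  fix n i j assume a: "tw_carrier d Q" "i < d" "j < d"
  have "tw_mult d Q (tw_const d (1\<^sub>m d)) n $$ (i, j) = (\<Sum>k<d. Q n $$ (i, k) * 1\<^sub>m d $$ (k, j) ^ (CARD('f) ^ n))"
    using a by (intro tw_mult_const_index) simp_all
  also have "\<dots> = (\<Sum>k<d. if k = j then Q n $$ (i, k) else 0)"
    using a by (intro sum.cong) auto
  finally show "tw_mult d Q (tw_const d (1\<^sub>m d)) n $$ (i, j) = Q n $$ (i, j)" using a by simp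
qed simp_all

lemma tw_const_mult_const:
  assumes "M \<in> carrier_mat d d" "L \<in> carrier_mat d d"
  shows "tw_mult d (tw_const d M) (tw_const d L) = tw_const d (M * L)"
proof (rule tw_eqI)
  fix n i j assume a: "i < d" "j < d"
  show "tw_mult d (tw_const d M) (tw_const d L) n $$ (i, j) = tw_const d (M * L) n $$ (i, j)"
    using a assms by (simp add: tw_const_mult_index) (auto simp: tw_const_def scalar_prod_def lessThan_atLeast0)
qed (use assms in \<open>auto intro!: tw_carrier_const\<close>)

lemma tw_mult_0_index:
  assumes "tw_carrier d P" "tw_carrier d Q" 
  shows "tw_mult d P Q 0 = P 0 * Q 0"
proof (rule eq_matI)
  have c: "dim_row (P 0) = d" "dim_col (P 0) = d" "dim_row (Q 0) = d" "dim_col (Q 0) = d" using assms by auto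
  show "dim_row (tw_mult d P Q 0) = dim_row (P 0 * Q 0)" "dim_col (tw_mult d P Q 0) = dim_col (P 0 * Q 0)"
    using c by (auto simp: tw_mult_def)
  show "tw_mult d P Q 0 $$ (i, j) = (P 0 * Q 0) $$ (i, j)"
    if "i < dim_row (P 0 * Q 0)" "j < dim_col (P 0 * Q 0)" for i j
    using that c assms by (subst tw_mult_index) (auto simp: scalar_prod_def lessThan_atLeast0 intro!: sum.cong)
qed

section \<open>Standard t-modules\<close>

text \<open>\<open>\<rho>\<^sub>t = (\<theta> + N) + E \<tau>\<close>, where \<open>N\<close> is strictly upper triangular with entries 0 and 1.\<close>

definition std_tm :: "nat \<Rightarrow> 'f::finite_field twisted \<Rightarrow> bool" where
  "std_tm d T \<longleftrightarrow> tw_carrier d T \<and> (\<forall>n\<ge>2. T n = 0\<^sub>m d d) \<and>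
     (\<forall>i<d. \<forall>j<d. T 0 $$ (i, j) = (if i = j then theta else 0) \<or> i < j \<and> T 0 $$ (i, j) = 1)"

text \<open>The cut-off at i < j makes strict triangularity hold for all indices and any T, as the
  lemmas on \<open>sylv\<close> want it.\<close>

definition nilpart :: "'f::finite_field twisted \<Rightarrow> nat \<Rightarrow> nat \<Rightarrow> 'f kbar" where
  "nilpart T i j = (if i < j then T 0 $$ (i, j) else 0)"

lemma std_tm_T0:
  assumes "std_tm d T" "i < d" "j < d"
  shows "T 0 $$ (i, j) = (if i = j then theta else 0) + nilpart T i j"
proof -
  have "T 0 $$ (i, j) = (if i = j then theta else 0) \<or> i < j \<and> T 0 $$ (i, j) = 1"
    using assms by (auto simp: std_tm_def)
  then show ?thesis by (auto simp: nilpart_def)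
qed

lemma nilpart_0_1: 
  assumes "std_tm d T" "i < d" "j < d"
  shows "nilpart T i j \<in> {0, 1}"
proof -
  have "T 0 $$ (i, j) = (if i = j then theta else 0) \<or> i < j \<and> T 0 $$ (i, j) = 1"
    using assms by (auto simp: std_tm_def)
  then show ?thesis by (auto simp: nilpart_def)
qed

text \<open>N has entries 0 and 1 and is fixed by the Frobenius. So the same N occurs on both sides
  of the Sylvester equation, and only the scalar theta is twisted.\<close>

lemma std_tm_T0_frob:
  fixes T :: "'f::finite_field twisted"
  assumes "std_tm d T" "i < d" "j < d"
  shows "T 0 $$ (i, j) ^ (CARD('f) ^ n) = (if i = j then theta ^ (CARD('f) ^ n) else 0) + nilpart T i j"
proof -
  have "nilpart T i j ^ (CARD('f) ^ n) = nilpart T i j"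
    using nilpart_0_1[OF assms] by (rule frob_0_1)
  then show ?thesis by (simp add: std_tm_T0[OF assms] frob_add)
qed

text \<open>Lets the constant part of T count as a standard module itself, so that exponential,
  logarithm and their composites all fall under the intertwiner lemmas.\<close>

lemma std_tm_const: "std_tm d T \<Longrightarrow> std_tm d (tw_const d (T 0))"
  by (auto simp: std_tm_def tw_const_def)

lemma std_mult_index:
  fixes Q :: "'f::finite_field twisted"
  assumes T: "std_tm d T" and "tw_carrier d Q" "i < d" "j < d"
  shows "tw_mult d T Q n $$ (i, j) = (\<Sum>k<d. T 0 $$ (i, k) * Q n $$ (k, j)) +
    (if n = 0 then 0 else \<Sum>k<d. T 1 $$ (i, k) * Q (n - 1) $$ (k, j) ^ CARD('f))"
proof -
  have c: "tw_carrier d T" and z: "\<And>n. n \<ge> 2 \<Longrightarrow> T n = 0\<^sub>m d d" using T by (auto simp: std_tm_def)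
  have "tw_mult d T Q n $$ (i, j) = (\<Sum>m\<le>n. \<Sum>k<d. T m $$ (i, k) * Q (n - m) $$ (k, j) ^ (CARD('f) ^ m))"
    using c assms by (subst tw_mult_index) simp_all
  also have "\<dots> = (\<Sum>m\<in>{..n} \<inter> {0, 1}. \<Sum>k<d. T m $$ (i, k) * Q (n - m) $$ (k, j) ^ (CARD('f) ^ m))"
  proof (rule sum.mono_neutral_right)
    show "\<forall>m\<in>{..n} - {..n} \<inter> {0, 1}. (\<Sum>k<d. T m $$ (i, k) * Q (n - m) $$ (k, j) ^ (CARD('f) ^ m)) = 0"
    proof
      fix m assume "m \<in> {..n} - {..n} \<inter> {0, 1}"
      then have "T m = 0\<^sub>m d d" by (intro z) auto
      then show "(\<Sum>k<d. T m $$ (i, k) * Q (n - m) $$ (k, j) ^ (CARD('f) ^ m)) = 0" using assms by simp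
    qed
  qed auto
  also have "{..n} \<inter> {0, 1} = (if n = 0 then {0} else {0, 1})" by auto
  finally show ?thesis by (simp split: if_splits)
qed

lemma mult_std_index:
  fixes Q :: "'f::finite_field twisted"
  assumes T: "std_tm d T" and "tw_carrier d Q" "i < d" "j < d"
  shows "tw_mult d Q T n $$ (i, j) = (\<Sum>k<d. Q n $$ (i, k) * T 0 $$ (k, j) ^ (CARD('f) ^ n)) +
    (if n = 0 then 0 else \<Sum>k<d. Q (n - 1) $$ (i, k) * T 1 $$ (k, j) ^ (CARD('f) ^ (n - 1)))"
proof -
  have c: "tw_carrier d T" and z: "\<And>n. n \<ge> 2 \<Longrightarrow> T n = 0\<^sub>m d d" using T by (auto simp: std_tm_def)
  have "tw_mult d Q T n $$ (i, j) = (\<Sum>m\<le>n. \<Sum>k<d. Q m $$ (i, k) * T (n - m) $$ (k, j) ^ (CARD('f) ^ m))"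
    using c assms by (subst tw_mult_index) simp_all
  also have "\<dots> = (\<Sum>m\<in>{..n} \<inter> {n, n - 1}. \<Sum>k<d. Q m $$ (i, k) * T (n - m) $$ (k, j) ^ (CARD('f) ^ m))"
  proof (rule sum.mono_neutral_right)
    show "\<forall>m\<in>{..n} - {..n} \<inter> {n, n - 1}. (\<Sum>k<d. Q m $$ (i, k) * T (n - m) $$ (k, j) ^ (CARD('f) ^ m)) = 0"
    proof
      fix m assume "m \<in> {..n} - {..n} \<inter> {n, n - 1}"
      then have "T (n - m) = 0\<^sub>m d d" by (intro z) auto
      then show "(\<Sum>k<d. Q m $$ (i, k) * T (n - m) $$ (k, j) ^ (CARD('f) ^ m)) = 0" using assms by simp
    qed
  qed auto
  also have "{..n} \<inter> {n, n - 1} = (if n = 0 then {n} else {n, n - 1})" by auto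
  finally show ?thesis by (simp split: if_splits)
qed

lemma theta_frob_ne:
  assumes "n > 0"
  shows "(theta :: 'f::finite_field kbar) ^ (CARD('f) ^ n) - theta \<noteq> 0"
proof -
  have "CARD('f) ^ n > 1"
    using card_finite_field_gt_1[where 'f = 'f] assms by (rule one_less_power)
  then have "monom 1 (CARD('f) ^ n) - monom (1::'f) 1 \<noteq> 0"
    by (metis coeff_diff coeff_monom diff_zero less_irrefl_nat one_neq_zero coeff_0)
  then show ?thesis by (simp add: theta_frob_sub)
qed

text \<open>The inhomogeneous term: what the coefficients of \<open>\<tau>\<close> in S and T
  contribute in degree n + 1. It involves only the preceding coefficient, here Y.\<close>

definition intertw_C :: "nat \<Rightarrow> 'f::finite_field twisted \<Rightarrow> 'f twisted \<Rightarrow> nat \<Rightarrow> 'f kbar mat \<Rightarrow> nat \<Rightarrow> nat \<Rightarrow> 'f kbar" where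
  "intertw_C d S T n Y i j = (\<Sum>k<d. Y $$ (i, k) * T 1 $$ (k, j) ^ (CARD('f) ^ n))
     - (\<Sum>k<d. S 1 $$ (i, k) * Y $$ (k, j) ^ CARD('f))"

text \<open>Comparing the coefficients of \<open>\<tau>\<^sup>n\<^sup>+\<^sup>1\<close> in \<open>S U = U T\<close> gives a Sylvester equation for \<open>U\<^sub>n\<^sub>+\<^sub>1\<close>.\<close>

lemma intertw_Suc_iff:
  fixes S T U :: "'f::finite_field twisted"
  assumes S: "std_tm d S" and T: "std_tm d T" and ST: "S 0 = T 0" and U: "tw_carrier d U"
    and ij: "i < d" "j < d"
  shows "tw_mult d S U (Suc n) $$ (i, j) = tw_mult d U T (Suc n) $$ (i, j) \<longleftrightarrow>
    U (Suc n) $$ (i, j) = sylv d (nilpart T) (theta ^ (CARD('f) ^ Suc n) - theta)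
      (intertw_C d S T n (U n)) (\<lambda>i j. U (Suc n) $$ (i, j)) i j"
proof -
  define \<delta> where "\<delta> = (theta :: 'f kbar) ^ (CARD('f) ^ Suc n) - theta"
  have \<delta>: "\<delta> \<noteq> 0" unfolding \<delta>_def by (rule theta_frob_ne) simp
  have 1: "(\<Sum>k<d. S 0 $$ (i, k) * U (Suc n) $$ (k, j)) =
      theta * U (Suc n) $$ (i, j) + (\<Sum>k<d. nilpart T i k * U (Suc n) $$ (k, j))"
  proof -
    have "(\<Sum>k<d. S 0 $$ (i, k) * U (Suc n) $$ (k, j)) = (\<Sum>k<d. (if k = i then theta * U (Suc n) $$ (k, j) else 0)
        + nilpart T i k * U (Suc n) $$ (k, j))"
      using ij by (intro sum.cong) (auto simp: ST std_tm_T0[OF T] algebra_simps)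
    then show ?thesis using ij by (simp add: sum.distrib)
  qed
  have 2: "(\<Sum>k<d. U (Suc n) $$ (i, k) * T 0 $$ (k, j) ^ (CARD('f) ^ Suc n)) =
      theta ^ (CARD('f) ^ Suc n) * U (Suc n) $$ (i, j) + (\<Sum>k<d. U (Suc n) $$ (i, k) * nilpart T k j)"
  proof -
    have "(\<Sum>k<d. U (Suc n) $$ (i, k) * T 0 $$ (k, j) ^ (CARD('f) ^ Suc n)) =
       (\<Sum>k<d. (if k = j then theta ^ (CARD('f) ^ Suc n) * U (Suc n) $$ (i, k) else 0)
        + U (Suc n) $$ (i, k) * nilpart T k j)"
      using ij by (intro sum.cong) (auto simp: std_tm_T0_frob[OF T] algebra_simps simp del: power_Suc)
    then show ?thesis using ij by (simp add: sum.distrib)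
  qed
  define x a b c e where "x = U (Suc n) $$ (i, j)"
    and "a = (\<Sum>k<d. nilpart T i k * U (Suc n) $$ (k, j))"
    and "b = (\<Sum>k<d. U (Suc n) $$ (i, k) * nilpart T k j)"
    and "c = (\<Sum>k<d. S 1 $$ (i, k) * U n $$ (k, j) ^ CARD('f))"
    and "e = (\<Sum>k<d. U n $$ (i, k) * T 1 $$ (k, j) ^ (CARD('f) ^ n))"
  have "tw_mult d S U (Suc n) $$ (i, j) = tw_mult d U T (Suc n) $$ (i, j) \<longleftrightarrow>
      theta * x + a + c = (\<delta> + theta) * x + b + e"
    using ij U by (simp add: std_mult_index[OF S] mult_std_index[OF T] 1 2[simplified] x_def a_def b_def c_def e_def \<delta>_def)
  also have "\<dots> \<longleftrightarrow> x * \<delta> = a - b - (e - c)" by (auto simp: algebra_simps)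
  also have "\<dots> \<longleftrightarrow> x = (a - b - (e - c)) / \<delta>" using \<delta> by (simp add: eq_divide_eq)
  finally show ?thesis
    by (simp add: sylv_def intertw_C_def x_def a_def b_def c_def e_def \<delta>_def)
qed

lemma nilpart_upper: "j \<le> i \<Longrightarrow> nilpart T i j = 0"
  by (simp add: nilpart_def)

text \<open>Each coefficient is determined by its predecessor through \<open>sylv_unique\<close>.
  This rigidity serves for the uniqueness of the exponential and for both identities that make the
  logarithm its inverse.\<close>

lemma intertw_unique:
  fixes S T U Y :: "'f::finite_field twisted"
  assumes S: "std_tm d S" and T: "std_tm d T" and ST: "S 0 = T 0"
    and U: "tw_carrier d U" "tw_mult d S U = tw_mult d U T"
    and Y: "tw_carrier d Y" "tw_mult d S Y = tw_mult d Y T" and "U 0 = Y 0"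
  shows "U = Y"
proof
  show "U n = Y n" for n
  proof (induction n)
    case (Suc n)
    let ?F = "sylv d (nilpart T) (theta ^ (CARD('f) ^ Suc n) - theta) (intertw_C d S T n (U n))"
    have "U (Suc n) $$ (i, j) = Y (Suc n) $$ (i, j)" if "i < d" "j < d" for i j
      using _ _ _ that
    proof (rule sylv_unique)
      show "U (Suc n) $$ (i, j) = ?F (\<lambda>i j. U (Suc n) $$ (i, j)) i j" if "i < d" "j < d" for i j
        using intertw_Suc_iff[OF S T ST U(1) that] U(2) by simp
      show "Y (Suc n) $$ (i, j) = ?F (\<lambda>i j. Y (Suc n) $$ (i, j)) i j" if "i < d" "j < d" for i j
        using intertw_Suc_iff[OF S T ST Y(1) that] Y(2) Suc by simp
    qed (simp add: nilpart_upper)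
    moreover have "U (Suc n) \<in> carrier_mat d d" "Y (Suc n) \<in> carrier_mat d d" using U Y by auto
    ultimately show ?case by (intro eq_matI) auto
  qed fact
qed

text \<open>The coefficients are built recursively from \<open>sylv_sol\<close>. The equation in
  degree 0 is outside the recursion and holds since \<open>U 0\<close> is the identity and
  \<open>S 0 = T 0\<close>.\<close>

lemma intertw_exists:
  fixes S T :: "'f::finite_field twisted"
  assumes S: "std_tm d S" and T: "std_tm d T" and ST: "S 0 = T 0"
  shows "\<exists>U. tw_carrier d U \<and> U 0 = 1\<^sub>m d \<and> tw_mult d S U = tw_mult d U T"
proof -
  define U where "U = rec_nat (1\<^sub>m d) (\<lambda>n Y. mat d d (\<lambda>(i, j).
    sylv_sol d (nilpart T) (theta ^ (CARD('f) ^ Suc n) - theta) (intertw_C d S T n Y) i j))"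
  have X0: "U 0 = 1\<^sub>m d" by (simp add: U_def)
  have XS: "U (Suc n) = mat d d (\<lambda>(i, j). sylv_sol d (nilpart T) (theta ^ (CARD('f) ^ Suc n) - theta)
      (intertw_C d S T n (U n)) i j)" for n by (simp add: U_def)
  have "U n \<in> carrier_mat d d" for n by (cases n) (simp_all add: X0 XS)
  then have U: "tw_carrier d U" by simp
  have "tw_mult d S U = tw_mult d U T"
  proof (rule tw_eqI)
    fix n i j assume ij: "i < d" "j < d"
    show "tw_mult d S U n $$ (i, j) = tw_mult d U T n $$ (i, j)"
    proof (cases n)
      case 0
      have c: "tw_carrier d S" "tw_carrier d T" using S T by (auto simp: std_tm_def)
      have "T 0 \<in> carrier_mat d d" using c by simp
      then have "T 0 * 1\<^sub>m d = 1\<^sub>m d * T 0" by simp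
      then show ?thesis
        by (simp add: 0 tw_mult_0_index[OF c(1) U] tw_mult_0_index[OF U c(2)] X0 ST)
    next
      case (Suc m)
      let ?F = "sylv d (nilpart T) (theta ^ (CARD('f) ^ Suc m) - theta) (intertw_C d S T m (U m))"
      let ?s = "sylv_sol d (nilpart T) (theta ^ (CARD('f) ^ Suc m) - theta) (intertw_C d S T m (U m))"
      have "U (Suc m) $$ (i, j) = ?F ?s i j"
        using sylv_sol[of d "nilpart T" i j] ij by (simp add: XS nilpart_upper)
      \<comment> \<open>The matrix entries agree with \<open>sylv_sol\<close> only at indices below
        d, hence the passage through \<open>sylv_cong\<close>.\<close>
      also have "\<dots> = ?F (\<lambda>i j. U (Suc m) $$ (i, j)) i j"
        using ij by (intro sylv_cong) (auto simp: XS nilpart_upper)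
      finally show ?thesis unfolding Suc using intertw_Suc_iff[OF S T ST U ij] by blast
    qed
  qed simp_all
  then show ?thesis using U X0 by blast
qed

section \<open>Exponential and logarithm\<close>

lemma tm_dim_tmodule_of [simp]: "tm_dim (tmodule_of d T) = d"
  by (simp add: tmodule_of_def)

lemma tm_rho_tmodule_of:
  "tm_rho (tmodule_of d T) a n = mat d d (\<lambda>rc. \<Sum>k\<le>degree a. A_to_kbar [:coeff a k:] * tw_power d T k n $$ rc)"
  by (simp add: tmodule_of_def)

lemma tw_carrier_rho [simp]: "tm_rho (tmodule_of d T) a n \<in> carrier_mat d d"
  by (simp add: tm_rho_tmodule_of)

lemma tm_rho_t:
  fixes T :: "'f::finite_field twisted"
  assumes "tw_carrier d T"
  shows "tm_rho (tmodule_of d T) [:0, 1:] = T"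
proof (rule tw_eqI)
  have "A_to_kbar [:1 :: 'f:] = 1" by (metis A_to_kbar_hom(2) one_pCons)
  then show "tm_rho (tmodule_of d T) [:0, 1:] n $$ (i, j) = T n $$ (i, j)" if "i < d" "j < d" for n i j
    using that assms by (simp add: tm_rho_tmodule_of)
qed (use assms in simp_all)

text \<open>Induction by associativity, using that taking constant coefficients is
  multiplicative.\<close>

lemma tw_power_intertw:
  fixes T :: "'f::finite_field twisted"
  assumes T: "tw_carrier d T" and Q: "tw_carrier d Q" and eq: "tw_mult d T Q = tw_mult d Q (tw_const d (T 0))"
  shows "tw_mult d (tw_power d T k) Q = tw_mult d Q (tw_const d (tw_power d T k 0))"
proof (induction k)
  case 0
  have "tw_power d T 0 0 = 1\<^sub>m d" by (simp add: tw_const_def)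
  then show ?case using Q by simp
next
  case (Suc k)
  let ?P = "tw_power d T k"
  have P: "tw_carrier d ?P" and T0: "T 0 \<in> carrier_mat d d" using T by simp_all
  have c: "tw_carrier d (tw_const d (T 0))" "tw_carrier d (tw_const d (?P 0))" using T0 by simp_all
  have "tw_mult d (tw_power d T (Suc k)) Q = tw_mult d T (tw_mult d ?P Q)"
    by (simp add: tw_mult_assoc[OF T P Q])
  also have "\<dots> = tw_mult d (tw_mult d T Q) (tw_const d (?P 0))"
    unfolding Suc by (rule tw_mult_assoc[OF T Q c(2), symmetric])
  also have "\<dots> = tw_mult d Q (tw_mult d (tw_const d (T 0)) (tw_const d (?P 0)))"
    unfolding eq by (rule tw_mult_assoc[OF Q c])
  also have "\<dots> = tw_mult d Q (tw_const d (tw_power d T (Suc k) 0))"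
    using T0 by (simp add: tw_const_mult_const tw_mult_0_index[OF T P])
  finally show ?case .
qed

text \<open>Reduces the condition on all a in \<open>tm_exp\<close> to a = t: the action of a is an
  F_q-combination of powers of T, and its coefficients pass through Q because they are
  Frobenius-fixed.\<close>

lemma tm_rho_intertw:
  fixes T :: "'f::finite_field twisted"
  assumes T: "tw_carrier d T" and Q: "tw_carrier d Q" and eq: "tw_mult d T Q = tw_mult d Q (tw_const d (T 0))"
  defines "G \<equiv> tmodule_of d T"
  shows "tw_mult d (tm_rho G a) Q = tw_mult d Q (tw_const d (tm_rho G a 0))"
proof (rule tw_eqI)
  fix n i j assume ij: "i < d" "j < d"
  let ?c = "\<lambda>l. A_to_kbar [:coeff a l:]"
  let ?P = "\<lambda>l. tw_power d T l"
  have "tw_mult d (tm_rho G a) Q n $$ (i, j)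
      = (\<Sum>m\<le>n. \<Sum>k<d. (\<Sum>l\<le>degree a. ?c l * ?P l m $$ (i, k)) * Q (n - m) $$ (k, j) ^ (CARD('f) ^ m))"
    using ij Q by (simp add: tw_mult_index G_def) (simp add: tm_rho_tmodule_of)
  also have "\<dots> = (\<Sum>m\<le>n. \<Sum>l\<le>degree a. \<Sum>k<d. ?c l * ?P l m $$ (i, k) * Q (n - m) $$ (k, j) ^ (CARD('f) ^ m))"
    unfolding sum_distrib_right by (rule sum.cong[OF refl], rule sum.swap)
  also have "\<dots> = (\<Sum>l\<le>degree a. \<Sum>m\<le>n. \<Sum>k<d. ?c l * ?P l m $$ (i, k) * Q (n - m) $$ (k, j) ^ (CARD('f) ^ m))"
    by (rule sum.swap)
  also have "\<dots> = (\<Sum>l\<le>degree a. ?c l * tw_mult d (?P l) Q n $$ (i, j))"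
    using ij Q by (simp add: tw_mult_index sum_distrib_left mult.assoc)
  also have "\<dots> = (\<Sum>l\<le>degree a. ?c l * tw_mult d Q (tw_const d (?P l 0)) n $$ (i, j))"
    by (simp add: tw_power_intertw[OF T Q eq])
  also have "\<dots> = (\<Sum>l\<le>degree a. ?c l * (\<Sum>k<d. Q n $$ (i, k) * ?P l 0 $$ (k, j) ^ (CARD('f) ^ n)))"
    using ij Q by (simp add: tw_mult_const_index)
  also have "\<dots> = (\<Sum>l\<le>degree a. \<Sum>k<d. Q n $$ (i, k) * (?c l * ?P l 0 $$ (k, j)) ^ (CARD('f) ^ n))"
    by (simp add: sum_distrib_left power_mult_distrib mult.left_commute)
  also have "\<dots> = (\<Sum>k<d. Q n $$ (i, k) * (\<Sum>l\<le>degree a. ?c l * ?P l 0 $$ (k, j)) ^ (CARD('f) ^ n))"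
    unfolding frob_sum sum_distrib_left by (rule sum.swap)
  also have "\<dots> = tw_mult d Q (tw_const d (tm_rho G a 0)) n $$ (i, j)"
    using ij Q by (simp add: tw_mult_const_index G_def) (simp add: tm_rho_tmodule_of)
  finally show "tw_mult d (tm_rho G a) Q n $$ (i, j) = tw_mult d Q (tw_const d (tm_rho G a 0)) n $$ (i, j)" .
qed simp_all

lemma tm_exp_tmodule_of:
  fixes T :: "'f::finite_field twisted"
  assumes std: "std_tm d T" and Q: "tw_carrier d Q" "Q 0 = 1\<^sub>m d" "tw_mult d T Q = tw_mult d Q (tw_const d (T 0))"
  shows "tm_exp (tmodule_of d T) = Q"
proof -
  have T: "tw_carrier d T" using std by (simp add: std_tm_def)
  show ?thesis
    unfolding tm_exp_def Let_def tm_dim_tmodule_of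
  proof (rule the_equality)
    show "tw_carrier d Q \<and> Q 0 = 1\<^sub>m d \<and> (\<forall>a. tw_mult d (tm_rho (tmodule_of d T) a) Q
        = tw_mult d Q (tw_const d (tm_rho (tmodule_of d T) a 0)))"
      using Q tm_rho_intertw[OF T Q(1,3)] by simp
    fix Q' assume Q': "tw_carrier d Q' \<and> Q' 0 = 1\<^sub>m d \<and> (\<forall>a. tw_mult d (tm_rho (tmodule_of d T) a) Q'
        = tw_mult d Q' (tw_const d (tm_rho (tmodule_of d T) a 0)))"
    then have "tw_mult d T Q' = tw_mult d Q' (tw_const d (T 0))"
      using tm_rho_t[OF T] by metis
    then show "Q' = Q"
      using Q Q' std_tm_const[OF std] 
      by - (rule intertw_unique[OF std, of "tw_const d (T 0)"], simp_all add: tw_const_def)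
  qed
qed

text \<open>Take intertwiners Q from the constant part to T and L back, both starting with the
  identity. Each composite intertwines a standard module with itself, as the identity does, so
  \<open>intertw_unique\<close> gives L Q = 1 = Q L. Since Q is the exponential, the description of
  the logarithm picks L.\<close>

lemma tm_log_intertw:
  fixes T :: "'f::finite_field twisted"
  assumes std: "std_tm d T"
  defines "P \<equiv> tm_log (tmodule_of d T)"
  shows "tw_carrier d P" "P 0 = 1\<^sub>m d" "tw_mult d (tw_const d (T 0)) P = tw_mult d P T"
proof -
  define T0 where "T0 = tw_const d (T 0)"
  have T: "tw_carrier d T" using std by (simp add: std_tm_def)
  have std0: "std_tm d T0" unfolding T0_def using std by (rule std_tm_const)
  have T0: "tw_carrier d T0" using std0 by (simp add: std_tm_def)
  have eq0: "T0 0 = T 0" by (simp add: T0_def tw_const_def)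
  obtain Q where Q: "tw_carrier d Q" "Q 0 = 1\<^sub>m d" "tw_mult d T Q = tw_mult d Q T0"
    using intertw_exists[OF std std0 eq0[symmetric]] by auto
  obtain L where L: "tw_carrier d L" "L 0 = 1\<^sub>m d" "tw_mult d T0 L = tw_mult d L T"
    using intertw_exists[OF std0 std eq0] by auto
  define I :: "'f twisted" where "I = tw_const d (1\<^sub>m d)"
  have I: "tw_carrier d I" "I 0 = 1\<^sub>m d" by (auto simp: I_def tw_const_def)
  have LQ: "tw_mult d L Q = I"
  proof (rule intertw_unique[OF std0 std0 refl])
    have "tw_mult d T0 (tw_mult d L Q) = tw_mult d (tw_mult d L T) Q"
      unfolding L(3)[symmetric] by (rule tw_mult_assoc[OF T0 L(1) Q(1), symmetric])
    also have "\<dots> = tw_mult d L (tw_mult d Q T0)"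
      unfolding Q(3)[symmetric] by (rule tw_mult_assoc[OF L(1) T Q(1)])
    also have "\<dots> = tw_mult d (tw_mult d L Q) T0"
      by (rule tw_mult_assoc[OF L(1) Q(1) T0, symmetric])
    finally show "tw_mult d T0 (tw_mult d L Q) = tw_mult d (tw_mult d L Q) T0" .
    show "tw_mult d L Q 0 = I 0" using L Q by (simp add: tw_mult_0_index I)
  qed (use T0 I in \<open>simp_all add: I_def\<close>)
  have QL: "tw_mult d Q L = I"
  proof (rule intertw_unique[OF std std refl])
    have "tw_mult d T (tw_mult d Q L) = tw_mult d (tw_mult d Q T0) L"
      unfolding Q(3)[symmetric] by (rule tw_mult_assoc[OF T Q(1) L(1), symmetric])
    also have "\<dots> = tw_mult d Q (tw_mult d L T)"
      unfolding L(3)[symmetric] by (rule tw_mult_assoc[OF Q(1) T0 L(1)])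
    also have "\<dots> = tw_mult d (tw_mult d Q L) T"
      by (rule tw_mult_assoc[OF Q(1) L(1) T, symmetric])
    finally show "tw_mult d T (tw_mult d Q L) = tw_mult d (tw_mult d Q L) T" .
    show "tw_mult d Q L 0 = I 0" using L Q by (simp add: tw_mult_0_index I)
  qed (use T I in \<open>simp_all add: I_def\<close>)
  have exp: "tm_exp (tmodule_of d T) = Q"
    using tm_exp_tmodule_of[OF std Q(1,2)] Q(3) by (simp add: T0_def)
  have "P = L"
    unfolding P_def tm_log_def Let_def tm_dim_tmodule_of exp
  proof (rule the_equality)
    fix P' assume P': "tw_carrier d P' \<and> tw_mult d P' Q = tw_const d (1\<^sub>m d) \<and> tw_mult d Q P' = tw_const d (1\<^sub>m d)"
    have "P' = tw_mult d P' I" using P' by (simp add: I_def)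
    also have "\<dots> = tw_mult d (tw_mult d P' Q) L"
      unfolding QL[symmetric] using P' Q L by (intro tw_mult_assoc[symmetric]) simp_all
    also have "\<dots> = L" using P' L(1) by simp
    finally show "P' = L" .
  qed (use L(1) LQ QL in \<open>simp add: I_def\<close>)
  then show "tw_carrier d P" "P 0 = 1\<^sub>m d" "tw_mult d (tw_const d (T 0)) P = tw_mult d P T"
    using L by (simp_all add: T0_def)
qed

text \<open>Entries in A, not just v-integral ones: the torsion argument reduces points modulo v
  inside \<open>'f poly\<close>. For \<open>T 0\<close> this follows from
  \<open>std_tm\<close>.\<close>

definition integral_tm :: "nat \<Rightarrow> 'f::finite_field twisted \<Rightarrow> bool" where
  "integral_tm d T \<longleftrightarrow> std_tm d T \<and> (\<forall>i<d. \<forall>j<d. T 1 $$ (i, j) \<in> range A_to_kbar)"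

section \<open>The action on points\<close>

text \<open>The action of t on a point given by its coordinate function. The value 0 from d on makes
  equations between functions, as in \<open>tm_op_ext\<close>, hold at every index.\<close>

definition tm_op :: "nat \<Rightarrow> 'f::finite_field twisted \<Rightarrow> (nat \<Rightarrow> 'f kbar) \<Rightarrow> nat \<Rightarrow> 'f kbar" where
  "tm_op d T x = (\<lambda>i. if i < d then \<Sum>j<d. T 0 $$ (i, j) * x j + T 1 $$ (i, j) * x j ^ CARD('f) else 0)"

definition tm_op_poly :: "nat \<Rightarrow> 'f::finite_field twisted \<Rightarrow> 'f poly \<Rightarrow> (nat \<Rightarrow> 'f kbar) \<Rightarrow> nat \<Rightarrow> 'f kbar" where
  "tm_op_poly d T p y = (\<lambda>i. \<Sum>k\<le>degree p. A_to_kbar [:coeff p k:] * (tm_op d T ^^ k) y i)"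

lemma tm_op_sum: "tm_op d T (\<lambda>j. \<Sum>l\<in>L. f l j) = (\<lambda>i. \<Sum>l\<in>L. tm_op d T (f l) i)"
proof
  fix i
  show "tm_op d T (\<lambda>j. \<Sum>l\<in>L. f l j) i = (\<Sum>l\<in>L. tm_op d T (f l) i)"
  proof (cases "i < d")
    case True
    have "tm_op d T (\<lambda>j. \<Sum>l\<in>L. f l j) i
       = (\<Sum>j<d. \<Sum>l\<in>L. T 0 $$ (i, j) * f l j + T 1 $$ (i, j) * f l j ^ CARD('a))"
      using True by (simp add: tm_op_def frob_sum_1 sum.distrib sum_distrib_left)
    also have "\<dots> = (\<Sum>l\<in>L. \<Sum>j<d. T 0 $$ (i, j) * f l j + T 1 $$ (i, j) * f l j ^ CARD('a))"
      by (rule sum.swap)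
    finally show ?thesis using True by (simp add: tm_op_def)
  qed (simp add: tm_op_def)
qed

lemma tm_op_scalar: "tm_op d T (\<lambda>j. A_to_kbar [:c:] * x j) = (\<lambda>i. A_to_kbar [:c:] * tm_op d T x i)"
proof -
  have "A_to_kbar [:c:] ^ CARD('a) = A_to_kbar [:c:]" using frob_scalar[of c 1] by simp
  then show ?thesis
    by (auto simp: tm_op_def fun_eq_iff sum_distrib_left power_mult_distrib algebra_simps intro!: sum.cong)
qed

lemma tm_op_poly_eq_sum:
  assumes "degree p \<le> N"
  shows "tm_op_poly d T p y i = (\<Sum>k\<le>N. A_to_kbar [:coeff p k:] * (tm_op d T ^^ k) y i)"
  unfolding tm_op_poly_def
  by (rule sum.mono_neutral_left) (use assms in \<open>auto simp: coeff_eq_0\<close>)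

lemma tm_op_poly_0 [simp]: "tm_op_poly d T 0 y = (\<lambda>_. 0)"
  by (simp add: tm_op_poly_def)

text \<open>Horner's rule, the step behind the later inductions over the acting polynomial. The
  F_q-linearity of \<open>tm_op\<close> moves it outside the sum.\<close>

lemma tm_op_poly_pCons:
  "tm_op_poly d T (pCons c p) y = (\<lambda>i. A_to_kbar [:c:] * y i + tm_op d T (tm_op_poly d T p y) i)"
proof
  fix i
  have "tm_op_poly d T (pCons c p) y i
      = (\<Sum>k\<le>Suc (degree p). A_to_kbar [:coeff (pCons c p) k:] * (tm_op d T ^^ k) y i)"
    by (rule tm_op_poly_eq_sum) (rule degree_pCons_le)
  also have "\<dots> = A_to_kbar [:c:] * y i + (\<Sum>k\<le>degree p. A_to_kbar [:coeff p k:] * tm_op d T ((tm_op d T ^^ k) y) i)"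
    by (subst sum.atMost_Suc_shift) simp
  also have "(\<Sum>k\<le>degree p. A_to_kbar [:coeff p k:] * tm_op d T ((tm_op d T ^^ k) y) i) = tm_op d T (tm_op_poly d T p y) i"
    by (simp only: tm_op_poly_def tm_op_sum tm_op_scalar)
  finally show "tm_op_poly d T (pCons c p) y i = A_to_kbar [:c:] * y i + tm_op d T (tm_op_poly d T p y) i" .
qed

lemma tm_op_poly_add: "tm_op_poly d T (p + r) y = (\<lambda>i. tm_op_poly d T p y i + tm_op_poly d T r y i)"
proof
  fix i
  have "A_to_kbar [:coeff p k + coeff r k:] = A_to_kbar [:coeff p k:] + A_to_kbar [:coeff r k:]" for k
    by (metis A_to_kbar_hom(3) add_pCons add_0)
  then show "tm_op_poly d T (p + r) y i = tm_op_poly d T p y i + tm_op_poly d T r y i"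
    using tm_op_poly_eq_sum[of "p + r" "max (degree p) (degree r)" d T y i]
      tm_op_poly_eq_sum[of p "max (degree p) (degree r)" d T y i]
      tm_op_poly_eq_sum[of r "max (degree p) (degree r)" d T y i]
    by (simp add: degree_add_le_max distrib_right sum.distrib)
qed

lemma tm_op_poly_smult: "tm_op_poly d T (smult c p) y = (\<lambda>i. A_to_kbar [:c:] * tm_op_poly d T p y i)"
proof
  fix i
  have "A_to_kbar [:c * coeff p k:] = A_to_kbar [:c:] * A_to_kbar [:coeff p k:]" for k
    by (subst A_to_kbar_hom(6)[symmetric]) simp
  then show "tm_op_poly d T (smult c p) y i = A_to_kbar [:c:] * tm_op_poly d T p y i"
    using tm_op_poly_eq_sum[of "smult c p" "degree p" d T y i]
    by (simp add: degree_smult_le tm_op_poly_def sum_distrib_left mult.assoc)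
qed

lemma tm_op_poly_diff: "tm_op_poly d T (p - r) y = (\<lambda>i. tm_op_poly d T p y i - tm_op_poly d T r y i)"
  using tm_op_poly_add[of d T "p - r" r y] by (simp add: fun_eq_iff)

lemma tm_op_poly_mult: "tm_op_poly d T (p * r) y = tm_op_poly d T p (tm_op_poly d T r y)"
proof (induction p)
  case (pCons c p)
  then show ?case by (simp add: tm_op_poly_add tm_op_poly_smult tm_op_poly_pCons)
qed simp

lemma tm_op_poly_sum: "tm_op_poly d T p (\<lambda>j. \<Sum>l\<in>L. f l j) = (\<lambda>i. \<Sum>l\<in>L. tm_op_poly d T p (f l) i)"
  by (induction p) (simp_all add: tm_op_poly_pCons tm_op_sum sum.distrib sum_distrib_left)

lemma tw_apply_index:
  fixes P :: "'f::finite_field twisted"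
  assumes P: "tw_carrier d P" "\<And>n. n > N \<Longrightarrow> P n = 0\<^sub>m d d" and x: "dim_vec x = d" and i: "i < d"
  shows "tw_apply d P x $ i = (\<Sum>n\<le>N. \<Sum>j<d. P n $$ (i, j) * (x $ j) ^ (CARD('f) ^ n))"
proof -
  have eq: "(P n *\<^sub>v map_vec (\<lambda>z. z ^ (CARD('f) ^ n)) x) $ i = (\<Sum>j<d. P n $$ (i, j) * (x $ j) ^ (CARD('f) ^ n))" for n
  proof -
    have "P n \<in> carrier_mat d d" using P by simp
    then show ?thesis using x i by (auto simp: scalar_prod_def lessThan_atLeast0 intro!: sum.cong)
  qed
  have "tw_apply d P x $ i = (\<Sum>n | P n \<noteq> 0\<^sub>m d d. \<Sum>j<d. P n $$ (i, j) * (x $ j) ^ (CARD('f) ^ n))"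
    using i by (simp add: tw_apply_def eq)
  also have "\<dots> = (\<Sum>n\<le>N. \<Sum>j<d. P n $$ (i, j) * (x $ j) ^ (CARD('f) ^ n))"
  proof (rule sum.mono_neutral_left)
    show "{n. P n \<noteq> 0\<^sub>m d d} \<subseteq> {..N}" using P(2) by (auto simp: not_less[symmetric])
    show "\<forall>n\<in>{..N} - {n. P n \<noteq> 0\<^sub>m d d}. (\<Sum>j<d. P n $$ (i, j) * (x $ j) ^ (CARD('f) ^ n)) = 0"
      using i by auto
  qed simp
  finally show ?thesis .
qed

text \<open>Each factor T raises the degree in \<open>\<tau>\<close> by at most one. For polynomials
  in T, the index set in \<open>tw_apply\<close> may therefore be replaced by an initial
  segment.\<close>

lemma tw_power_vanish:
  fixes T :: "'f::finite_field twisted"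
  assumes T: "std_tm d T"
  shows "n > k \<Longrightarrow> tw_power d T k n = 0\<^sub>m d d"
proof (induction k arbitrary: n)
  case 0
  then show ?case by (simp add: tw_const_def)
next
  case (Suc k)
  have "tw_power d T (Suc k) n $$ (i, j) = 0" if "i < d" "j < d" for i j
    using that Suc.IH[of n] Suc.IH[of "n - 1"] Suc.prems
    by (simp add: std_mult_index[OF T])
  then show ?case using tw_carrier_power[of d T "Suc k" n]
    by (intro eq_matI) (simp_all only: carrier_matD index_zero_mat)
qed

lemma sum_rotate: "(\<Sum>n\<in>A. \<Sum>j\<in>B. \<Sum>h\<in>C. F n j h) = (\<Sum>h\<in>C. \<Sum>n\<in>A. \<Sum>j\<in>B. F n j h)"
proof -
  have "(\<Sum>n\<in>A. \<Sum>j\<in>B. \<Sum>h\<in>C. F n j h) = (\<Sum>n\<in>A. \<Sum>h\<in>C. \<Sum>j\<in>B. F n j h)"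
    by (rule sum.cong[OF refl], rule sum.swap)
  also have "\<dots> = (\<Sum>h\<in>C. \<Sum>n\<in>A. \<Sum>j\<in>B. F n j h)"
    by (rule sum.swap)
  finally show ?thesis .
qed

text \<open>Evaluation at a point turns twisted multiplication into composition. The bound N is free
  because in the induction the constant part of T uses the hypothesis with N, the
  \<open>\<tau>\<close>-part with N - 1.\<close>

lemma tw_power_apply:
  fixes T :: "'f::finite_field twisted"
  assumes T: "std_tm d T"
  shows "i < d \<Longrightarrow> k \<le> N \<Longrightarrow>
    (\<Sum>n\<le>N. \<Sum>j<d. tw_power d T k n $$ (i, j) * y j ^ (CARD('f) ^ n)) = (tm_op d T ^^ k) y i"
proof (induction k arbitrary: i N)
  case 0
  have "(\<Sum>n\<le>N. \<Sum>j<d. tw_power d T 0 n $$ (i, j) * y j ^ (CARD('f) ^ n))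
      = (\<Sum>n\<in>{0}. \<Sum>j<d. tw_power d T 0 n $$ (i, j) * y j ^ (CARD('f) ^ n))"
    by (rule sum.mono_neutral_right) (use 0 in \<open>auto simp: tw_const_def\<close>)
  also have "\<dots> = (\<Sum>j<d. tw_power d T 0 0 $$ (i, j) * y j)" by simp
  also have "\<dots> = (\<Sum>j<d. if j = i then y j else 0)"
    by (rule sum.cong) (use 0 in \<open>auto simp: tw_const_def\<close>)
  finally show ?case using 0 by simp
next
  case (Suc k)
  then obtain M where N: "N = Suc M" and M: "k \<le> M" by (cases N) auto
  let ?P = "tw_power d T k"
  let ?q = "CARD('f)"
  have P: "tw_carrier d ?P" by simp
  have "(\<Sum>n\<le>N. \<Sum>j<d. tw_power d T (Suc k) n $$ (i, j) * y j ^ (?q ^ n))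
    = (\<Sum>n\<le>N. \<Sum>j<d. (\<Sum>h<d. T 0 $$ (i, h) * ?P n $$ (h, j)) * y j ^ (?q ^ n)) +
      (\<Sum>n\<le>N. \<Sum>j<d. (if n = 0 then 0 else \<Sum>h<d. T 1 $$ (i, h) * ?P (n - 1) $$ (h, j) ^ ?q) * y j ^ (?q ^ n))"
    using Suc.prems by (simp add: std_mult_index[OF T P] distrib_right sum.distrib)
  also have "(\<Sum>n\<le>N. \<Sum>j<d. (if n = 0 then 0 else \<Sum>h<d. T 1 $$ (i, h) * ?P (n - 1) $$ (h, j) ^ ?q) * y j ^ (?q ^ n))
    = (\<Sum>n\<le>M. \<Sum>j<d. (\<Sum>h<d. T 1 $$ (i, h) * ?P n $$ (h, j) ^ ?q) * y j ^ (?q ^ Suc n))"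
    unfolding N by (subst sum.atMost_Suc_shift) simp
  also have "\<dots> = (\<Sum>h<d. T 1 $$ (i, h) * (\<Sum>n\<le>M. \<Sum>j<d. ?P n $$ (h, j) * y j ^ (?q ^ n)) ^ ?q)"
  proof -
    have "(\<Sum>n\<le>M. \<Sum>j<d. ?P n $$ (h, j) * y j ^ (?q ^ n)) ^ ?q
       = (\<Sum>n\<le>M. \<Sum>j<d. ?P n $$ (h, j) ^ ?q * y j ^ (?q ^ Suc n))" for h
      by (simp add: frob_sum_1 power_mult_distrib power_mult[symmetric] mult.commute)
    then show ?thesis
      by (simp only: sum_distrib_right sum_distrib_left mult.assoc) (rule sum_rotate)
  qed
  also have "(\<Sum>n\<le>N. \<Sum>j<d. (\<Sum>h<d. T 0 $$ (i, h) * ?P n $$ (h, j)) * y j ^ (?q ^ n))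
      = (\<Sum>h<d. T 0 $$ (i, h) * (\<Sum>n\<le>N. \<Sum>j<d. ?P n $$ (h, j) * y j ^ (?q ^ n)))"
    by (simp only: sum_distrib_right sum_distrib_left mult.assoc) (rule sum_rotate)
  also have "(\<Sum>h<d. T 0 $$ (i, h) * (\<Sum>n\<le>N. \<Sum>j<d. ?P n $$ (h, j) * y j ^ (?q ^ n)))
     = (\<Sum>h<d. T 0 $$ (i, h) * (tm_op d T ^^ k) y h)"
    using N M by (intro sum.cong refl arg_cong2[of _ _ _ _ "(*)"] Suc.IH) auto
  also have "(\<Sum>h<d. T 1 $$ (i, h) * (\<Sum>n\<le>M. \<Sum>j<d. ?P n $$ (h, j) * y j ^ (?q ^ n)) ^ ?q)
     = (\<Sum>h<d. T 1 $$ (i, h) * (tm_op d T ^^ k) y h ^ ?q)"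
    using M by (intro sum.cong refl) (simp add: Suc.IH)
  finally show ?case
    using Suc.prems by (simp add: tm_op_def[of d T "(tm_op d T ^^ k) y"] sum.distrib)
qed

lemma tm_act_index:
  fixes T :: "'f::finite_field twisted"
  assumes T: "std_tm d T" and x: "dim_vec x = d" and i: "i < d"
  shows "tm_act (tmodule_of d T) a x $ i = tm_op_poly d T a (\<lambda>j. x $ j) i"
proof -
  let ?N = "degree a"
  let ?c = "\<lambda>k. A_to_kbar [:coeff a k:]"
  have "tm_rho (tmodule_of d T) a n = 0\<^sub>m d d" if "n > degree a" for n
    using that by (intro eq_matI) (simp_all add: tm_rho_tmodule_of tw_power_vanish[OF T])
  then have "tm_act (tmodule_of d T) a x $ i
      = (\<Sum>n\<le>?N. \<Sum>j<d. tm_rho (tmodule_of d T) a n $$ (i, j) * (x $ j) ^ (CARD('f) ^ n))"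
    unfolding tm_act_def tm_dim_tmodule_of using x i by (intro tw_apply_index) simp_all
  also have "\<dots> = (\<Sum>n\<le>?N. \<Sum>j<d. \<Sum>k\<le>?N. ?c k * (tw_power d T k n $$ (i, j) * (x $ j) ^ (CARD('f) ^ n)))"
    using i by (simp add: tm_rho_tmodule_of sum_distrib_right mult.assoc)
  also have "\<dots> = (\<Sum>n\<le>?N. \<Sum>k\<le>?N. ?c k * (\<Sum>j<d. tw_power d T k n $$ (i, j) * (x $ j) ^ (CARD('f) ^ n)))"
    by (rule sum.cong[OF refl], subst sum.swap) (simp only: sum_distrib_left)
  also have "\<dots> = (\<Sum>k\<le>?N. ?c k * (\<Sum>n\<le>?N. \<Sum>j<d. tw_power d T k n $$ (i, j) * (x $ j) ^ (CARD('f) ^ n)))"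
    by (subst sum.swap) (simp only: sum_distrib_left)
  also have "\<dots> = tm_op_poly d T a (\<lambda>j. x $ j) i"
    using i by (simp add: tm_op_poly_def tw_power_apply[OF T])
  finally show ?thesis .
qed

lemma dim_tm_act [simp]: "dim_vec (tm_act (tmodule_of d T) a x) = d"
  by (simp add: tm_act_def tw_apply_def)

text \<open>
  For the row of \<open>\<theta> + N\<close> read off by the theorem, the recursion for the logarithm closes up in that row
  alone, so logarithms can be compared under gluing one row at a time.
\<close>

lemma tm_log_row:
  fixes T :: "'f::finite_field twisted"
  assumes std: "std_tm d T" and r: "r < d" and k: "k < d" and row: "\<And>j. j < d \<Longrightarrow> nilpart T r j = 0"
  defines "P \<equiv> tm_log (tmodule_of d T)"
  shows "theta * P n $$ (r, k) = (\<Sum>j<d. P n $$ (r, j) * T 0 $$ (j, k) ^ (CARD('f) ^ n)) +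
    (if n = 0 then 0 else \<Sum>j<d. P (n - 1) $$ (r, j) * T 1 $$ (j, k) ^ (CARD('f) ^ (n - 1)))"
proof -
  have T0: "T 0 \<in> carrier_mat d d" using std by (simp add: std_tm_def)
  have "(\<Sum>j<d. T 0 $$ (r, j) * P n $$ (j, k)) = (\<Sum>j<d. if j = r then theta * P n $$ (j, k) else 0)"
    using row by (intro sum.cong) (auto simp: std_tm_T0[OF std r])
  then have "theta * P n $$ (r, k) = tw_mult d (tw_const d (T 0)) P n $$ (r, k)"
    using r by (simp add: P_def tw_const_mult_index[OF T0 tm_log_intertw(1)[OF std] r k])
  also have "\<dots> = tw_mult d P T n $$ (r, k)" by (simp only: P_def tm_log_intertw(3)[OF std])
  finally show ?thesis
    unfolding P_def by (simp only: mult_std_index[OF std tm_log_intertw(1)[OF std] r k])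
qed

section \<open>Convergence\<close>

context Cv_embedding
begin

lemma vabs_0 [simp]: "vabs (0 :: 'c) = 0" by (simp add: vabs_def)

lemma vabs_nonneg [simp]: "vabs (x :: 'c) \<ge> 0" by (simp add: vabs_def)

lemma vabs_eq_0_iff [simp]: "vabs (x :: 'c) = 0 \<longleftrightarrow> x = 0" by (simp add: vabs_def)

lemma vabs_1 [simp]: "vabs (1 :: 'c) = 1"
  using vabs_mult[of 1 1] by simp

lemma vabs_minus [simp]: "vabs (- x :: 'c) = vabs x"
  using dist_eq_vabs[of 0 x] dist_eq_vabs[of x 0] by (simp add: dist_commute)

lemma vabs_diff: "vabs (x - y :: 'c) \<le> max (vabs x) (vabs y)"
  using vabs_ultrametric[of x "- y"] by simp

lemma vabs_diff_less: "vabs x < e \<Longrightarrow> vabs y < e \<Longrightarrow> vabs (x - y :: 'c) < e"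
  using vabs_diff[of x y] by simp

text \<open>The classes of \<open>'c\<close> do not connect its metric with its field operations;
  only the locale does. Limits are moved to real absolute values, where the ultrametric inequality
  and multiplicativity give continuity.\<close>

lemma tendsto_vabs: "((f \<longlongrightarrow> (l :: 'c)) F) \<longleftrightarrow> ((\<lambda>n. vabs (f n - l)) \<longlongrightarrow> 0) F"
  by (subst tendsto_dist_iff) (simp add: dist_eq_vabs)

lemma tendsto_add_Cv:
  assumes "(f \<longlongrightarrow> (a :: 'c)) F" "(g \<longlongrightarrow> b) F"
  shows "((\<lambda>n. f n + g n) \<longlongrightarrow> a + b) F"
  unfolding tendsto_vabs
proof (rule tendsto_sandwich[of "\<lambda>_. 0"])
  have "vabs (f n + g n - (a + b)) \<le> vabs (f n - a) + vabs (g n - b)" for n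
  proof -
    have "vabs ((f n - a) + (g n - b)) \<le> max (vabs (f n - a)) (vabs (g n - b))"
      by (rule vabs_ultrametric)
    also have "\<dots> \<le> vabs (f n - a) + vabs (g n - b)" by simp
    finally show ?thesis by (simp add: algebra_simps)
  qed
  then show "\<forall>\<^sub>F n in F. vabs (f n + g n - (a + b)) \<le> vabs (f n - a) + vabs (g n - b)" by simp
  show "((\<lambda>n. vabs (f n - a) + vabs (g n - b)) \<longlongrightarrow> 0) F"
    using tendsto_add[OF assms(1)[unfolded tendsto_vabs] assms(2)[unfolded tendsto_vabs]] by simp
qed simp_all

lemma tendsto_cmult_Cv:
  assumes "(f \<longlongrightarrow> (a :: 'c)) F"
  shows "((\<lambda>n. c * f n) \<longlongrightarrow> c * a) F"
  using tendsto_mult_right_zero[OF assms[unfolded tendsto_vabs], of "vabs c"]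
  unfolding tendsto_vabs by (simp add: vabs_mult flip: right_diff_distrib)

lemma sums_add_Cv:
  assumes "f sums (a :: 'c)" "g sums b"
  shows "(\<lambda>n. f n + g n) sums (a + b)"
  using tendsto_add_Cv[OF assms[unfolded sums_def]] by (simp add: sums_def sum.distrib)

lemma sums_sum_Cv:
  assumes "\<And>l. l \<in> A \<Longrightarrow> f l sums (a l :: 'c)"
  shows "(\<lambda>n. \<Sum>l\<in>A. f l n) sums (\<Sum>l\<in>A. a l)"
  using assms
proof (induction A rule: infinite_finite_induct)
  case (insert l A)
  then show ?case by (simp add: sums_add_Cv)
qed simp_all

text \<open>A block of consecutive terms is no larger than its largest term, so in a complete
  ultrametric space null terms already give a Cauchy sequence of partial sums.\<close>

lemma summable_Cv:
  assumes "(\<lambda>n. vabs (f n :: 'c)) \<longlonglongrightarrow> 0"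
  shows "summable f"
proof -
  have "Cauchy (\<lambda>n. \<Sum>i<n. f i)"
  proof (rule metric_CauchyI)
    fix e :: real assume e: "e > 0"
    obtain M where M: "\<And>n. n \<ge> M \<Longrightarrow> vabs (f n) < e"
      using order_tendstoD(2)[OF assms e] by (auto simp: eventually_sequentially)
    have *: "vabs ((\<Sum>i<M + k. f i) - (\<Sum>i<M. f i)) < e" for k
    proof (induction k)
      case (Suc k)
      have "vabs (((\<Sum>i<M + k. f i) - (\<Sum>i<M. f i)) + f (M + k)) < e"
        using vabs_ultrametric[of "(\<Sum>i<M + k. f i) - (\<Sum>i<M. f i)" "f (M + k)"] Suc M[of "M + k"] by simp
      then show ?case by (simp add: algebra_simps)
    qed (use e in simp)
    have "dist (\<Sum>i<m. f i) (\<Sum>i<n. f i) < e" if "m \<ge> M" "n \<ge> M" for m n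
      using vabs_diff_less[OF *[of "m - M"] *[of "n - M"]] that by (simp add: dist_eq_vabs)
    then show "\<exists>M. \<forall>m\<ge>M. \<forall>n\<ge>M. dist (\<Sum>i<m. f i) (\<Sum>i<n. f i) < e" by blast
  qed
  then have "convergent (\<lambda>n. \<Sum>i<n. f i)" by (rule Cauchy_convergent)
  then show ?thesis by (simp add: summable_iff_convergent)
qed

definition val :: "'f kbar \<Rightarrow> real" where
  "val z = vabs (\<iota> z)"

lemma val_simps [simp]: "val 0 = 0" "val 1 = 1" "val (- x) = val x" "val x \<ge> 0"
    "val (x * y) = val x * val y"
  by (simp_all add: val_def hom_mult hom_uminus vabs_mult)

lemma val_power [simp]: "val (x ^ n) = val x ^ n"
  by (induction n) simp_all

lemma val_add_le: "val x \<le> c \<Longrightarrow> val y \<le> c \<Longrightarrow> val (x + y) \<le> c"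
  using vabs_ultrametric[of "\<iota> x" "\<iota> y"] by (simp add: val_def hom_add)

lemma val_diff_le: "val x \<le> c \<Longrightarrow> val y \<le> c \<Longrightarrow> val (x - y) \<le> c"
  using vabs_diff[of "\<iota> x" "\<iota> y"] by (simp add: val_def hom_minus)

lemma val_sum_le:
  assumes "c \<ge> 0" "\<And>x. x \<in> A \<Longrightarrow> val (f x) \<le> c"
  shows "val (\<Sum>x\<in>A. f x) \<le> c"
  using assms(2)
  by (induction A rule: infinite_finite_induct) (use assms(1) in \<open>simp_all add: val_add_le\<close>)

lemma val_divide: "val (x / y) = val x / val y"
proof (cases "y = 0")
  case False
  then have "val (x / y) * val y = val x" "val y \<noteq> 0"
    by (simp_all flip: val_simps(5)) (simp add: val_def)
  then show ?thesis by (simp add: field_simps)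
qed simp

end

section \<open>The place v: absolute values on A and bounds for the logarithm\<close>

locale Cv_place = Cv_embedding +
  assumes irr: "irreducible v"
begin

lemma degree_v: "degree v > 0"
  using irr by (metis gr0I irreducible_def is_unit_iff_degree)

text \<open>Produces the exponent about which \<open>vabs_normalized\<close> speaks. It exists
  because v is nonconstant, so that v^(deg f + 1) has larger degree than f.\<close>

lemma val_A_cases:
  assumes "f \<noteq> 0"
  obtains n where "v ^ n dvd f" "\<not> v ^ Suc n dvd f"
proof -
  have "\<not> v ^ Suc (degree f) dvd f"
  proof
    assume "v ^ Suc (degree f) dvd f"
    then have "degree (v ^ Suc (degree f)) \<le> degree f" using assms by (rule dvd_imp_degree_le)
    moreover have "degree (v ^ Suc (degree f)) = Suc (degree f) * degree v"
      by (subst degree_power_eq) (use irr in auto)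
    moreover have "Suc (degree f) * 1 \<le> Suc (degree f) * degree v"
      using degree_v by (intro mult_le_mono) auto
    ultimately show False by simp
  qed
  then obtain k where "\<forall>i\<le>k. v ^ i dvd f" "\<not> v ^ Suc k dvd f"
    using ex_least_nat_less[of "\<lambda>n. \<not> v ^ n dvd f" "Suc (degree f)"] by auto
  then show ?thesis using that by blast
qed

lemma val_A_le_1 [simp]: "val (A_to_kbar f) \<le> 1"
proof (cases "f = 0")
  case False
  then obtain n where "v ^ n dvd f" "\<not> v ^ Suc n dvd f" by (rule val_A_cases)
  then show ?thesis
    using card_finite_field_gt_1[where 'f = 'a] by (simp add: val_def vabs_normalized)
qed simp

lemma val_A_less_1:
  assumes "v dvd f"
  shows "val (A_to_kbar f) < 1"
proof (cases "f = 0")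
  case False
  then obtain n where n: "v ^ n dvd f" "\<not> v ^ Suc n dvd f" by (rule val_A_cases)
  then have "n > 0" using assms by (cases n) auto
  then have "real CARD('a) ^ (degree v * n) > 1"
    using card_finite_field_gt_1[where 'f = 'a] degree_v by (intro one_less_power) auto
  then show ?thesis using n by (simp add: val_def vabs_normalized)
qed simp

text \<open>The inverse of the absolute value of v, and by \<open>val_theta_frob_ge\<close> the most
  that one division by theta^(q^n) - theta with n > 0 can cost.\<close>

definition \<beta> :: real where "\<beta> = real CARD('a) ^ degree v"

lemma beta_ge_1: "\<beta> \<ge> 1"
  using card_finite_field_gt_1[where 'f = 'a] by (simp add: \<beta>_def one_le_power)

text \<open>The derivative of \<open>\<theta>\<^sup>q\<^sup>^\<^sup>n - \<theta>\<close> is \<open>-1\<close>, so \<open>v\<close> divides it at most once.\<close>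

lemma val_theta_frob_ge:
  assumes "n > 0"
  shows "1 / val ((theta :: 'a kbar) ^ (CARD('a) ^ n) - theta) \<le> \<beta>"
proof -
  define f :: "'a poly" where "f = monom 1 (CARD('a) ^ n) - monom 1 1"
  \<comment> \<open>As q choose 1 is q, this says q = 0 in F_q, which kills the derivative of the
    first monomial.\<close>
  have "of_nat (CARD('a) choose 1) = (0 :: 'a)"
    by (rule of_nat_choose_card_eq_0) (use card_finite_field_gt_1[where 'f = 'a] in auto)
  then have "pderiv f = -1" using assms
    by (simp add: f_def pderiv_diff pderiv_monom one_pCons monom_0 power_0_left)
  have "\<not> v ^ Suc 1 dvd f"
  proof
    assume "v ^ Suc 1 dvd f"
    then obtain g where "f = v * (v * g)" by (auto simp: dvd_def mult.assoc)
    then have "pderiv f = v * (pderiv (v * g) + g * pderiv v)" by (simp add: pderiv_mult algebra_simps)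
    then have "v dvd 1" using \<open>pderiv f = -1\<close> by (metis dvd_minus_iff dvd_triv_left)
    then show False using irr by (simp add: irreducible_def)
  qed
  then have "val (A_to_kbar f) = 1 \<or> val (A_to_kbar f) = 1 / \<beta>"
    using vabs_normalized[of 0 f] vabs_normalized[of 1 f]
    by (cases "v dvd f") (auto simp: val_def \<beta>_def)
  then show ?thesis using beta_ge_1 by (auto simp: theta_frob_sub f_def)
qed

text \<open>One application of \<open>sylv\<close> divides by \<open>\<delta>\<close> once, a factor
  of at most \<open>\<beta>\<close>. Sums cost nothing by the ultrametric inequality, and neither do
  the entries of N.\<close>

lemma sylv_bound:
  assumes N: "\<And>i j. i < d \<Longrightarrow> j < d \<Longrightarrow> val (N i j) \<le> 1"
    and C: "\<And>i j. i < d \<Longrightarrow> j < d \<Longrightarrow> val (C i j) \<le> M"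
    and M: "M \<ge> 0" and \<delta>: "1 / val \<delta> \<le> \<beta>"
  shows "i < d \<Longrightarrow> j < d \<Longrightarrow> val ((sylv d N \<delta> C ^^ m) (\<lambda>_ _. 0) i j) \<le> M * \<beta> ^ m"
proof (induction m arbitrary: i j)
  case (Suc m)
  let ?U = "(sylv d N \<delta> C ^^ m) (\<lambda>_ _. 0)"
  have M1: "M * \<beta> ^ m \<ge> M" using M beta_ge_1 by (simp add: mult_le_cancel_left1 one_le_power)
  then have M0: "M * \<beta> ^ m \<ge> 0" using M by linarith
  have "val (N i k * ?U k j) \<le> M * \<beta> ^ m" if "k < d" for k
    using mult_mono[OF N[of i k] Suc.IH[of k j]] that Suc.prems by simp
  then have 1: "val (\<Sum>k<d. N i k * ?U k j) \<le> M * \<beta> ^ m" using M0 by (intro val_sum_le) auto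
  have "val (?U i k * N k j) \<le> M * \<beta> ^ m" if "k < d" for k
    using mult_mono[OF N[of k j] Suc.IH[of i k]] that Suc.prems by (simp add: mult.commute)
  then have 2: "val (\<Sum>k<d. ?U i k * N k j) \<le> M * \<beta> ^ m" using M0 by (intro val_sum_le) auto
  have 3: "val (C i j) \<le> M * \<beta> ^ m" using C[of i j] Suc.prems M1 by linarith
  have "val ((\<Sum>k<d. N i k * ?U k j) - (\<Sum>k<d. ?U i k * N k j) - C i j) \<le> M * \<beta> ^ m"
    using 1 2 3 by (intro val_diff_le)
  then have "val ((\<Sum>k<d. N i k * ?U k j) - (\<Sum>k<d. ?U i k * N k j) - C i j) * (1 / val \<delta>) \<le> (M * \<beta> ^ m) * \<beta>"
    using \<delta> M0 by (intro mult_mono) auto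
  moreover have "(sylv d N \<delta> C ^^ Suc m) (\<lambda>_ _. 0) i j = sylv d N \<delta> C ?U i j" by simp
  then have "(sylv d N \<delta> C ^^ Suc m) (\<lambda>_ _. 0) i j
      = ((\<Sum>k<d. N i k * ?U k j) - (\<Sum>k<d. ?U i k * N k j) - C i j) / \<delta>"
    by (simp only: sylv_def[of d N \<delta> C ?U])
  ultimately show ?case by (simp only: val_divide) (simp add: mult_ac)
qed (use M in simp)

lemma integral_tm_T1:
  assumes "integral_tm d T" "i < d" "j < d"
  shows "val (T 1 $$ (i, j)) \<le> 1"
proof -
  have "T 1 $$ (i, j) \<in> range A_to_kbar" using assms by (auto simp: integral_tm_def)
  then show ?thesis by auto
qed

text \<open>Each new coefficient is the 2 d-th iterate of \<open>sylv\<close> for an inhomogeneous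
  term that obeys the bound of the preceding coefficient, so \<open>sylv_bound\<close> adds one
  factor \<open>\<beta> ^ (2 * d)\<close>.\<close>

lemma tm_log_bound:
  assumes T: "integral_tm d T" and ij: "i < d" "j < d"
  shows "val (tm_log (tmodule_of d T) n $$ (i, j)) \<le> (\<beta> ^ (2 * d)) ^ n"
  using ij
proof (induction n arbitrary: i j)
  case 0
  have "std_tm d T" using T by (simp add: integral_tm_def)
  then show ?case using 0 by (simp add: tm_log_intertw)
next
  case (Suc n)
  let ?P = "tm_log (tmodule_of d T)"
  let ?\<delta> = "(theta :: 'a kbar) ^ (CARD('a) ^ Suc n) - theta"
  let ?S = "tw_const d (T 0)"
  let ?C = "intertw_C d ?S T n (?P n)"
  have std: "std_tm d T" using T by (simp add: integral_tm_def)
  have "?P (Suc n) $$ (i, j) = sylv_sol d (nilpart T) ?\<delta> ?C i j"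
    using _ _ _ Suc.prems
  proof (rule sylv_unique)
    show "?P (Suc n) $$ (i, j) = sylv d (nilpart T) ?\<delta> ?C (\<lambda>i j. ?P (Suc n) $$ (i, j)) i j"
      if "i < d" "j < d" for i j
      using intertw_Suc_iff[OF std_tm_const[OF std] std _ tm_log_intertw(1)[OF std] that, of n]
        tm_log_intertw(3)[OF std] by (simp add: tw_const_def)
    show "sylv_sol d (nilpart T) ?\<delta> ?C i j = sylv d (nilpart T) ?\<delta> ?C (sylv_sol d (nilpart T) ?\<delta> ?C) i j"
      if "i < d" "j < d" for i j
      using that by (intro sylv_sol) (auto simp: nilpart_upper)
  qed (simp add: nilpart_upper)
  moreover have "val (sylv_sol d (nilpart T) ?\<delta> ?C i j) \<le> (\<beta> ^ (2 * d)) ^ n * \<beta> ^ (2 * d)"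
    unfolding sylv_sol_def
  proof (rule sylv_bound)
    show "val (nilpart T i j) \<le> 1" if "i < d" "j < d" for i j
      using nilpart_0_1[OF std that] by auto
    show "(\<beta> ^ (2 * d)) ^ n \<ge> 0" using beta_ge_1 by simp
    show "1 / val ?\<delta> \<le> \<beta>" by (rule val_theta_frob_ge) simp
    \<comment> \<open>Here S is constant, so the second sum of \<open>intertw_C\<close>, which
      carries a q-th power of the preceding coefficient and would break the geometric bound,
      vanishes. In the first sum only the integral entries of \<open>T 1\<close> are raised to a
      power.\<close>
    show "val (?C i j) \<le> (\<beta> ^ (2 * d)) ^ n" if "i < d" "j < d" for i j
    proof -
      have "val (?P n $$ (i, k) * T 1 $$ (k, j) ^ (CARD('a) ^ n)) \<le> (\<beta> ^ (2 * d)) ^ n" if "k < d" for k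
        using mult_mono[OF Suc.IH[of i k] power_le_one[OF _ integral_tm_T1[OF T, of k j]]] that \<open>i < d\<close> \<open>j < d\<close>
        using beta_ge_1 by simp
      then have "val (\<Sum>k<d. ?P n $$ (i, k) * T 1 $$ (k, j) ^ (CARD('a) ^ n)) \<le> (\<beta> ^ (2 * d)) ^ n"
        using beta_ge_1 by (intro val_sum_le) auto
      then show ?thesis using that by (simp add: intertw_C_def tw_const_def)
    qed
  qed (use Suc.prems in auto)
  ultimately show ?case by (simp add: mult.commute)
qed

text \<open>The exponents q^n and q^(n+1) are at least n apart, so the ratio of consecutive terms is
  at most \<open>B * \<rho> ^ n\<close> and eventually below 1/2.\<close>

lemma bound_tendsto_0:
  fixes B \<rho> :: real
  assumes "B \<ge> 1" "0 < \<rho>" "\<rho> < 1"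
  shows "(\<lambda>n. B ^ n * \<rho> ^ (CARD('a) ^ n)) \<longlonglongrightarrow> 0"
proof -
  define q where "q = CARD('a)"
  have q: "q > 1" unfolding q_def by (rule card_finite_field_gt_1)
  have "(\<lambda>n. B * \<rho> ^ n) \<longlonglongrightarrow> B * 0"
    using assms by (intro tendsto_intros LIMSEQ_power_zero) auto
  then have "eventually (\<lambda>n. B * \<rho> ^ n < 1 / 2) sequentially"
    by (rule order_tendstoD) simp
  then obtain M where M: "\<And>n. n \<ge> M \<Longrightarrow> B * \<rho> ^ n < 1 / 2" by (auto simp: eventually_sequentially)
  have "summable (\<lambda>n. B ^ n * \<rho> ^ (q ^ n))"
  proof (rule summable_ratio_test)
    fix n assume n: "n \<ge> M"
    have "n < q ^ n" using q by (simp add: power_gt_expt)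
    moreover have "q ^ Suc n \<ge> 2 * q ^ n" using q by simp
    ultimately have "q ^ n + n \<le> q ^ Suc n" by linarith
    then have "\<rho> ^ (q ^ Suc n) \<le> \<rho> ^ (q ^ n + n)" using assms by (intro power_decreasing) auto
    then have "B ^ Suc n * \<rho> ^ (q ^ Suc n) \<le> B ^ Suc n * \<rho> ^ (q ^ n + n)"
      using assms by (intro mult_left_mono) auto
    also have "\<dots> = (B * \<rho> ^ n) * (B ^ n * \<rho> ^ (q ^ n))" by (simp add: power_add)
    also have "\<dots> \<le> 1 / 2 * (B ^ n * \<rho> ^ (q ^ n))"
      using M[OF n] assms by (intro mult_right_mono) auto
    finally show "norm (B ^ Suc n * \<rho> ^ (q ^ Suc n)) \<le> 1 / 2 * norm (B ^ n * \<rho> ^ (q ^ n))"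
      using assms by simp
  qed simp
  then show ?thesis unfolding q_def by (rule summable_LIMSEQ_zero)
qed

definition small :: "nat \<Rightarrow> (nat \<Rightarrow> 'a kbar) \<Rightarrow> bool" where
  "small d x \<longleftrightarrow> (\<forall>j<d. val (x j) < 1)"

lemma small_bound:
  assumes "small d x"
  obtains \<rho> where "0 < \<rho>" "\<rho> < 1" "\<And>j. j < d \<Longrightarrow> val (x j) \<le> \<rho>"
proof
  \<comment> \<open>The inserted 1/2 keeps \<open>\<rho>\<close> positive, also when all coordinates
    vanish or d = 0.\<close>
  define \<rho> where "\<rho> = Max (insert (1 / 2) ((\<lambda>j. val (x j)) ` {..<d}))"
  show "\<rho> < 1" using assms by (auto simp: \<rho>_def small_def)
  have "1 / 2 \<le> \<rho>" unfolding \<rho>_def by (rule Max_ge) auto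
  then show "0 < \<rho>" by linarith
  show "val (x j) \<le> \<rho>" if "j < d" for j unfolding \<rho>_def by (rule Max_ge) (use that in auto)
qed

text \<open>Kept in \<open>kbar\<close>, where the Frobenius lemmas apply; \<open>\<iota>\<close> is
  applied only to finished terms.\<close>

definition log_coord_term :: "nat \<Rightarrow> 'a twisted \<Rightarrow> nat \<Rightarrow> (nat \<Rightarrow> 'a kbar) \<Rightarrow> nat \<Rightarrow> 'a kbar" where
  "log_coord_term d T r x n = (\<Sum>j<d. tm_log (tmodule_of d T) n $$ (r, j) * x j ^ (CARD('a) ^ n))"

definition log_coord :: "nat \<Rightarrow> 'a twisted \<Rightarrow> nat \<Rightarrow> (nat \<Rightarrow> 'a kbar) \<Rightarrow> 'b" where
  "log_coord d T r x = (\<Sum>n. \<iota> (log_coord_term d T r x n))"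

lemma vabs_bounded_tendsto:
  assumes "B \<ge> 1" "0 < \<rho>" "\<rho> < 1" "\<And>n. val (f n) \<le> B ^ n * \<rho> ^ (CARD('a) ^ n)"
  shows "(\<lambda>n. vabs (\<iota> (f n))) \<longlonglongrightarrow> 0"
proof (rule tendsto_sandwich[of "\<lambda>_. 0"])
  show "(\<lambda>n. B ^ n * \<rho> ^ (CARD('a) ^ n)) \<longlonglongrightarrow> 0" using assms by (intro bound_tendsto_0)
qed (use assms(4) in \<open>auto simp: val_def\<close>)

lemma log_coord_term_summable:
  assumes T: "integral_tm d T" and r: "r < d" and x: "small d x"
  shows "summable (\<lambda>n. \<iota> (log_coord_term d T r x n))"
proof -
  obtain \<rho> where \<rho>: "0 < \<rho>" "\<rho> < 1" "\<And>j. j < d \<Longrightarrow> val (x j) \<le> \<rho>" using small_bound[OF x] by blast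
  define B where "B = \<beta> ^ (2 * d)"
  have B: "B \<ge> 1" using beta_ge_1 by (simp add: B_def one_le_power)
  have "val (log_coord_term d T r x n) \<le> B ^ n * \<rho> ^ (CARD('a) ^ n)" for n
    unfolding log_coord_term_def
  proof (rule val_sum_le)
    fix j assume "j \<in> {..<d}"
    then show "val (tm_log (tmodule_of d T) n $$ (r, j) * x j ^ (CARD('a) ^ n)) \<le> B ^ n * \<rho> ^ (CARD('a) ^ n)"
      using tm_log_bound[OF T r, of j n] power_mono[OF \<rho>(3)[of j], of "CARD('a) ^ n"] B
      by (simp add: B_def mult_mono)
  qed (use B \<rho> in simp)
  then have "(\<lambda>n. vabs (\<iota> (log_coord_term d T r x n))) \<longlonglongrightarrow> 0"
    using B \<rho> by (intro vabs_bounded_tendsto)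
  then show ?thesis by (rule summable_Cv)
qed

lemma log_coord_term_sums:
  assumes "integral_tm d T" "r < d" "small d x"
  shows "(\<lambda>n. \<iota> (log_coord_term d T r x n)) sums log_coord d T r x"
  unfolding log_coord_def using assms by (intro summable_sums log_coord_term_summable)

text \<open>The partial sums of the two sides differ by a single boundary term, which tends to 0, so
  no infinite sum is rearranged.\<close>

lemma log_coord_tm_op:
  assumes T: "integral_tm d T" and r: "r < d" and x: "small d x"
    and sx: "small d (tm_op d T x)"
    and row: "\<And>j. j < d \<Longrightarrow> nilpart T r j = 0"
  shows "log_coord d T r (tm_op d T x) = \<iota> theta * log_coord d T r x"
proof -
  let ?P = "tm_log (tmodule_of d T)"
  let ?q = "CARD('a)"
  have std: "std_tm d T" using T by (simp add: integral_tm_def)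
  \<comment> \<open>The contribution of \<open>T 1\<close>: it sits in term n of the logarithm at
    \<open>tm_op d T x\<close>, but in term n + 1 of theta times the logarithm at x. The part
    \<open>K\<close> sits in the same term of both.\<close>
  define D where "D n = (\<Sum>k<d. (\<Sum>j<d. ?P n $$ (r, j) * T 1 $$ (j, k) ^ (?q ^ n)) * x k ^ (?q ^ Suc n))" for n
  define K where "K n k = (\<Sum>j<d. ?P n $$ (r, j) * T 0 $$ (j, k) ^ (?q ^ n))" for n k
  have P: "theta * ?P n $$ (r, k) = K n k +
      (if n = 0 then 0 else \<Sum>j<d. ?P (n - 1) $$ (r, j) * T 1 $$ (j, k) ^ (?q ^ (n - 1)))" if k: "k < d" for n k
    unfolding K_def by (rule tm_log_row[OF std r k row])
  have opn: "log_coord_term d T r (tm_op d T x) n = (\<Sum>k<d. K n k * x k ^ (?q ^ n)) + D n" for n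
  proof -
    have "log_coord_term d T r (tm_op d T x) n
      = (\<Sum>j<d. \<Sum>k<d. ?P n $$ (r, j) * T 0 $$ (j, k) ^ (?q ^ n) * x k ^ (?q ^ n)
           + ?P n $$ (r, j) * T 1 $$ (j, k) ^ (?q ^ n) * x k ^ (?q ^ Suc n))"
      unfolding log_coord_term_def
    proof (rule sum.cong[OF refl])
      fix j assume "j \<in> {..<d}"
      then have "tm_op d T x j ^ (?q ^ n)
         = (\<Sum>k<d. T 0 $$ (j, k) ^ (?q ^ n) * x k ^ (?q ^ n) + T 1 $$ (j, k) ^ (?q ^ n) * x k ^ (?q ^ Suc n))"
        by (simp add: tm_op_def frob_sum frob_add power_mult_distrib power_mult)
      then show "?P n $$ (r, j) * tm_op d T x j ^ (?q ^ n) = (\<Sum>k<d. ?P n $$ (r, j) * T 0 $$ (j, k) ^ (?q ^ n) * x k ^ (?q ^ n)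
           + ?P n $$ (r, j) * T 1 $$ (j, k) ^ (?q ^ n) * x k ^ (?q ^ Suc n))"
        by (simp add: sum_distrib_left distrib_left mult.assoc)
    qed
    also have "\<dots> = (\<Sum>k<d. \<Sum>j<d. ?P n $$ (r, j) * T 0 $$ (j, k) ^ (?q ^ n) * x k ^ (?q ^ n)
           + ?P n $$ (r, j) * T 1 $$ (j, k) ^ (?q ^ n) * x k ^ (?q ^ Suc n))"
      by (rule sum.swap)
    also have "\<dots> = (\<Sum>k<d. K n k * x k ^ (?q ^ n)) + D n"
      by (simp only: K_def D_def sum.distrib sum_distrib_right)
    finally show ?thesis .
  qed
  have xn: "theta * log_coord_term d T r x n = (\<Sum>k<d. K n k * x k ^ (?q ^ n)) + (if n = 0 then 0 else D (n - 1))" for n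
  proof -
    have "theta * log_coord_term d T r x n = (\<Sum>k<d. (theta * ?P n $$ (r, k)) * x k ^ (?q ^ n))"
      by (simp add: log_coord_term_def sum_distrib_left mult.assoc)
    also have "\<dots> = (\<Sum>k<d. (K n k + (if n = 0 then 0 else \<Sum>j<d. ?P (n - 1) $$ (r, j) * T 1 $$ (j, k) ^ (?q ^ (n - 1))))
        * x k ^ (?q ^ n))"
      by (rule sum.cong) (simp_all only: P lessThan_iff)
    also have "\<dots> = (\<Sum>k<d. K n k * x k ^ (?q ^ n)) + (if n = 0 then 0 else D (n - 1))"
      by (simp only: distrib_right sum.distrib) (simp add: D_def)
    finally show ?thesis .
  qed
  have part: "(\<Sum>n<Suc m. log_coord_term d T r (tm_op d T x) n) = theta * (\<Sum>n<Suc m. log_coord_term d T r x n) + D m" for m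
  proof (induction m)
    case 0
    then show ?case using xn[of 0] opn[of 0] by simp
  next
    case (Suc m)
    have "(\<Sum>n<Suc (Suc m). log_coord_term d T r (tm_op d T x) n)
       = theta * (\<Sum>n<Suc m. log_coord_term d T r x n) + (D m + ((\<Sum>k<d. K (Suc m) k * x k ^ (?q ^ Suc m)) + D (Suc m)))"
      by (subst sum.lessThan_Suc, subst Suc, subst opn) (simp only: add.assoc)
    also have "\<dots> = theta * (\<Sum>n<Suc m. log_coord_term d T r x n) + theta * log_coord_term d T r x (Suc m) + D (Suc m)"
      unfolding xn[of "Suc m"] by simp
    also have "\<dots> = theta * (\<Sum>n<Suc (Suc m). log_coord_term d T r x n) + D (Suc m)"
      by (simp add: distrib_left)
    finally show ?case .
  qed
  have D0: "(\<lambda>n. vabs (\<iota> (D n))) \<longlonglongrightarrow> 0"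
  proof -
    obtain \<rho> where \<rho>: "0 < \<rho>" "\<rho> < 1" "\<And>j. j < d \<Longrightarrow> val (x j) \<le> \<rho>" using small_bound[OF x] by blast
    define B where "B = \<beta> ^ (2 * d)"
    have B: "B \<ge> 1" using beta_ge_1 by (simp add: B_def one_le_power)
    have "val (D n) \<le> B ^ n * \<rho> ^ (?q ^ n)" for n
      unfolding D_def
    proof (rule val_sum_le)
      fix k assume k: "k \<in> {..<d}"
      have 1: "val (\<Sum>j<d. ?P n $$ (r, j) * T 1 $$ (j, k) ^ (?q ^ n)) \<le> B ^ n"
      proof (rule val_sum_le)
        fix j assume j: "j \<in> {..<d}"
        then have "val (?P n $$ (r, j)) * val (T 1 $$ (j, k) ^ (?q ^ n)) \<le> B ^ n * 1"
          using tm_log_bound[OF T r, of j n] power_le_one[OF _ integral_tm_T1[OF T, of j k]] k B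
          by (intro mult_mono) (simp_all add: B_def)
        then show "val (?P n $$ (r, j) * T 1 $$ (j, k) ^ (?q ^ n)) \<le> B ^ n" by simp
      qed (use B in simp)
      have "val (x k ^ (?q ^ Suc n)) \<le> \<rho> ^ (?q ^ Suc n)" unfolding val_power using \<rho>(3)[of k] k by (intro power_mono) auto
      \<comment> \<open>Weakened to the exponent q^n, which is the shape that
        \<open>vabs_bounded_tendsto\<close> expects.\<close>
      also have "\<dots> \<le> \<rho> ^ (?q ^ n)" using \<rho> card_finite_field_gt_1[where 'f = 'a] by (intro power_decreasing power_increasing) auto
      finally have 2: "val (x k ^ (?q ^ Suc n)) \<le> \<rho> ^ (?q ^ n)" .
      show "val ((\<Sum>j<d. ?P n $$ (r, j) * T 1 $$ (j, k) ^ (?q ^ n)) * x k ^ (?q ^ Suc n)) \<le> B ^ n * \<rho> ^ (?q ^ n)"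
        unfolding val_simps(5) using 1 2 B by (intro mult_mono) auto
    qed (use B \<rho> in simp)
    then show ?thesis using B \<rho> by (intro vabs_bounded_tendsto)
  qed
  have L1: "(\<lambda>m. \<iota> (\<Sum>n<Suc m. log_coord_term d T r (tm_op d T x) n)) \<longlonglongrightarrow> log_coord d T r (tm_op d T x)"
    using log_coord_term_sums[OF T r sx] unfolding sums_def hom_sum[symmetric] by (rule LIMSEQ_Suc)
  have L2: "(\<lambda>m. \<iota> (\<Sum>n<Suc m. log_coord_term d T r x n)) \<longlonglongrightarrow> log_coord d T r x"
    using log_coord_term_sums[OF T r x] unfolding sums_def hom_sum[symmetric] by (rule LIMSEQ_Suc)
  have "(\<lambda>m. \<iota> (D m)) \<longlonglongrightarrow> 0" using D0 by (simp add: tendsto_vabs)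
  from tendsto_add_Cv[OF tendsto_cmult_Cv[OF L2, of "\<iota> theta"] this]
  have "(\<lambda>m. \<iota> (\<Sum>n<Suc m. log_coord_term d T r (tm_op d T x) n)) \<longlonglongrightarrow> \<iota> theta * log_coord d T r x"
    unfolding part by (simp only: hom_add hom_mult add_0_right)
  then show ?thesis using L1 LIMSEQ_unique by blast
qed

end

section \<open>Integrality over A, and the logarithm as a module homomorphism on small
  points\<close>

lemma range_A_closed:
  "x \<in> range A_to_kbar \<Longrightarrow> y \<in> range A_to_kbar \<Longrightarrow> x + y \<in> range A_to_kbar"
  "x \<in> range A_to_kbar \<Longrightarrow> y \<in> range A_to_kbar \<Longrightarrow> x * y \<in> range A_to_kbar"
  "x \<in> range A_to_kbar \<Longrightarrow> x ^ n \<in> range A_to_kbar"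
  "0 \<in> range A_to_kbar" "1 \<in> range A_to_kbar" "x \<in> range A_to_kbar \<Longrightarrow> - x \<in> range A_to_kbar"
  by (auto simp: image_iff simp flip: A_to_kbar_hom A_to_kbar_power)

lemma range_A_sum:
  "(\<And>x. x \<in> S \<Longrightarrow> f x \<in> range A_to_kbar) \<Longrightarrow> (\<Sum>x\<in>S. f x) \<in> range A_to_kbar"
  by (induction S rule: infinite_finite_induct) (simp_all add: range_A_closed)

lemma range_A_prod:
  "(\<And>x. x \<in> S \<Longrightarrow> f x \<in> range A_to_kbar) \<Longrightarrow> (\<Prod>x\<in>S. f x) \<in> range A_to_kbar"
  by (induction S rule: infinite_finite_induct) (simp_all add: range_A_closed)

lemma finite_degree_less: "finite {p :: 'a::finite_field poly. degree p < n}"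
proof (rule finite_subset)
  show "{p :: 'a poly. degree p < n} \<subseteq> Poly ` {xs. set xs \<subseteq> UNIV \<and> length xs \<le> n}"
  proof
    fix p :: "'a poly" assume "p \<in> {p. degree p < n}"
    then have "length (coeffs p) \<le> n" by (cases "p = 0") (auto simp: length_coeffs_degree)
    then show "p \<in> Poly ` {xs. set xs \<subseteq> UNIV \<and> length xs \<le> n}"
      by (intro image_eqI[of _ _ "coeffs p"]) auto
  qed
qed (intro finite_imageI finite_lists_length_le, simp)

context Cv_place
begin

lemma integral_tm_std: "integral_tm d T \<Longrightarrow> std_tm d T"
  by (simp add: integral_tm_def)

lemma integral_tm_range:
  assumes "integral_tm d T" "i < d" "j < d"
  shows "T 0 $$ (i, j) \<in> range A_to_kbar" "T 1 $$ (i, j) \<in> range A_to_kbar"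
proof -
  have "T 0 $$ (i, j) = (if i = j then theta else 0) \<or> i < j \<and> T 0 $$ (i, j) = 1"
    using assms by (auto simp: integral_tm_def std_tm_def)
  then show "T 0 $$ (i, j) \<in> range A_to_kbar"
    by (auto simp: theta_def range_A_closed split: if_splits)
  show "T 1 $$ (i, j) \<in> range A_to_kbar" using assms by (auto simp: integral_tm_def)
qed

lemma val_sum_less:
  assumes "c > 0" "\<And>x. x \<in> S \<Longrightarrow> val (f x) < c"
  shows "val (\<Sum>x\<in>S. f x) < c"
  using assms(2)
proof (induction S rule: infinite_finite_induct)
  case (insert x S)
  have "val (f x + sum f S) \<le> max (val (f x)) (val (sum f S))"
    by (rule val_add_le) auto
  also have "\<dots> < c" using insert by simp
  finally show ?case using insert(1,2) by simp
qed (use assms(1) in simp_all)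

lemma small_add: "small d x \<Longrightarrow> small d y \<Longrightarrow> small d (\<lambda>i. x i + y i)"
proof -
  assume "small d x" "small d y"
  \<comment> \<open>Two terms are written as a sum over the booleans, so that the statement for
    finite sums applies.\<close>
  then have "val (\<Sum>b\<in>UNIV. if b then x i else y i) < 1" if "i < d" for i
    using that by (intro val_sum_less) (auto simp: small_def)
  then show ?thesis by (simp add: small_def UNIV_bool add.commute)
qed

lemma val_range_mult_less:
  assumes "a \<in> range A_to_kbar" "val z < 1"
  shows "val (a * z) < 1"
proof -
  have "val a \<le> 1" using assms(1) by auto
  then have "val a * val z \<le> val z" by (simp add: mult_left_le_one_le)
  then show ?thesis using assms(2) by simp
qed

lemma small_scalar: "small d x \<Longrightarrow> a \<in> range A_to_kbar \<Longrightarrow> small d (\<lambda>i. a * x i)"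
  unfolding small_def using val_range_mult_less by blast

text \<open>All coefficients are integral and q-th powers of numbers below 1 stay below 1. This
  keeps the logarithm convergent along Horner's rule.\<close>

lemma small_tm_op:
  assumes T: "integral_tm d T" and x: "small d x"
  shows "small d (tm_op d T x)"
proof -
  have "val (\<Sum>j<d. T 0 $$ (i, j) * x j + T 1 $$ (i, j) * x j ^ CARD('a)) < 1" if i: "i < d" for i
  proof (rule val_sum_less)
    fix j assume j: "j \<in> {..<d}"
    have xj: "val (x j) < 1" using x j by (simp add: small_def)
    then have "val (x j ^ CARD('a)) < 1"
      using card_finite_field_gt_1[where 'f = 'a] by (simp add: power_less_one_iff)
    then have "val (T 1 $$ (i, j) * x j ^ CARD('a)) < 1"
      using integral_tm_range[OF T i, of j] j by (intro val_range_mult_less) auto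
    moreover have "val (T 0 $$ (i, j) * x j) < 1"
      using integral_tm_range[OF T i, of j] j xj by (intro val_range_mult_less) auto
    moreover have "val (T 0 $$ (i, j) * x j + T 1 $$ (i, j) * x j ^ CARD('a))
        \<le> max (val (T 0 $$ (i, j) * x j)) (val (T 1 $$ (i, j) * x j ^ CARD('a)))"
      by (rule val_add_le) auto
    ultimately show "val (T 0 $$ (i, j) * x j + T 1 $$ (i, j) * x j ^ CARD('a)) < 1" by simp
  qed simp
  then show ?thesis by (simp add: small_def tm_op_def)
qed

lemma small_tm_op_poly:
  assumes T: "integral_tm d T" and x: "small d x"
  shows "small d (tm_op_poly d T p x)"
proof (induction p)
  case (pCons c p)
  then show ?case
    unfolding tm_op_poly_pCons by (intro small_add small_scalar x small_tm_op T) auto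
qed (simp add: small_def)

lemma log_coord_unique:
  assumes "(\<lambda>n. \<iota> (log_coord_term d T r x n)) sums l"
  shows "log_coord d T r x = l"
  unfolding log_coord_def using assms by (rule sums_unique[symmetric])

text \<open>Additivity of the Frobenius gives the equation for each term; smallness supplies the
  convergence for adding the series.\<close>

lemma log_coord_sum:
  assumes T: "integral_tm d T" and r: "r < d" and x: "\<And>l. l \<in> L \<Longrightarrow> small d (f l)"
  shows "log_coord d T r (\<lambda>i. \<Sum>l\<in>L. f l i) = (\<Sum>l\<in>L. log_coord d T r (f l))"
proof (rule log_coord_unique)
  have "log_coord_term d T r (\<lambda>i. \<Sum>l\<in>L. f l i) n = (\<Sum>l\<in>L. log_coord_term d T r (f l) n)" for n
    unfolding log_coord_term_def frob_sum sum_distrib_left by (rule sum.swap)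
  moreover have "(\<lambda>n. \<Sum>l\<in>L. \<iota> (log_coord_term d T r (f l) n)) sums (\<Sum>l\<in>L. log_coord d T r (f l))"
    by (intro sums_sum_Cv log_coord_term_sums T r x)
  ultimately show "(\<lambda>n. \<iota> (log_coord_term d T r (\<lambda>i. \<Sum>l\<in>L. f l i) n)) sums (\<Sum>l\<in>L. log_coord d T r (f l))"
    by (simp add: hom_sum)
qed

lemma log_coord_add:
  assumes "integral_tm d T" "r < d" "small d x" "small d y"
  shows "log_coord d T r (\<lambda>i. x i + y i) = log_coord d T r x + log_coord d T r y"
  using log_coord_sum[of d T r UNIV "\<lambda>b. if b then x else y"] assms by (simp add: UNIV_bool add.commute)

lemma log_coord_scalar:
  assumes "integral_tm d T" "r < d" "small d x"
  shows "log_coord d T r (\<lambda>i. A_to_kbar [:c:] * x i) = \<iota> (A_to_kbar [:c:]) * log_coord d T r x"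
proof (rule log_coord_unique)
  have "log_coord_term d T r (\<lambda>i. A_to_kbar [:c:] * x i) n = A_to_kbar [:c:] * log_coord_term d T r x n" for n
    by (simp add: log_coord_term_def power_mult_distrib sum_distrib_left mult.left_commute)
  then show "(\<lambda>n. \<iota> (log_coord_term d T r (\<lambda>i. A_to_kbar [:c:] * x i) n)) sums (\<iota> (A_to_kbar [:c:]) * log_coord d T r x)"
    using tendsto_cmult_Cv[OF log_coord_term_sums[OF assms, unfolded sums_def]]
    by (simp add: sums_def hom_mult flip: sum_distrib_left)
qed

lemma log_coord_tm_op_poly:
  assumes T: "integral_tm d T" and r: "r < d" and x: "small d x"
    and row: "\<And>j. j < d \<Longrightarrow> nilpart T r j = 0"
  shows "log_coord d T r (tm_op_poly d T p x) = \<iota> (A_to_kbar p) * log_coord d T r x"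
proof (induction p)
  case 0
  show ?case using log_coord_sum[OF T r, of "{}"] by simp
next
  case (pCons c p)
  have s: "small d (tm_op_poly d T p x)" "small d (tm_op d T (tm_op_poly d T p x))"
    using small_tm_op_poly[OF T x] small_tm_op[OF T] by blast+
  have "A_to_kbar (pCons c p) = A_to_kbar [:c:] + theta * A_to_kbar p"
    unfolding theta_def by (simp flip: A_to_kbar_hom)
  moreover have "log_coord d T r (tm_op_poly d T (pCons c p) x)
      = \<iota> (A_to_kbar [:c:]) * log_coord d T r x + \<iota> theta * log_coord d T r (tm_op_poly d T p x)"
    unfolding tm_op_poly_pCons
    by (simp add: log_coord_add T r s small_scalar x log_coord_scalar log_coord_tm_op[OF T r s(1) s(2) row])
  ultimately show ?case using pCons by (simp add: hom_distribs distrib_right mult.assoc)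
qed

text \<open>\<open>(A / v)\<^sup>d\<close> is finite, hence a torsion \<open>F\<^sub>q[t]\<close>-module.\<close>

lemma exists_multiplier:
  assumes T: "integral_tm d T" and y: "\<And>j. j < d \<Longrightarrow> y j \<in> range A_to_kbar"
  shows "\<exists>c. c \<noteq> 0 \<and> small d (tm_op_poly d T c y)"
proof -
  have op: "tm_op d T x i \<in> range A_to_kbar"
    if "\<And>j. j < d \<Longrightarrow> x j \<in> range A_to_kbar" for x i
    using that integral_tm_range[OF T]
    by (auto simp: tm_op_def simp del: One_nat_def intro!: range_A_sum range_A_closed)
  have poly: "i < d \<Longrightarrow> tm_op_poly d T p y i \<in> range A_to_kbar" for p i
    by (induction p arbitrary: i) (auto simp: tm_op_poly_pCons intro!: range_A_closed op y)
  define f where "f p i = inv_into UNIV A_to_kbar (tm_op_poly d T p y i)" for p i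
  have f: "tm_op_poly d T p y i = A_to_kbar (f p i)" if "i < d" for p i
    using poly[OF that] by (simp add: f_def f_inv_into_f)
  define g where "g p = map (\<lambda>i. f p i mod v) [0..<d]" for p
  have "v \<noteq> 0" using irr by auto
  have "degree (h mod v) < degree v" for h
    using degree_mod_less[OF \<open>v \<noteq> 0\<close>, of h] degree_v by auto
  then have "range g \<subseteq> {xs. set xs \<subseteq> {p. degree p < degree v} \<and> length xs = d}"
    by (auto simp: g_def)
  then have fin: "finite (range g)"
    by (rule finite_subset) (intro finite_lists_length_eq finite_degree_less)
  have "infinite (UNIV :: 'a poly set)"
  proof
    assume "finite (UNIV :: 'a poly set)"
    then have "finite (range (\<lambda>n. monom (1 :: 'a) n))" by (rule finite_subset[rotated]) simp
    moreover have "inj (\<lambda>n. monom (1 :: 'a) n)" by (rule injI) (simp add: monom_eq_iff')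
    ultimately show False by (simp add: finite_image_iff)
  qed
  \<comment> \<open>Pigeonhole: infinitely many polynomials, finitely many residue vectors modulo v.
    Two polynomials that act alike differ by a multiplier as wanted.\<close>
  then have "\<not> inj g" using fin finite_imageD by blast
  then obtain p p' where p: "p \<noteq> p'" "g p = g p'" by (auto simp: inj_def)
  have "val (tm_op_poly d T (p - p') y i) < 1" if i: "i < d" for i
  proof -
    have "f p i mod v = f p' i mod v"
      using arg_cong[OF p(2), of "\<lambda>xs. xs ! i"] i by (simp add: g_def)
    then have "v dvd f p i - f p' i" by (simp add: mod_eq_dvd_iff)
    then have "val (A_to_kbar (f p i - f p' i)) < 1" by (rule val_A_less_1)
    then show ?thesis using i by (simp add: tm_op_poly_diff f)
  qed
  then show ?thesis using p(1) by (intro exI[of _ "p - p'"]) (simp add: small_def)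
qed

end

section \<open>Gluing\<close>

lemma nth_concat_offset:
  "l < length xss \<Longrightarrow> j < length (xss ! l) \<Longrightarrow> concat xss ! ((\<Sum>k<l. length (xss ! k)) + j) = xss ! l ! j"
proof (induction xss arbitrary: l)
  case (Cons xs xss)
  then show ?case
    by (cases l) (simp_all add: sum.lessThan_Suc_shift nth_append del: sum.lessThan_Suc)
qed simp

lemma length_concat_offset: "length (concat xss) = (\<Sum>k<length xss. length (xss ! k))"
  by (simp add: length_concat sum_list_sum_nth atLeast0LessThan)

lemma hconcat_index:
  assumes "l < length Ms" "j < dim_col (Ms ! l)" "i < n"
    and dims: "\<And>M. M \<in> set Ms \<Longrightarrow> dim_row M = n"
  shows "hconcat n Ms $$ (i, (\<Sum>k<l. dim_col (Ms ! k)) + j) = Ms ! l $$ (i, j)"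
proof -
  let ?xss = "map cols Ms"
  have off: "(\<Sum>k<l. length (?xss ! k)) = (\<Sum>k<l. dim_col (Ms ! k))"
    using assms(1) by (intro sum.cong) auto
  have col: "concat ?xss ! ((\<Sum>k<l. dim_col (Ms ! k)) + j) = col (Ms ! l) j"
    using nth_concat_offset[of l ?xss j] assms off by simp
  have "(\<Sum>k<l. dim_col (Ms ! k)) + dim_col (Ms ! l) = (\<Sum>k<Suc l. dim_col (Ms ! k))" by simp
  also have "\<dots> \<le> (\<Sum>k<length Ms. dim_col (Ms ! k))"
    using assms(1) by (intro sum_mono2) auto
  also have "\<dots> = length (concat ?xss)" by (simp add: length_concat_offset)
  finally have "(\<Sum>k<l. dim_col (Ms ! k)) + j < length (concat ?xss)" using assms(2) by linarith
  then show ?thesis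
    using assms by (simp add: hconcat_def mat_of_cols_index col)
qed

text \<open>Columns are given as block offset plus position, while rows are free: gluing is analysed
  column by column, and a column is supported on the rows of its own block.\<close>

lemma diag_block_mat_index:
  assumes "\<And>M. M \<in> set Ms \<Longrightarrow> square_mat M"
    and "l < length Ms" "j < dim_row (Ms ! l)" "i < sum_list (map dim_row Ms)"
  defines "r \<equiv> (\<Sum>k<l. dim_row (Ms ! k))"
  shows "diag_block_mat Ms $$ (i, r + j)
    = (if r \<le> i \<and> i < r + dim_row (Ms ! l) then Ms ! l $$ (i - r, j) else 0)"
  using assms(1-4) unfolding r_def
proof (induction Ms arbitrary: l i)
  case (Cons M Ms)
  have sq: "dim_col M = dim_row M" using Cons.prems(1)[of M] by simp
  have sqs: "\<And>M. M \<in> set Ms \<Longrightarrow> square_mat M" using Cons.prems(1) by simp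
  then have cols: "sum_list (map dim_col Ms) = sum_list (map dim_row Ms)"
    by (intro arg_cong[where f = sum_list] map_cong) auto
  have dims: "dim_row (diag_block_mat Ms) = sum_list (map dim_row Ms)"
    "dim_col (diag_block_mat Ms) = sum_list (map dim_row Ms)"
    by (simp_all add: dim_diag_block_mat cols)
  show ?case
  proof (cases l)
    case 0
    then show ?thesis using Cons.prems sq by (auto simp: Let_def dims)
  next
    case (Suc l')
    define r' where "r' = (\<Sum>k<l'. dim_row (Ms ! k))"
    have r: "(\<Sum>k<l. dim_row ((M # Ms) ! k)) = dim_row M + r'"
      by (simp add: Suc r'_def sum.lessThan_Suc_shift del: sum.lessThan_Suc)
    have l': "l' < length Ms" "j < dim_row (Ms ! l')" using Cons.prems Suc by simp_all
    have "r' + dim_row (Ms ! l') = (\<Sum>k<Suc l'. dim_row (Ms ! k))" by (simp add: r'_def)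
    also have "\<dots> \<le> (\<Sum>k<length Ms. dim_row (Ms ! k))" using l' by (intro sum_mono2) auto
    also have "\<dots> = sum_list (map dim_row Ms)" by (simp add: sum_list_sum_nth atLeast0LessThan)
    finally have le: "r' + j < sum_list (map dim_row Ms)" using l' by simp
    show ?thesis
    proof (cases "i < dim_row M")
      case True
      then show ?thesis unfolding r using Cons.prems le sq by (simp add: Let_def dims)
    next
      case False
      then have i: "i - dim_row M < sum_list (map dim_row Ms)" using Cons.prems(4) by simp
      have "diag_block_mat (M # Ms) $$ (i, dim_row M + r' + j) = diag_block_mat Ms $$ (i - dim_row M, r' + j)"
        using False i le sq by (simp add: Let_def dims add.assoc)
      also have "\<dots> = (if r' \<le> i - dim_row M \<and> i - dim_row M < r' + dim_row (Ms ! l')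
          then Ms ! l' $$ (i - dim_row M - r', j) else 0)"
        unfolding r'_def by (rule Cons.IH[OF sqs l' i])
      also have "\<dots> = (if dim_row M + r' \<le> i \<and> i < dim_row M + r' + dim_row (Ms ! l')
          then Ms ! l' $$ (i - (dim_row M + r'), j) else 0)"
        using False by auto
      finally show ?thesis unfolding r by (simp add: Suc)
    qed
  qed
qed simp

locale gluing =
  fixes n :: nat and ds :: "nat list"
  assumes n_pos: "n > 0" and ds_ge: "\<And>l. l < length ds \<Longrightarrow> n \<le> ds ! l" and ds_ne: "ds \<noteq> []"
begin

definition off :: "nat \<Rightarrow> nat" where
  "off l = n + (\<Sum>k<l. ds ! k - n)"

definition D :: nat where
  "D = off (length ds)"

text \<open>The map from the coordinates of the \<open>l\<close>-th summand to the coordinates of the glued module.\<close>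

definition emb :: "nat \<Rightarrow> nat \<Rightarrow> nat" where
  "emb l j = (if j < n then j else off l + (j - n))"

lemma off_ge: "off l \<ge> n" by (simp add: off_def)

lemma off_Suc: "off (Suc l) = off l + (ds ! l - n)" by (simp add: off_def)

lemma off_mono: "l \<le> l' \<Longrightarrow> off l \<le> off l'"
  unfolding off_def by (intro add_left_mono sum_mono2) auto

lemma emb_less: "l < length ds \<Longrightarrow> j < ds ! l \<Longrightarrow> emb l j < D"
  using off_Suc[of l] off_mono[of "Suc l" "length ds"] off_ge[of "length ds"] ds_ge[of l]
  by (auto simp: emb_def D_def)

lemma emb_strict_mono: "j < j' \<Longrightarrow> emb l j < emb l j'"
  using off_ge[of l] by (auto simp: emb_def)

lemma emb_inj: "emb l j = emb l j' \<longleftrightarrow> j = j'"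
  by (metis emb_strict_mono less_irrefl nat_neq_iff)

lemma emb_lt_n: "j < n \<Longrightarrow> emb l j = j" by (simp add: emb_def)

lemma emb_disjoint:
  assumes "n \<le> j" "n \<le> j'" "j < ds ! l" "j' < ds ! l'" "emb l j = emb l' j'"
  shows "l = l'"
proof (rule ccontr)
  have *: False if "l < l'" "emb l j = emb l' j'" "n \<le> j" "n \<le> j'" "j < ds ! l" for l l' j j'
    using that off_Suc[of l] off_mono[of "Suc l" l'] by (auto simp: emb_def)
  assume "l \<noteq> l'"
  then show False using *[of l l' j j'] *[of l' l j' j] assms by (cases "l < l'") auto
qed

lemma emb_cover:
  assumes "c < D"
  obtains l j where "l < length ds" "j < ds ! l" "c = emb l j"
proof -
  have "c < off m \<Longrightarrow> m \<le> length ds \<Longrightarrow> n \<le> c \<Longrightarrow> \<exists>l j. l < length ds \<and> j < ds ! l \<and> c = emb l j" for m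
  proof (induction m)
    case 0
    then show ?case by (simp add: off_def)
  next
    case (Suc m)
    show ?case
    proof (cases "c < off m")
      case False
      then have "c = emb m (c - off m + n)" by (simp add: emb_def)
      moreover have "c - off m + n < ds ! m" using Suc.prems False ds_ge[of m] by (simp add: off_Suc)
      ultimately show ?thesis using Suc.prems by (metis Suc_le_lessD)
    qed (use Suc in auto)
  qed
  \<comment> \<open>Common coordinates lie in every summand; summand 0 serves as witness and exists
    by \<open>ds_ne\<close>.\<close>
  moreover have "\<exists>l j. l < length ds \<and> j < ds ! l \<and> c = emb l j" if "c < n"
    using that ds_ge[of 0] ds_ne by (intro exI[of _ 0] exI[of _ c]) (auto simp: emb_def)
  ultimately show ?thesis using assms that unfolding D_def by (metis linorder_not_less order_refl)
qed

text \<open>Pushforward along \<open>emb l\<close>. As \<open>emb l\<close> is injective, at most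
  one term is nonzero; the sum gives 0 off the image without a choice of preimages.\<close>

definition ext :: "nat \<Rightarrow> (nat \<Rightarrow> 'a::comm_monoid_add) \<Rightarrow> nat \<Rightarrow> 'a" where
  "ext l z i = (\<Sum>j<ds ! l. if emb l j = i then z j else 0)"

lemma ext_emb: "j < ds ! l \<Longrightarrow> ext l z (emb l j) = z j"
  by (simp add: ext_def emb_inj)

lemma ext_notin: "i \<notin> emb l ` {..<ds ! l} \<Longrightarrow> ext l z i = 0"
  unfolding ext_def by (rule sum.neutral) auto

lemma ext_linear:
  fixes y z :: "nat \<Rightarrow> 'a::comm_ring_1"
  shows "ext l (\<lambda>j. c * y j + z j) = (\<lambda>i. c * ext l y i + ext l z i)"
  by (auto simp: ext_def fun_eq_iff sum_distrib_left simp flip: sum.distrib intro!: sum.cong)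

lemma sum_emb:
  assumes l: "l < length ds" and g: "\<And>i. i < D \<Longrightarrow> i \<notin> emb l ` {..<ds ! l} \<Longrightarrow> g i = 0"
  shows "(\<Sum>i<D. g i) = (\<Sum>j<ds ! l. g (emb l j))"
proof -
  have "(\<Sum>i<D. g i) = (\<Sum>i\<in>emb l ` {..<ds ! l}. g i)"
    using emb_less[OF l] g by (intro sum.mono_neutral_right) auto
  also have "\<dots> = (\<Sum>j<ds ! l. g (emb l j))"
    by (subst sum.reindex) (auto simp: inj_on_def emb_inj)
  finally show ?thesis .
qed

text \<open>The common block is compared with the head of the list because \<open>glue_mat\<close>
  takes it from there.\<close>

definition glued :: "'a::zero mat list \<Rightarrow> bool" where
  "glued Ms \<longleftrightarrow> length Ms = length ds \<and> (\<forall>l<length ds. Ms ! l \<in> carrier_mat (ds ! l) (ds ! l) \<and>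
     (\<forall>i<n. \<forall>j<n. Ms ! l $$ (i, j) = hd Ms $$ (i, j)) \<and> (\<forall>i<ds ! l. \<forall>j<n. n \<le> i \<longrightarrow> Ms ! l $$ (i, j) = 0))"

text \<open>The column at \<open>emb l j\<close> can be read off from \<open>Ms ! l\<close> alone,
  for every l. For j < n this rests on the common upper left block and the zero block below
  it.\<close>

lemma glue_mat_index:
  assumes Ms: "glued Ms" and l: "l < length ds" and j: "j < ds ! l" and i: "i < D"
  shows "glue_mat n Ms \<in> carrier_mat D D"
    and "glue_mat n Ms $$ (i, emb l j) = (if i < n then Ms ! l $$ (i, j)
      else if off l \<le> i \<and> i < off l + (ds ! l - n) then Ms ! l $$ (i - off l + n, j) else 0)"
proof -
  have len: "length Ms = length ds" using Ms by (simp add: glued_def)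
  have car: "k < length ds \<Longrightarrow> dim_row (Ms ! k) = ds ! k \<and> dim_col (Ms ! k) = ds ! k" for k
    using Ms by (auto simp: glued_def)
  let ?U = "hconcat n (map (right_block n) Ms)" and ?L = "diag_block_mat (map (lower_block n) Ms)"
  let ?R = "mat n n (\<lambda>ij. hd Ms $$ ij)"
  have sq: "square_mat M" if "M \<in> set (map (lower_block n) Ms)" for M
    using that car len by (auto simp: lower_block_def in_set_conv_nth)
  have rows: "sum_list (map dim_row (map (lower_block n) Ms)) = D - n"
    using car len by (simp add: sum_list_sum_nth atLeast0LessThan lower_block_def D_def off_def)
  have cols: "sum_list (map dim_col (map (lower_block n) Ms)) = D - n"
    using car len by (simp add: sum_list_sum_nth atLeast0LessThan lower_block_def D_def off_def)
  have dimU: "dim_col ?U = D - n" "dim_row ?U = n"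
    using car len by (simp_all add: hconcat_def length_concat_offset right_block_def D_def off_def)
  have dimL: "dim_row ?L = D - n" "dim_col ?L = D - n"
    by (simp_all only: dim_diag_block_mat rows cols)
  have Dn: "D \<ge> n" by (simp add: D_def off_ge)
  have glue: "glue_mat n Ms = four_block_mat ?R ?U (0\<^sub>m (D - n) n) ?L"
    unfolding glue_mat_def Let_def dimL ..
  show "glue_mat n Ms \<in> carrier_mat D D"
    unfolding glue using Dn dimL by (intro carrier_matI) simp_all
  have el: "emb l j < D" using l j by (rule emb_less)
  have ix: "glue_mat n Ms $$ (i, emb l j) = (if i < n then if emb l j < n then hd Ms $$ (i, emb l j)
       else ?U $$ (i, emb l j - n) else if emb l j < n then 0 else ?L $$ (i - n, emb l j - n))"
    unfolding glue using Dn el i dimL by (auto simp: index_mat_four_block)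
  show "glue_mat n Ms $$ (i, emb l j) = (if i < n then Ms ! l $$ (i, j)
      else if off l \<le> i \<and> i < off l + (ds ! l - n) then Ms ! l $$ (i - off l + n, j) else 0)"
  proof (cases "j < n")
    case True
    have "Ms ! l $$ (i - off l + n, j) = 0" if "off l \<le> i \<and> i < off l + (ds ! l - n)"
      using that Ms l True by (auto simp: glued_def)
    moreover have "Ms ! l $$ (i, j) = hd Ms $$ (i, j)" if "i < n" using that Ms l True by (auto simp: glued_def)
    ultimately show ?thesis unfolding ix using True by (auto simp: emb_def)
  next
    case False
    then have e: "emb l j - n = (\<Sum>k<l. ds ! k - n) + (j - n)" "\<not> emb l j < n"
      by (auto simp: emb_def off_def)
    have oR: "(\<Sum>k<l. dim_col (map (right_block n) Ms ! k)) = (\<Sum>k<l. ds ! k - n)"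
      using l len car by (intro sum.cong) (auto simp: right_block_def)
    have oL: "(\<Sum>k<l. dim_row (map (lower_block n) Ms ! k)) = (\<Sum>k<l. ds ! k - n)"
      using l len car by (intro sum.cong) (auto simp: lower_block_def)
    show ?thesis
    proof (cases "i < n")
      case True
      have "?U $$ (i, emb l j - n) = map (right_block n) Ms ! l $$ (i, j - n)"
        unfolding e(1) oR[symmetric] using True False l len car j
        by (intro hconcat_index) (auto simp: right_block_def)
      then show ?thesis unfolding ix using True False e(2) l len car j by (simp add: right_block_def)
    next
      case i': False
      have "?L $$ (i - n, emb l j - n) = (if (\<Sum>k<l. ds ! k - n) \<le> i - n \<and>
          i - n < (\<Sum>k<l. ds ! k - n) + dim_row (map (lower_block n) Ms ! l)
          then map (lower_block n) Ms ! l $$ (i - n - (\<Sum>k<l. ds ! k - n), j - n) else 0)"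
        unfolding e(1) oL[symmetric]
        by (rule diag_block_mat_index[OF sq]) (use l len car j False i i' rows in \<open>auto simp: lower_block_def\<close>)
      then show ?thesis unfolding ix using i' False e(2) l len car j
        by (auto simp: lower_block_def off_def add.commute)
    qed
  qed
qed

text \<open>The matrix form of the embedding of a summand being a morphism: columns from summand l
  have no entries outside the image of \<open>emb l\<close>.\<close>

lemma glue_mat_emb:
  assumes Ms: "glued Ms" and l: "l < length ds" and j: "j < ds ! l"
  shows "j' < ds ! l \<Longrightarrow> glue_mat n Ms $$ (emb l j', emb l j) = Ms ! l $$ (j', j)"
    and "i < D \<Longrightarrow> i \<notin> emb l ` {..<ds ! l} \<Longrightarrow> glue_mat n Ms $$ (i, emb l j) = 0"
proof -
  show "glue_mat n Ms $$ (emb l j', emb l j) = Ms ! l $$ (j', j)" if j': "j' < ds ! l"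
    using glue_mat_index(2)[OF Ms l j emb_less[OF l j']] j' off_ge[of l] by (auto simp: emb_def)
  assume i: "i < D" "i \<notin> emb l ` {..<ds ! l}"
  have "\<not> i < n"
  proof
    assume "i < n"
    then have "i = emb l i" "i < ds ! l" using ds_ge[OF l] by (auto simp: emb_def)
    then show False using i by blast
  qed
  moreover have "\<not> (off l \<le> i \<and> i < off l + (ds ! l - n))"
  proof
    assume "off l \<le> i \<and> i < off l + (ds ! l - n)"
    then have "i = emb l (i - off l + n)" "i - off l + n < ds ! l" by (auto simp: emb_def)
    then show False using i by blast
  qed
  ultimately show "glue_mat n Ms $$ (i, emb l j) = 0"
    using glue_mat_index(2)[OF Ms l j i(1)] by (simp only: if_False)
qed

text \<open>Below n all summands contribute, as in the first component of the gluing map. From n on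
  the images of the embeddings are disjoint, so only one does.\<close>

lemma glue_vec_index:
  fixes zs :: "'a::comm_monoid_add vec list"
  assumes len: "length zs = length ds" and dims: "\<And>l. l < length ds \<Longrightarrow> dim_vec (zs ! l) = ds ! l"
    and i: "i < D"
  shows "glue_vec n zs $ i = (\<Sum>l<length ds. ext l (\<lambda>j. zs ! l $ j) i)"
proof (cases "i < n")
  case True
  have "ext l (\<lambda>j. zs ! l $ j) i = zs ! l $ i" if "l < length ds" for l
    using ext_emb[of i l] ds_ge[OF that] True by (simp add: emb_lt_n)
  then show ?thesis using True len by (simp add: glue_vec_def sum_list_sum_nth atLeast0LessThan)
next
  case False
  obtain l j where lj: "l < length ds" "j < ds ! l" "i = emb l j" using i by (rule emb_cover)
  have j: "j \<ge> n" using False lj by (auto simp: emb_def split: if_splits)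
  let ?xss = "map (\<lambda>z. drop n (list_of_vec z)) zs"
  have off': "(\<Sum>k<l. length (?xss ! k)) = (\<Sum>k<l. ds ! k - n)"
    using lj len dims by (intro sum.cong) auto
  have "length (concat ?xss) = D - n"
    using len dims by (simp add: length_concat_offset D_def off_def)
  then have "glue_vec n zs $ i = concat ?xss ! (i - n)"
    using False i by (simp add: glue_vec_def vec_of_list_index)
  also have "i - n = (\<Sum>k<l. length (?xss ! k)) + (j - n)"
    unfolding off' using j lj by (simp add: emb_def off_def)
  also have "concat ?xss ! \<dots> = ?xss ! l ! (j - n)"
    by (rule nth_concat_offset) (use lj j len dims in auto)
  also have "\<dots> = zs ! l $ j" using lj j len dims by (simp add: list_of_vec_index)
  also have "\<dots> = (\<Sum>l'<length ds. if l' = l then zs ! l $ j else 0)" using lj by simp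
  also have "\<dots> = (\<Sum>l'<length ds. ext l' (\<lambda>j. zs ! l' $ j) i)"
  proof (rule sum.cong[OF refl])
    fix l' assume l': "l' \<in> {..<length ds}"
    show "(if l' = l then zs ! l $ j else 0) = ext l' (\<lambda>j. zs ! l' $ j) i"
    proof (cases "l' = l")
      case True
      then show ?thesis using lj by (simp add: ext_emb)
    next
      case ne: False
      have "i \<notin> emb l' ` {..<ds ! l'}"
      proof
        assume "i \<in> emb l' ` {..<ds ! l'}"
        then obtain j' where j': "j' < ds ! l'" "i = emb l' j'" by auto
        then have "n \<le> j'" using False by (auto simp: emb_def split: if_splits)
        then show False using emb_disjoint[of j' j l' l] j' j lj ne by auto
      qed
      then show ?thesis using ne by (simp add: ext_notin)
    qed
  qed
  finally show ?thesis .
qed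

end

locale glued_tm = Cv_place v \<iota> + gluing n ds
  for v :: "'f::finite_field poly" and \<iota> :: "'f kbar \<Rightarrow> 'c::{field,complete_space}" and n ds +
  fixes Ts :: "'f twisted list"
  assumes Ts_glued: "\<And>m. glued (map (\<lambda>T. T m) Ts)"
    and Ts_integral: "\<And>l. l < length ds \<Longrightarrow> integral_tm (ds ! l) (Ts ! l)"
    and Ts_row: "\<And>l j. l < length ds \<Longrightarrow> j < ds ! l \<Longrightarrow> nilpart (Ts ! l) (n - 1) j = 0"
begin

definition Tg :: "'f twisted" where
  "Tg m = glue_mat n (map (\<lambda>T. T m) Ts)"

lemma length_Ts: "length Ts = length ds"
  using Ts_glued[of 0] by (simp add: glued_def)

lemma D_pos: "n - 1 < D"
  using n_pos off_ge[of "length ds"] by (simp add: D_def)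

lemma Tg_carrier: "Tg m \<in> carrier_mat D D"
proof -
  have "0 < length ds" using ds_ne by simp
  moreover have "0 < ds ! 0" using n_pos ds_ge[OF calculation] by linarith
  ultimately show ?thesis
    unfolding Tg_def using glue_mat_index(1)[OF Ts_glued, of 0 0] D_pos by fastforce
qed

lemma Tg_emb:
  assumes "l < length ds" "j < ds ! l"
  shows "j' < ds ! l \<Longrightarrow> Tg m $$ (emb l j', emb l j) = (Ts ! l) m $$ (j', j)"
    and "i < D \<Longrightarrow> i \<notin> emb l ` {..<ds ! l} \<Longrightarrow> Tg m $$ (i, emb l j) = 0"
  using glue_mat_emb[OF Ts_glued assms, of _ m] assms(1) by (simp_all add: Tg_def length_Ts)

lemma emb_less_iff: "emb l i < emb l j \<longleftrightarrow> i < j"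
  by (metis emb_strict_mono emb_inj nat_neq_iff less_asym)

text \<open>Every column comes from some summand by \<open>emb_cover\<close>, and
  \<open>emb l\<close> is increasing, so strict triangularity is inherited column by column.\<close>

lemma Tg_std: "std_tm D Tg"
  unfolding std_tm_def
proof (intro conjI allI impI)
  show "Tg m \<in> carrier_mat D D" for m by (rule Tg_carrier)
  show "Tg m = 0\<^sub>m D D" if m: "2 \<le> m" for m
  proof (rule eq_matI)
    fix i c assume "i < dim_row (0\<^sub>m D D :: 'f kbar mat)" "c < dim_col (0\<^sub>m D D :: 'f kbar mat)"
    then have ic: "i < D" "c < D" by simp_all
    obtain l j where lj: "l < length ds" "j < ds ! l" "c = emb l j" using ic(2) by (rule emb_cover)
    have z: "(Ts ! l) m = 0\<^sub>m (ds ! l) (ds ! l)" using Ts_integral[OF lj(1)] m by (simp add: integral_tm_def std_tm_def)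
    show "Tg m $$ (i, c) = 0\<^sub>m D D $$ (i, c)"
      using Tg_emb[OF lj(1,2), of _ m] z ic lj by (cases "i \<in> emb l ` {..<ds ! l}") auto
  qed (use Tg_carrier[of m] in auto)
  fix i c assume ic: "i < D" "c < D"
  obtain l j where lj: "l < length ds" "j < ds ! l" "c = emb l j" using ic(2) by (rule emb_cover)
  show "Tg 0 $$ (i, c) = (if i = c then theta else 0) \<or> i < c \<and> Tg 0 $$ (i, c) = 1"
  proof (cases "i \<in> emb l ` {..<ds ! l}")
    case True
    then obtain j' where j': "j' < ds ! l" "i = emb l j'" by auto
    have "(Ts ! l) 0 $$ (j', j) = (if j' = j then theta else 0) \<or> j' < j \<and> (Ts ! l) 0 $$ (j', j) = 1"
      using Ts_integral[OF lj(1)] j' lj by (auto simp: integral_tm_def std_tm_def)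
    then show ?thesis
      using Tg_emb(1)[OF lj(1,2) j'(1), of 0] by (simp add: j' lj(3) emb_inj emb_less_iff)
  next
    case False
    then show ?thesis using Tg_emb(2)[OF lj(1,2) ic(1), of 0] lj by auto
  qed
qed

lemma Tg_integral: "integral_tm D Tg"
  unfolding integral_tm_def
proof (intro conjI allI impI Tg_std)
  fix i c assume ic: "i < D" "c < D"
  obtain l j where lj: "l < length ds" "j < ds ! l" "c = emb l j" using ic(2) by (rule emb_cover)
  show "Tg 1 $$ (i, c) \<in> range A_to_kbar"
  proof (cases "i \<in> emb l ` {..<ds ! l}")
    case True
    then obtain j' where j': "j' < ds ! l" "i = emb l j'" by auto
    then show ?thesis
      using Tg_emb(1)[OF lj(1,2) j'(1), of 1] integral_tm_range(2)[OF Ts_integral[OF lj(1)] j'(1) lj(2)] lj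
      by (simp only:)
  next
    case False
    then have "Tg 1 $$ (i, c) = 0" unfolding lj(3) by (rule Tg_emb(2)[OF lj(1,2) ic(1)])
    then show ?thesis by (simp only: range_A_closed(4))
  qed
qed

lemma Tg_row:
  assumes "c < D"
  shows "nilpart Tg (n - 1) c = 0"
proof -
  obtain l j where lj: "l < length ds" "j < ds ! l" "c = emb l j" using assms by (rule emb_cover)
  have e: "n - 1 = emb l (n - 1)" "n - 1 < ds ! l" using n_pos ds_ge[OF lj(1)] by (auto simp: emb_def)
  have "nilpart Tg (emb l (n - 1)) (emb l j) = nilpart (Ts ! l) (n - 1) j"
    unfolding nilpart_def using Tg_emb(1)[OF lj(1,2) e(2), of 0] by (simp add: emb_less_iff)
  then show ?thesis using Ts_row[OF lj(1,2)] e lj by simp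
qed

lemma Tg_sum_emb:
  fixes z :: "nat \<Rightarrow> 'f kbar"
  assumes l: "l < length ds"
  shows "(\<Sum>c<D. f c * ext l z c ^ (CARD('f) ^ m)) = (\<Sum>j<ds ! l. f (emb l j) * z j ^ (CARD('f) ^ m))"
  by (subst sum_emb[OF l]) (simp_all add: ext_notin ext_emb)

text \<open>A point supported on the image of \<open>emb l\<close> meets only columns of summand l,
  and these stay inside that image. So the embedding commutes with t.\<close>

lemma tm_op_ext:
  assumes l: "l < length ds"
  shows "tm_op D Tg (ext l z) = ext l (tm_op (ds ! l) (Ts ! l) z)"
proof
  fix i
  have "(\<Sum>c<D. Tg 0 $$ (i, c) * ext l z c + Tg 1 $$ (i, c) * ext l z c ^ CARD('f))
     = (\<Sum>j<ds ! l. Tg 0 $$ (i, emb l j) * z j + Tg 1 $$ (i, emb l j) * z j ^ CARD('f))"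
    using Tg_sum_emb[OF l, of "\<lambda>c. Tg 0 $$ (i, c)" z 0] Tg_sum_emb[OF l, of "\<lambda>c. Tg 1 $$ (i, c)" z 1]
    by (simp add: sum.distrib)
  then have op: "tm_op D Tg (ext l z) i = (if i < D then
      \<Sum>j<ds ! l. Tg 0 $$ (i, emb l j) * z j + Tg 1 $$ (i, emb l j) * z j ^ CARD('f) else 0)"
    by (simp add: tm_op_def)
  show "tm_op D Tg (ext l z) i = ext l (tm_op (ds ! l) (Ts ! l) z) i"
  proof (cases "i \<in> emb l ` {..<ds ! l}")
    case True
    then obtain j' where j': "j' < ds ! l" "i = emb l j'" by auto
    show ?thesis
      unfolding op using j' emb_less[OF l j'(1)] Tg_emb(1)[OF l _ j'(1)]
      by (simp add: ext_emb) (simp add: tm_op_def)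
  next
    case False
    then show ?thesis unfolding op using Tg_emb(2)[OF l _ _ False] by (simp add: ext_notin)
  qed
qed

lemma ext_zero [simp]: "ext l (\<lambda>_. 0) = (\<lambda>_. 0 :: 'a::comm_monoid_add)"
  by (simp add: ext_def fun_eq_iff)

lemma tm_op_poly_ext:
  assumes l: "l < length ds"
  shows "tm_op_poly D Tg p (ext l z) = ext l (tm_op_poly (ds ! l) (Ts ! l) p z)"
  by (induction p) (simp_all add: tm_op_poly_pCons ext_linear tm_op_ext[OF l])

lemma small_ext:
  assumes "l < length ds" "small (ds ! l) z"
  shows "small D (ext l z)"
  unfolding small_def
proof (intro allI impI)
  fix i assume "i < D"
  show "val (ext l z i) < 1"
    using assms by (cases "i \<in> emb l ` {..<ds ! l}") (auto simp: ext_notin ext_emb small_def)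
qed

text \<open>Read through \<open>emb l\<close>, the row recursion of \<open>tm_log_row\<close> is the
  same for the glued module and the summand. It is solved by an outer induction on the degree in
  \<open>\<tau>\<close> and an inner one on the column, since N feeds only earlier columns into
  column j.\<close>

lemma tm_log_row_emb:
  assumes l: "l < length ds"
  shows "j < ds ! l \<Longrightarrow> tm_log (tmodule_of D Tg) m $$ (n - 1, emb l j)
    = tm_log (tmodule_of (ds ! l) (Ts ! l)) m $$ (n - 1, j)"
proof (induction m arbitrary: j)
  case 0
  have "n - 1 = emb l (n - 1)" "n - 1 < ds ! l" using n_pos ds_ge[OF l] by (auto simp: emb_def)
  then show ?case
    using 0 D_pos emb_less[OF l 0] emb_inj[of l "n - 1" j]
    by (auto simp: tm_log_intertw(2)[OF Tg_std] tm_log_intertw(2)[OF integral_tm_std[OF Ts_integral[OF l]]])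
next
  case (Suc m)
  let ?P = "tm_log (tmodule_of D Tg)" and ?R = "tm_log (tmodule_of (ds ! l) (Ts ! l))"
  let ?T = "Ts ! l" and ?d = "ds ! l" and ?Q = "CARD('f) ^ Suc m"
  have std: "std_tm ?d ?T" using Ts_integral[OF l] by (rule integral_tm_std)
  have nd: "n - 1 < ?d" using n_pos ds_ge[OF l] by simp
  \<comment> \<open>The part from the preceding coefficient; by the outer induction hypothesis it is
    the same for both modules.\<close>
  define W where "W j = (\<Sum>k<?d. ?R m $$ (n - 1, k) * ?T 1 $$ (k, j) ^ (CARD('f) ^ m))" for j
  have split: "(\<Sum>k<?d. F k * ?T 0 $$ (k, j) ^ ?Q) = theta ^ ?Q * F j + (\<Sum>k<j. F k * nilpart ?T k j)"
    if j: "j < ?d" for F j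
  proof -
    have "(\<Sum>k<?d. F k * ?T 0 $$ (k, j) ^ ?Q) = (\<Sum>k<?d. (if k = j then theta ^ ?Q * F k else 0) + F k * nilpart ?T k j)"
      using j by (intro sum.cong) (auto simp: std_tm_T0_frob[OF std] algebra_simps simp del: power_Suc)
    also have "\<dots> = theta ^ ?Q * F j + (\<Sum>k<?d. F k * nilpart ?T k j)"
      using j by (simp add: sum.distrib)
    also have "(\<Sum>k<?d. F k * nilpart ?T k j) = (\<Sum>k<j. F k * nilpart ?T k j)"
      using j by (intro sum.mono_neutral_right) (auto simp: nilpart_def)
    finally show ?thesis .
  qed
  have R: "theta * ?R (Suc m) $$ (n - 1, j) = theta ^ ?Q * ?R (Suc m) $$ (n - 1, j) +
      (\<Sum>k<j. ?R (Suc m) $$ (n - 1, k) * nilpart ?T k j) + W j" if j: "j < ?d" for j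
    unfolding W_def split[OF j, symmetric, of "\<lambda>k. ?R (Suc m) $$ (n - 1, k)"]
    using tm_log_row[OF std nd j Ts_row[OF l], of "Suc m"] by (simp only: nat.simps if_False diff_Suc_1)
  have P: "theta * ?P (Suc m) $$ (n - 1, emb l j) = theta ^ ?Q * ?P (Suc m) $$ (n - 1, emb l j) +
      (\<Sum>k<j. ?P (Suc m) $$ (n - 1, emb l k) * nilpart ?T k j) + W j" if j: "j < ?d" for j
  proof -
    have 1: "(\<Sum>c<D. ?P (Suc m) $$ (n - 1, c) * Tg 0 $$ (c, emb l j) ^ ?Q)
       = (\<Sum>k<?d. ?P (Suc m) $$ (n - 1, emb l k) * ?T 0 $$ (k, j) ^ ?Q)"
      using j by (subst sum_emb[OF l]) (simp_all add: Tg_emb[OF l] del: power_Suc)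
    have 2: "(\<Sum>c<D. ?P m $$ (n - 1, c) * Tg 1 $$ (c, emb l j) ^ (CARD('f) ^ m)) = W j"
      unfolding W_def using j by (subst sum_emb[OF l]) (simp_all add: Tg_emb[OF l] Suc.IH del: One_nat_def)
    show ?thesis
      unfolding split[OF j, symmetric, of "\<lambda>k. ?P (Suc m) $$ (n - 1, emb l k)"] 1[symmetric] 2[symmetric]
      using tm_log_row[OF Tg_std D_pos emb_less[OF l j] Tg_row, of "Suc m"] by (simp only: nat.simps if_False diff_Suc_1)
  qed
  have ne: "theta ^ ?Q - (theta :: 'f kbar) \<noteq> 0" by (rule theta_frob_ne) simp
  show ?case using Suc.prems
  proof (induction j rule: less_induct)
    case (less j)
    have "(\<Sum>k<j. ?P (Suc m) $$ (n - 1, emb l k) * nilpart ?T k j) = (\<Sum>k<j. ?R (Suc m) $$ (n - 1, k) * nilpart ?T k j)"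
      using less by (intro sum.cong) auto
    then have "(theta ^ ?Q - theta) * ?P (Suc m) $$ (n - 1, emb l j) = (theta ^ ?Q - theta) * ?R (Suc m) $$ (n - 1, j)"
      using P[OF less.prems] R[OF less.prems] by (simp add: algebra_simps del: power_Suc)
    then show ?case using ne by (simp del: power_Suc)
  qed
qed

lemma log_coord_ext:
  assumes l: "l < length ds"
  shows "log_coord D Tg (n - 1) (ext l z) = log_coord (ds ! l) (Ts ! l) (n - 1) z"
proof -
  have "log_coord_term D Tg (n - 1) (ext l z) m = log_coord_term (ds ! l) (Ts ! l) (n - 1) z m" for m
    unfolding log_coord_term_def Tg_sum_emb[OF l] by (intro sum.cong refl) (simp add: tm_log_row_emb[OF l] del: One_nat_def)
  then show ?thesis by (simp add: log_coord_def)
qed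

text \<open>
  Smallness of \<open>a\<close> times the glued point says nothing about the single summands, so both sides are
  compared after multiplication by the product of the \<open>c l\<close>.
\<close>

lemma log_coord_glued:
  assumes small_pt: "small D (tm_op_poly D Tg a (\<lambda>i. \<Sum>l<length ds. ext l (tm_op_poly (ds ! l) (Ts ! l) (b l) (y l)) i))"
    and c: "\<And>l. l < length ds \<Longrightarrow> c l \<noteq> 0" "\<And>l. l < length ds \<Longrightarrow> small (ds ! l) (tm_op_poly (ds ! l) (Ts ! l) (c l) (y l))"
  shows "log_coord D Tg (n - 1) (tm_op_poly D Tg a (\<lambda>i. \<Sum>l<length ds. ext l (tm_op_poly (ds ! l) (Ts ! l) (b l) (y l)) i))
    = (\<Sum>l<length ds. \<iota> (A_to_kbar a) * \<iota> (A_to_kbar (b l)) / \<iota> (A_to_kbar (c l)) *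
        log_coord (ds ! l) (Ts ! l) (n - 1) (tm_op_poly (ds ! l) (Ts ! l) (c l) (y l)))"
proof -
  define C where "C = (\<Prod>l<length ds. c l)"
  let ?V = "\<lambda>i. \<Sum>l<length ds. ext l (tm_op_poly (ds ! l) (Ts ! l) (b l) (y l)) i"
  let ?k = "\<lambda>f. \<iota> (A_to_kbar f)"
  have C0: "C \<noteq> 0" using c(1) by (simp add: C_def)
  then have kC: "?k C \<noteq> 0" by simp
  have "?k C * log_coord D Tg (n - 1) (tm_op_poly D Tg a ?V) = log_coord D Tg (n - 1) (tm_op_poly D Tg C (tm_op_poly D Tg a ?V))"
    by (rule log_coord_tm_op_poly[OF Tg_integral D_pos small_pt Tg_row, symmetric])
  also have "tm_op_poly D Tg C (tm_op_poly D Tg a ?V) = (\<lambda>i. \<Sum>l<length ds. ext l (tm_op_poly (ds ! l) (Ts ! l) (C * a * b l) (y l)) i)"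
    by (simp add: tm_op_poly_sum tm_op_poly_ext mult.assoc flip: tm_op_poly_mult)
  also have "log_coord D Tg (n - 1) \<dots> = (\<Sum>l<length ds. ?k a * ?k (b l) * ?k C / ?k (c l) *
        log_coord (ds ! l) (Ts ! l) (n - 1) (tm_op_poly (ds ! l) (Ts ! l) (c l) (y l)))"
  proof -
    have *: "small (ds ! l) (tm_op_poly (ds ! l) (Ts ! l) (C * a * b l) (y l))"
      "log_coord (ds ! l) (Ts ! l) (n - 1) (tm_op_poly (ds ! l) (Ts ! l) (C * a * b l) (y l))
        = ?k a * ?k (b l) * ?k C / ?k (c l) * log_coord (ds ! l) (Ts ! l) (n - 1) (tm_op_poly (ds ! l) (Ts ! l) (c l) (y l))"
      if l: "l < length ds" for l
    proof -
      \<comment> \<open>The cofactor of \<open>c l\<close> in C. Through it C a b_l acts on y_l by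
        way of the small point [c_l] y_l, where the functional equation is available.\<close>
      define e where "e = (\<Prod>k\<in>{..<length ds} - {l}. c k)"
      have C: "C = c l * e" unfolding C_def e_def using l by (simp add: prod.remove)
      have eq: "tm_op_poly (ds ! l) (Ts ! l) (C * a * b l) (y l)
          = tm_op_poly (ds ! l) (Ts ! l) (e * a * b l) (tm_op_poly (ds ! l) (Ts ! l) (c l) (y l))"
        by (simp add: C mult_ac flip: tm_op_poly_mult)
      show "small (ds ! l) (tm_op_poly (ds ! l) (Ts ! l) (C * a * b l) (y l))"
        unfolding eq by (rule small_tm_op_poly[OF Ts_integral[OF l] c(2)[OF l]])
      have nd: "n - 1 < ds ! l" using n_pos ds_ge[OF l] by simp
      have "?k e = ?k C / ?k (c l)" using c(1)[OF l] by (simp add: C hom_mult)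
      moreover have "log_coord (ds ! l) (Ts ! l) (n - 1) (tm_op_poly (ds ! l) (Ts ! l) (C * a * b l) (y l))
        = ?k (e * a * b l) * log_coord (ds ! l) (Ts ! l) (n - 1) (tm_op_poly (ds ! l) (Ts ! l) (c l) (y l))"
        unfolding eq by (rule log_coord_tm_op_poly[OF Ts_integral[OF l] nd c(2)[OF l] Ts_row[OF l]])
      ultimately show "log_coord (ds ! l) (Ts ! l) (n - 1) (tm_op_poly (ds ! l) (Ts ! l) (C * a * b l) (y l))
        = ?k a * ?k (b l) * ?k C / ?k (c l) * log_coord (ds ! l) (Ts ! l) (n - 1) (tm_op_poly (ds ! l) (Ts ! l) (c l) (y l))"
        by (simp add: hom_mult)
    qed
    show ?thesis
      by (subst log_coord_sum[OF Tg_integral D_pos]) (simp_all add: small_ext log_coord_ext * del: One_nat_def)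
  qed
  also have "\<dots> = ?k C * (\<Sum>l<length ds. ?k a * ?k (b l) / ?k (c l) *
        log_coord (ds ! l) (Ts ! l) (n - 1) (tm_op_poly (ds ! l) (Ts ! l) (c l) (y l)))"
    by (simp add: sum_distrib_left mult_ac)
  finally show ?thesis using kC by simp
qed

end

section \<open>The modules attached to compositions\<close>

definition strict01 :: "'a::zero_neq_one mat \<Rightarrow> bool" where
  "strict01 M \<longleftrightarrow> dim_col M = dim_row M \<and>
     (\<forall>i<dim_row M. \<forall>j<dim_row M. M $$ (i, j) = 0 \<or> i < j \<and> M $$ (i, j) = 1)"

lemma strict01_superdiag: "strict01 (superdiag d)"
  by (simp add: strict01_def superdiag_def)

lemma strict01_diag_block_mat: "(\<And>M. M \<in> set Ms \<Longrightarrow> strict01 M) \<Longrightarrow> strict01 (diag_block_mat Ms)"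
proof (induction Ms)
  case (Cons M Ms)
  have M: "dim_col M = dim_row M" "\<And>i j. i < dim_row M \<Longrightarrow> j < dim_row M \<Longrightarrow> M $$ (i, j) = 0 \<or> i < j \<and> M $$ (i, j) = 1"
    using Cons.prems[of M] by (auto simp: strict01_def)
  let ?L = "diag_block_mat Ms"
  have L: "dim_col ?L = dim_row ?L" "\<And>i j. i < dim_row ?L \<Longrightarrow> j < dim_row ?L \<Longrightarrow> ?L $$ (i, j) = 0 \<or> i < j \<and> ?L $$ (i, j) = 1"
    using Cons.IH Cons.prems by (auto simp: strict01_def)
  show ?case
    unfolding strict01_def
  proof (intro conjI allI impI)
    fix i j assume ij: "i < dim_row (diag_block_mat (M # Ms))" "j < dim_row (diag_block_mat (M # Ms))"
    have lt: "i - dim_row M < j - dim_row M \<Longrightarrow> i < j" by arith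
    show "diag_block_mat (M # Ms) $$ (i, j) = 0 \<or> i < j \<and> diag_block_mat (M # Ms) $$ (i, j) = 1"
      using ij M(2)[of i j] L(2)[of "i - dim_row M" "j - dim_row M"] lt
      by (auto simp: Let_def M(1) L(1))
  qed (simp add: Let_def M(1) L(1))
qed (simp add: strict01_def)

context
  fixes s :: "nat list"
  assumes s_pos: "\<forall>m\<in>set s. m \<ge> 1" and s_ne: "s \<noteq> []"
begin

lemma block_dim_0: "block_dim s 0 = sum_list s" by (simp add: block_dim_def)

lemma block_dim_pos: "l < length s \<Longrightarrow> block_dim s l \<ge> 1"
proof -
  assume l: "l < length s"
  then have "s ! l \<ge> 1" using s_pos by simp
  then show ?thesis using l by (simp add: block_dim_def flip: Cons_nth_drop_Suc)
qed

lemma sum_list_pos: "sum_list s > 0"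
  using block_dim_pos[of 0] s_ne by (simp add: block_dim_0)

lemma block_offset_0: "block_offset s 0 = 0" by (simp add: block_offset_def)

lemma block_offset_ge: "l > 0 \<Longrightarrow> block_offset s l \<ge> sum_list s"
proof -
  assume "l > 0"
  then have "(\<Sum>e<1. block_dim s e) \<le> (\<Sum>e<l. block_dim s e)" by (intro sum_mono2) auto
  then show ?thesis by (simp add: block_offset_def block_dim_0)
qed

lemma total_dim_ge: "total_dim s \<ge> sum_list s"
  using block_offset_ge[of "length s"] s_ne by (simp add: total_dim_def)

lemma dim_G_N: "dim_row (G_N s) = total_dim s" "dim_col (G_N s) = total_dim s"
  by (simp_all add: G_N_def dim_diag_block_mat total_dim_def block_offset_def superdiag_def
      interv_sum_list_conv_sum_set_nat atLeast0LessThan o_def)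

lemma strict01_G_N: "strict01 (G_N s)"
  unfolding G_N_def by (rule strict01_diag_block_mat) (auto simp: strict01_superdiag)

text \<open>The first block has the full weight \<open>sum_list s\<close> as its size; splitting it
  off leaves zero blocks beside and below it.\<close>

lemma G_N_index:
  assumes "i < total_dim s" "j < total_dim s"
  shows "i < sum_list s \<Longrightarrow> j < sum_list s \<Longrightarrow> (G_N s :: 'f::finite_field kbar mat) $$ (i, j) = (if j = i + 1 then 1 else 0)"
    and "i < sum_list s \<Longrightarrow> \<not> j < sum_list s \<Longrightarrow> (G_N s :: 'f kbar mat) $$ (i, j) = 0"
    and "\<not> i < sum_list s \<Longrightarrow> j < sum_list s \<Longrightarrow> (G_N s :: 'f kbar mat) $$ (i, j) = 0"
proof -
  let ?L = "diag_block_mat (map (\<lambda>l. superdiag (block_dim s l)) [1..<length s]) :: 'f kbar mat"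
  let ?m = "dim_row ?L"
  have N: "(G_N s :: 'f kbar mat) = four_block_mat (superdiag (sum_list s)) (0\<^sub>m (sum_list s) (dim_col ?L)) (0\<^sub>m ?m (sum_list s)) ?L"
    using s_ne by (simp add: G_N_def upt_conv_Cons block_dim_0 Let_def) (simp add: superdiag_def)
  have dims: "dim_row (G_N s :: 'f kbar mat) = total_dim s" "dim_col (G_N s :: 'f kbar mat) = total_dim s"
    by (rule dim_G_N)+
  have ij: "i < sum_list s + ?m" "j < sum_list s + dim_col ?L"
    using assms dims unfolding N by (simp_all add: superdiag_def)
  show "i < sum_list s \<Longrightarrow> j < sum_list s \<Longrightarrow> (G_N s :: 'f kbar mat) $$ (i, j) = (if j = i + 1 then 1 else 0)"
    "i < sum_list s \<Longrightarrow> \<not> j < sum_list s \<Longrightarrow> (G_N s :: 'f kbar mat) $$ (i, j) = 0"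
    "\<not> i < sum_list s \<Longrightarrow> j < sum_list s \<Longrightarrow> (G_N s :: 'f kbar mat) $$ (i, j) = 0"
    unfolding N using ij by (simp_all add: superdiag_def)
qed

text \<open>A column below the weight is the first column of block m only for m = 0, and l \<le> m
  forces l = 0, where the product is empty. Hence u does not occur.\<close>

lemma G_E_index:
  assumes ij: "i < total_dim s" "j < total_dim s" and j: "j < sum_list s"
  shows "i < sum_list s \<Longrightarrow> G_E s u $$ (i, j) = (if i = sum_list s - 1 \<and> j = 0 then 1 else 0)"
    and "\<not> i < sum_list s \<Longrightarrow> G_E s u $$ (i, j) = 0"
proof -
  let ?t = "\<lambda>l m. if i = block_offset s l + block_dim s l - 1 \<and> j = block_offset s m
       then (-1) ^ (m - l) * (\<Prod>e\<in>{l..<m}. u ! e) else 0"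
  have E: "G_E s u $$ (i, j) = (\<Sum>l<length s. \<Sum>m\<in>{l..<length s}. ?t l m)"
    using ij by (simp add: G_E_def)
  have m: "m = 0" if "j = block_offset s m" for m
    using block_offset_ge[of m] j that by (cases m) auto
  show "G_E s u $$ (i, j) = 0" if i: "\<not> i < sum_list s"
  proof -
    have "?t l m = 0" if "m \<in> {l..<length s}" for l m
      using m[of m] that i sum_list_pos by (auto simp: block_offset_0 block_dim_0)
    then show ?thesis unfolding E by (intro sum.neutral ballI) auto
  qed
  show "G_E s u $$ (i, j) = (if i = sum_list s - 1 \<and> j = 0 then 1 else 0)" if i: "i < sum_list s"
  proof -
    let ?v = "if i = sum_list s - 1 \<and> j = 0 then 1 else 0"
    have t: "?t l m = (if m = 0 then if l = 0 then ?v else 0 else 0)" if l: "l < length s" and lm: "m \<in> {l..<length s}" for l m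
    proof (cases "l = 0")
      case True
      then show ?thesis using m[of m] by (auto simp: block_offset_0 block_dim_0)
    next
      case False
      then have "block_offset s l + block_dim s l - 1 \<ge> sum_list s"
        using block_offset_ge[of l] block_dim_pos[OF l] by simp
      then show ?thesis using False i by auto
    qed
    have "(\<Sum>m\<in>{l..<length s}. ?t l m) = (if l = 0 then ?v else 0)" if l: "l < length s" for l
    proof -
      have "(\<Sum>m\<in>{l..<length s}. ?t l m) = (\<Sum>m\<in>{l..<length s}. if m = 0 then if l = 0 then ?v else 0 else 0)"
        by (rule sum.cong[OF refl t[OF l]])
      also have "\<dots> = (if l = 0 then ?v else 0)" using l by (subst sum.delta) auto
      finally show ?thesis .
    qed
    then have "G_E s u $$ (i, j) = (\<Sum>l<length s. if l = 0 then ?v else 0)"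
      unfolding E by (intro sum.cong) auto
    also have "\<dots> = ?v" using s_ne by (subst sum.delta) auto
    finally show ?thesis .
  qed
qed

lemma G_rho_t_0_index:
  assumes "i < total_dim s" "j < total_dim s"
  shows "G_rho_t s u 0 $$ (i, j) = (if i = j then theta else 0) + G_N s $$ (i, j)"
  using assms by (simp add: G_rho_t_def dim_G_N)

lemma G_rho_t_carrier: "G_rho_t s u m \<in> carrier_mat (total_dim s) (total_dim s)"
  by (auto simp: G_rho_t_def G_E_def dim_G_N)

lemma G_rho_t_std:
  fixes u :: "'f::finite_field kbar list"
  shows "std_tm (total_dim s) (G_rho_t s u)"
  unfolding std_tm_def
proof (intro conjI allI impI)
  fix i j assume ij: "i < total_dim s" "j < total_dim s"
  have strict: "strict01 (G_N s :: 'f kbar mat)" by (rule strict01_G_N)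
  have "G_N s $$ (i, j) = (0 :: 'f kbar) \<or> i < j \<and> G_N s $$ (i, j) = (1 :: 'f kbar)"
    using strict ij by (simp add: strict01_def dim_G_N)
  then show "G_rho_t s u 0 $$ (i, j) = (if i = j then theta else 0) \<or> i < j \<and> G_rho_t s u 0 $$ (i, j) = 1"
    using G_rho_t_0_index[OF ij, of u] by auto
qed (simp_all add: G_rho_t_carrier, simp add: G_rho_t_def)

lemma G_rho_t_integral:
  assumes u: "length u = length s" "set u \<subseteq> range A_to_kbar"
  shows "integral_tm (total_dim s) (G_rho_t s u)"
proof -
  have "G_E s u $$ (i, j) \<in> range A_to_kbar" if ij: "i < total_dim s" "j < total_dim s" for i j
  proof -
    have "(if i = block_offset s l + block_dim s l - 1 \<and> j = block_offset s m
       then (-1) ^ (m - l) * (\<Prod>e\<in>{l..<m}. u ! e) else 0) \<in> range A_to_kbar" if "m \<in> {l..<length s}" for l m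
    proof -
      have "u ! e \<in> range A_to_kbar" if "e \<in> {l..<m}" for e
        using u that \<open>m \<in> _\<close> by (simp add: subset_iff)
      then show ?thesis by (auto intro!: range_A_closed range_A_prod simp del: rangeI)
    qed
    note entry = this
    have "G_E s u $$ (i, j) = (\<Sum>l<length s. \<Sum>m\<in>{l..<length s}.
        if i = block_offset s l + block_dim s l - 1 \<and> j = block_offset s m
        then (-1) ^ (m - l) * (\<Prod>e\<in>{l..<m}. u ! e) else 0)"
      using ij by (simp add: G_E_def)
    also have "\<dots> \<in> range A_to_kbar" by (intro range_A_sum entry)
    finally show ?thesis .
  qed
  then show ?thesis by (simp add: integral_tm_def G_rho_t_std) (simp add: G_rho_t_def)
qed

text \<open>This is the last row of the first block of N, where the superdiagonal has run out. It
  supplies the hypothesis of \<open>tm_log_row\<close> and \<open>log_coord_tm_op\<close>.\<close>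

lemma G_rho_t_row:
  fixes u :: "'f::finite_field kbar list"
  assumes j: "j < total_dim s"
  shows "nilpart (G_rho_t s u) (sum_list s - 1) j = 0"
proof -
  have i: "sum_list s - 1 < sum_list s" "sum_list s - 1 < total_dim s"
    using sum_list_pos total_dim_ge by auto
  have "G_N s $$ (sum_list s - 1, j) = (0 :: 'f kbar)"
    using G_N_index(1,2)[OF i(2) j] i(1) by (cases "j < sum_list s") auto
  then show ?thesis using G_rho_t_0_index[OF i(2) j, of u] by (auto simp: nilpart_def)
qed

text \<open>The right-hand side involves s only through its weight and u not at all: it is the block
  R shared by all summands.\<close>

lemma G_rho_t_top_left:
  assumes "i < sum_list s" "j < sum_list s"
  shows "G_rho_t s u m $$ (i, j) =
    (if m = 0 then (if i = j then theta else 0) + (if j = i + 1 then 1 else 0)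
     else if m = 1 then if i = sum_list s - 1 \<and> j = 0 then 1 else 0 else 0)"
proof -
  have ij: "i < total_dim s" "j < total_dim s" using assms total_dim_ge by auto
  show ?thesis
    using G_N_index(1)[OF ij assms] G_E_index(1)[OF ij assms(2,1), of u] G_rho_t_0_index[OF ij, of u] ij
    by (auto simp: G_rho_t_def)
qed

lemma G_rho_t_bottom_left:
  assumes "i < total_dim s" "sum_list s \<le> i" "j < sum_list s"
  shows "G_rho_t s u m $$ (i, j) = 0"
proof -
  have ij: "i < total_dim s" "j < total_dim s" "\<not> i < sum_list s" using assms total_dim_ge by auto
  show ?thesis
    using G_N_index(3)[OF ij(1,2,3) assms(3)] G_E_index(2)[OF ij(1,2) assms(3) ij(3), of u] G_rho_t_0_index[OF ij(1,2), of u] ij assms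
    by (auto simp: G_rho_t_def)
qed

lemma v_point_range:
  assumes u: "length u = length s" "set u \<subseteq> range A_to_kbar" and i: "i < total_dim s"
  shows "v_point s u $ i \<in> range A_to_kbar"
proof -
  have "(\<Prod>e\<in>{l..<length s}. u ! e) \<in> range A_to_kbar" for l
    using u by (intro range_A_prod) (simp add: subset_iff)
  then show ?thesis
    using i by (auto simp: v_point_def intro!: range_A_sum range_A_closed simp del: rangeI)
qed

end

section \<open>Merged compositions, Carlitz factorials, and the translation of
  \<open>Li_star\<close>\<close>

lemma tm_op_poly_cong:
  assumes "\<And>j. j < d \<Longrightarrow> x j = y j"
  shows "i < d \<Longrightarrow> tm_op_poly d T p x i = tm_op_poly d T p y i"
proof (induction p arbitrary: i)
  case (pCons c p)
  have "tm_op d T (tm_op_poly d T p x) i = tm_op d T (tm_op_poly d T p y) i"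
    using pCons by (simp add: tm_op_def)
  then show ?case using pCons.prems assms by (simp add: tm_op_poly_pCons)
qed simp

text \<open>Only the separators and the number of entries decide where neighbours merge, so the
  merged composition and the merged tuple match in length.\<close>

lemma length_join_adjacent:
  "length xs = length ys \<Longrightarrow> length (join_adjacent f P xs) = length (join_adjacent g P ys)"
proof (induction P arbitrary: xs ys)
  case (Cons p P)
  \<comment> \<open>\<open>remdups_adj.cases\<close> serves only as the split into empty,
    one-element and longer lists, the pattern of \<open>join_adjacent\<close>.\<close>
  consider "length xs < 2" | x y xs' a b ys' where "xs = x # y # xs'" "ys = a # b # ys'"
    using Cons.prems by (cases xs rule: remdups_adj.cases; cases ys rule: remdups_adj.cases) auto
  then show ?case
  proof cases
    case 1
    then have "join_adjacent f (p # P) xs = xs" "join_adjacent g (p # P) ys = ys"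
      using Cons.prems by (cases p; cases xs rule: remdups_adj.cases; cases ys rule: remdups_adj.cases; simp)+
    then show ?thesis using Cons.prems by simp
  next
    case 2
    then show ?thesis
      using Cons.prems Cons.IH[of "y # xs'" "b # ys'"] Cons.IH[of "f x y # xs'" "g a b # ys'"]
      by (cases p) simp_all
  qed
qed simp

text \<open>Merging by addition keeps the weight, so all summands share the same n.\<close>

lemma sum_list_join_adjacent: "sum_list (join_adjacent (+) P xs) = sum_list (xs :: nat list)"
proof (induction P arbitrary: xs)
  case (Cons p P)
  show ?case
    by (cases p; cases xs rule: remdups_adj.cases) (simp_all add: Cons.IH)
qed simp

lemma join_adjacent_pos:
  "\<forall>m\<in>set xs. m \<ge> (1 :: nat) \<Longrightarrow> m \<in> set (join_adjacent (+) P xs) \<Longrightarrow> m \<ge> 1"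
proof (induction P arbitrary: xs)
  case (Cons p P)
  show ?case
  proof (cases xs rule: remdups_adj.cases)
    case (3 x y zs)
    then show ?thesis
      using Cons.prems Cons.IH[of "y # zs"] Cons.IH[of "(x + y) # zs"] by (cases p) auto
  qed (use Cons.prems in \<open>cases p; simp\<close>)+
qed simp

lemma map_conv_nth: "map f xs = map (\<lambda>l. f (xs ! l)) [0..<length xs]"
  by (rule nth_equalityI) simp_all

lemma carlitz_D_nonzero: "carlitz_D i \<noteq> (0 :: 'f::finite_field poly)"
proof -
  have "monom 1 (CARD('f) ^ i) - monom (1 :: 'f) (CARD('f) ^ j) \<noteq> 0" if "j < i" for j
  proof -
    have "CARD('f) ^ j < CARD('f) ^ i"
      using that card_finite_field_gt_1[where 'f = 'f] by (rule power_strict_increasing)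
    then show ?thesis by (simp add: monom_eq_iff')
  qed
  then show ?thesis by (simp add: carlitz_D_def)
qed

lemma Gamma_list_nonzero: "Gamma_list s \<noteq> (0 :: 'f::finite_field poly)"
  by (auto simp: Gamma_list_def carlitz_Gamma_def carlitz_D_nonzero prod_list_zero_iff Let_def)

context Cv_place
begin

lemma log_coord_term_cong: "(\<And>j. j < d \<Longrightarrow> x j = y j) \<Longrightarrow> log_coord_term d T r x n = log_coord_term d T r y n"
  by (simp add: log_coord_term_def)

lemma log_coord_cong: "(\<And>j. j < d \<Longrightarrow> x j = y j) \<Longrightarrow> log_coord d T r x = log_coord d T r y"
  unfolding log_coord_def by (subst log_coord_term_cong) auto

lemma small_cong: "(\<And>j. j < d \<Longrightarrow> x j = y j) \<Longrightarrow> small d x \<longleftrightarrow> small d y"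
  by (simp add: small_def)

lemma log_term_index:
  fixes x :: "'a kbar vec"
  assumes T: "std_tm d T" and x: "dim_vec x = d" and r: "r < d"
  shows "log_term \<iota> (tmodule_of d T) (map_vec \<iota> x) n $ r = \<iota> (log_coord_term d T r (\<lambda>j. x $ j) n)"
proof -
  have "tm_log (tmodule_of d T) n \<in> carrier_mat d d" using tm_log_intertw(1)[OF T] by simp
  then show ?thesis
    using x r by (auto simp: log_term_def log_coord_term_def scalar_prod_def lessThan_atLeast0 hom_sum hom_mult hom_power
        intro!: sum.cong)
qed

lemma log_converges_small:
  fixes x :: "'a kbar vec"
  assumes T: "integral_tm d T" and x: "dim_vec x = d" and s: "small d (\<lambda>j. x $ j)"
  shows "log_converges \<iota> (tmodule_of d T) (map_vec \<iota> x)"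
  unfolding log_converges_def tm_dim_tmodule_of
  using log_coord_term_summable[OF T _ s] by (simp add: log_term_index[OF integral_tm_std[OF T] x])

lemma log_value_index:
  fixes x :: "'a kbar vec"
  assumes T: "integral_tm d T" and x: "dim_vec x = d" and r: "r < d"
  shows "log_value \<iota> (tmodule_of d T) (map_vec \<iota> x) $ r = log_coord d T r (\<lambda>j. x $ j)"
  using r by (simp add: log_value_def log_coord_def log_term_index[OF integral_tm_std[OF T] x])

lemma vabs_vec_less_1_iff:
  fixes x :: "'a kbar vec"
  assumes "dim_vec x = d" "d > 0"
  shows "vabs_vec (map_vec \<iota> x) < 1 \<longleftrightarrow> small d (\<lambda>j. x $ j)"
proof -
  have "(\<lambda>j. vabs (map_vec \<iota> x $ j)) ` {..<dim_vec (map_vec \<iota> x)} = (\<lambda>j. val (x $ j)) ` {..<d}"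
    using assms(1) by (intro image_cong) (auto simp: val_def)
  then have "vabs_vec (map_vec \<iota> x) = Max ((\<lambda>j. val (x $ j)) ` {..<d})"
    unfolding vabs_vec_def by (rule arg_cong)
  also have "\<dots> < 1 \<longleftrightarrow> small d (\<lambda>j. x $ j)"
    using assms(2) by (subst Max_less_iff) (auto simp: small_def)
  finally show ?thesis .
qed

text \<open>The \<open>SOME\<close> in \<open>Li_star\<close> has a witness:
  \<open>exists_multiplier\<close> makes the point small, and smallness gives convergence. The
  selected c comes with the properties that \<open>log_coord_glued\<close> asks for, where it may
  vary with the summand.\<close>

lemma Li_star_eq:
  fixes t :: "nat list" and w :: "'a poly list"
  assumes t: "\<forall>m\<in>set t. m \<ge> 1" "t \<noteq> []" and w: "length w = length t"
  defines "d \<equiv> total_dim (rev t)" and "T \<equiv> G_rho_t (rev t) (rev (map A_to_kbar w))"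
  shows "\<exists>c. c \<noteq> 0 \<and> small d (tm_op_poly d T c (\<lambda>j. tilde_v t w $ j)) \<and>
    Li_star \<iota> t w = (-1) ^ (length t - 1) / \<iota> (A_to_kbar c) *
      log_coord d T (sum_list t - 1) (tm_op_poly d T c (\<lambda>j. tilde_v t w $ j))"
proof -
  let ?u = "rev (map A_to_kbar w)"
  have rt: "\<forall>m\<in>set (rev t). m \<ge> 1" "rev t \<noteq> []" using t by auto
  have u: "length ?u = length (rev t)" "set ?u \<subseteq> range A_to_kbar" using w by auto
  have T: "integral_tm d T" unfolding T_def d_def by (rule G_rho_t_integral[OF rt u])
  have G: "tilde_G t w = tmodule_of d T" by (simp add: tilde_G_def G_mod_def d_def T_def)
  have dv: "dim_vec (tilde_v t w) = d" by (simp add: tilde_v_def v_point_def d_def)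
  have sum_rev: "sum_list (rev t) = sum_list t" by simp
  have r: "sum_list t - 1 < d" and d0: "d > 0"
    using sum_list_pos[OF rt] total_dim_ge[OF rt] by (simp_all add: d_def)
  let ?y = "\<lambda>j. tilde_v t w $ j"
  let ?x = "\<lambda>c. tm_act (tmodule_of d T) c (tilde_v t w)"
  have ix: "j < d \<Longrightarrow> ?x c $ j = tm_op_poly d T c ?y j" for c j
    by (rule tm_act_index[OF integral_tm_std[OF T] dv])
  have sm: "vabs_vec (map_vec \<iota> (?x c)) < 1 \<longleftrightarrow> small d (tm_op_poly d T c ?y)" for c
    using vabs_vec_less_1_iff[of "?x c" d] d0 small_cong[of d "\<lambda>j. ?x c $ j", OF ix] by simp
  obtain c0 where c0: "c0 \<noteq> 0" "small d (tm_op_poly d T c0 ?y)"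
    using exists_multiplier[OF T, of ?y] v_point_range[OF rt u] by (auto simp: tilde_v_def d_def)
  let ?Q = "\<lambda>c. c \<noteq> 0 \<and> vabs_vec (map_vec \<iota> (?x c)) < 1 \<and> log_converges \<iota> (tmodule_of d T) (map_vec \<iota> (?x c))"
  have "?Q c0"
    using c0 log_converges_small[OF T, of "?x c0"] small_cong[of d "\<lambda>j. ?x c0 $ j", OF ix] by (simp add: sm)
  then have Q: "?Q (SOME c. ?Q c)" by (rule someI)
  define c where "c = (SOME c. ?Q c)"
  have "Li_star \<iota> t w = (-1) ^ (length t - 1) / \<iota> (A_to_kbar c) *
      log_value \<iota> (tmodule_of d T) (map_vec \<iota> (?x c)) $ (sum_list t - 1)"
    unfolding Li_star_def Let_def G c_def ..
  also have "log_value \<iota> (tmodule_of d T) (map_vec \<iota> (?x c)) $ (sum_list t - 1)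
      = log_coord d T (sum_list t - 1) (tm_op_poly d T c ?y)"
    using log_value_index[OF T _ r, of "?x c"] log_coord_cong[of d "\<lambda>j. ?x c $ j", OF ix] by simp
  finally have "Li_star \<iota> t w = (-1) ^ (length t - 1) / \<iota> (A_to_kbar c) *
      log_coord d T (sum_list t - 1) (tm_op_poly d T c ?y)" .
  moreover have "c \<noteq> 0" "small d (tm_op_poly d T c ?y)"
    using Q unfolding c_def[symmetric] by (simp_all add: sm)
  ultimately show ?thesis by (intro exI[of _ c] conjI)
qed

end

theorem theorem6p2p4:
  fixes v :: "'f::finite_field poly"
    and \<iota> :: "'f kbar \<Rightarrow> 'c::{field,complete_space}"
    and s :: "nat list"
    and ix :: "(nat list \<times> separator list) list"
    and a :: "'f poly"
  assumes "irreducible v" and "lead_coeff v = 1"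
    and "Cv_embedding v \<iota>"
    and "s \<noteq> []" and "\<forall>m\<in>set s. m \<ge> 1"
    and "distinct ix" and "set ix = J_set TYPE('f) s \<times> S_set (length s - 1)"
    and "a \<noteq> 0"
    and "vabs_vec (map_vec \<iota> (tm_act (MZV_module s ix) a (MZV_point s ix))) < 1"
  shows "log_converges \<iota> (MZV_module s ix)
           (map_vec \<iota> (tm_act (MZV_module s ix) a (MZV_point s ix))) \<and>
         log_value \<iota> (MZV_module s ix)
           (map_vec \<iota> (tm_act (MZV_module s ix) a (MZV_point s ix))) $ (sum_list s - 1)
         = \<iota> (A_to_kbar a) * \<iota> (A_to_kbar (Gamma_list s)) * zeta_v \<iota> s"
proof -
  interpret Cv_place v \<iota>
    using assms(1,3) by (simp add: Cv_place_def Cv_place_axioms_def)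
  define n where "n = sum_list s"
  define t where "t l = join_adjacent (+) (snd (ix ! l)) s" for l
  define w :: "nat \<Rightarrow> 'f poly list" where "w l = join_adjacent (*) (snd (ix ! l)) (u_tuple s (fst (ix ! l)))" for l
  define d where "d l = total_dim (rev (t l))" for l
  define T :: "nat \<Rightarrow> 'f twisted" where "T l = G_rho_t (rev (t l)) (rev (map A_to_kbar (w l)))" for l
  define y where "y l = (\<lambda>j. tilde_v (t l) (w l) $ j)" for l
  define b :: "nat \<Rightarrow> 'f poly" where "b l = summand_b s (ix ! l)" for l
  define ds where "ds = map d [0..<length ix]"
  define Ts where "Ts = map T [0..<length ix]"
  have t1: "\<forall>m\<in>set (t l). m \<ge> 1" and t3: "sum_list (t l) = n" for l
    using join_adjacent_pos[OF assms(5)] by (auto simp: t_def n_def sum_list_join_adjacent)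
  have t2: "t l \<noteq> []" for l
  proof
    assume "t l = []"
    then have "sum_list s = 0" using t3[of l] unfolding n_def by simp
    then show False using sum_list_pos[OF assms(5,4)] by linarith
  qed
  note t = t1 t2 t3
  have w: "length (w l) = length (t l)" for l
    unfolding w_def t_def by (rule length_join_adjacent) (simp add: u_tuple_def)
  have rt: "\<forall>m\<in>set (rev (t l)). m \<ge> 1" "rev (t l) \<noteq> []" "sum_list (rev (t l)) = n" for l
    using t[of l] by auto
  have rw: "length (rev (map A_to_kbar (w l))) = length (rev (t l))" "set (rev (map A_to_kbar (w l))) \<subseteq> range A_to_kbar" for l
    using w[of l] by auto
  have T: "integral_tm (d l) (T l)" for l
    unfolding T_def d_def by (rule G_rho_t_integral[OF rt(1,2) rw])
  have n0: "n > 0" using sum_list_pos[OF rt(1,2)[of 0]] rt(3)[of 0] by simp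
  have dn: "n \<le> d l" for l
    using total_dim_ge[OF rt(1,2)[of l]] rt(3)[of l] by (simp add: d_def)
  \<comment> \<open>The zero tuple with commas is an index, so there is a first summand from which
    the common block can be taken.\<close>
  have "replicate (length s) 0 \<in> J_set TYPE('f) s" "replicate (length s - 1) Comma \<in> S_set (length s - 1)"
    by (simp_all add: J_set_def S_set_def)
  then have "set ix \<noteq> {}" unfolding assms(7) by blast
  then have ix_ne: "ix \<noteq> []" by auto
  have len: "length ds = length ix" "length Ts = length ix" by (simp_all add: ds_def Ts_def)
  have nth: "l < length ds \<Longrightarrow> ds ! l = d l" "l < length ds \<Longrightarrow> Ts ! l = T l" for l
    by (simp_all add: ds_def Ts_def)
  interpret gl: gluing n ds
    by unfold_locales (use n0 dn ix_ne in \<open>auto simp: ds_def\<close>)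
  interpret glued_tm v \<iota> n ds Ts
  proof unfold_locales
    show "gl.glued (map (\<lambda>T. T m) Ts)" for m
      unfolding gl.glued_def
    proof (intro conjI allI impI)
      fix l assume l: "l < length ds"
      show "map (\<lambda>T. T m) Ts ! l \<in> carrier_mat (ds ! l) (ds ! l)"
        using l T[of l] len nth by (auto simp: integral_tm_def std_tm_def)
      have hd: "hd (map (\<lambda>T. T m) Ts) = T 0 m" using ix_ne by (simp add: Ts_def hd_map upt_conv_Cons)
      show "map (\<lambda>T. T m) Ts ! l $$ (i, j) = hd (map (\<lambda>T. T m) Ts) $$ (i, j)" if "i < n" "j < n" for i j
      proof -
        \<comment> \<open>The right-hand side is free of k, so it also describes the head of the
          list.\<close>
        have "T k m $$ (i, j) = (if m = 0 then (if i = j then theta else 0) + (if j = i + 1 then 1 else 0)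
            else if m = 1 then if i = n - 1 \<and> j = 0 then 1 else 0 else 0)" for k
          using G_rho_t_top_left[OF rt(1,2)[of k], of i j "rev (map A_to_kbar (w k))" m] that
          unfolding rt(3) T_def by blast
        then show ?thesis using l len by (simp only: hd nth nth_map)
      qed
      show "map (\<lambda>T. T m) Ts ! l $$ (i, j) = 0" if "i < ds ! l" "j < n" "n \<le> i" for i j
      proof -
        have "T l m $$ (i, j) = 0"
          using G_rho_t_bottom_left[OF rt(1,2)[of l], of i j "rev (map A_to_kbar (w l))" m] that l
          unfolding rt(3) T_def by (simp add: nth d_def)
        then show ?thesis using l len by (simp only: nth nth_map)
      qed
    qed (simp add: len)
    show "integral_tm (ds ! l) (Ts ! l)" if "l < length ds" for l using that T by (simp add: nth)
    show "nilpart (Ts ! l) (n - 1) j = 0" if "l < length ds" "j < ds ! l" for l j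
      using G_rho_t_row[OF rt(1,2)[of l], of j "rev (map A_to_kbar (w l))"] that rt(3)[of l] by (simp add: nth T_def d_def)
  qed
  have G: "summand_G s (ix ! l) = tmodule_of (d l) (T l)" for l
    by (simp add: summand_G_def case_prod_beta tilde_G_def G_mod_def d_def T_def t_def w_def)
  have v: "summand_v s (ix ! l) = tilde_v (t l) (w l)" for l
    by (simp add: summand_v_def case_prod_beta t_def w_def)
  have dv: "dim_vec (tilde_v (t l) (w l)) = d l" for l
    by (simp add: tilde_v_def v_point_def d_def)
  have Tc: "\<forall>m. T l m \<in> carrier_mat (d l) (d l)" for l using T[of l] by (simp add: integral_tm_def std_tm_def)
  have module: "MZV_module s ix = tmodule_of gl.D Tg"
  proof -
    let ?S = "summand_G s :: nat list \<times> separator list \<Rightarrow> 'f tmodule"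
    have "map (\<lambda>G. tm_dim G - n) (map ?S ix) = map (\<lambda>l. d l - n) [0..<length ix]"
      by (simp add: map_conv_nth[of "summand_G s" ix] G o_def)
    then have "n + (\<Sum>G\<leftarrow>map ?S ix. tm_dim G - n) = gl.D"
      by (simp only:) (simp add: gl.D_def gl.off_def interv_sum_list_conv_sum_set_nat atLeast0LessThan len nth)
    moreover have "map (\<lambda>G. tm_rho G [:0, 1:] m) (map ?S ix) = map (\<lambda>T. T m) Ts" for m
      by (simp add: map_conv_nth[of "summand_G s" ix] G o_def Ts_def tm_rho_t[OF Tc])
    ultimately show ?thesis
      unfolding MZV_module_def glue_tmodule_def n_def[symmetric] Tg_def by (simp only:)
  qed
  define zs where "zs = map (\<lambda>l. tm_act (tmodule_of (d l) (T l)) (b l) (tilde_v (t l) (w l))) [0..<length ix]"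
  have point: "MZV_point s ix = glue_vec n zs"
    by (simp add: MZV_point_def n_def zs_def G v b_def
        map_conv_nth[of "\<lambda>l. tm_act (summand_G s l) (summand_b s l) (summand_v s l)" ix])
  have zs: "length zs = length ds" "\<And>l. l < length ds \<Longrightarrow> dim_vec (zs ! l) = ds ! l"
    by (simp_all add: zs_def len nth)
  let ?V = "\<lambda>i. \<Sum>l<length ds. gl.ext l (tm_op_poly (ds ! l) (Ts ! l) (b l) (y l)) i"
  have V: "MZV_point s ix $ i = ?V i" if i: "i < gl.D" for i
  proof -
    have "gl.ext l (\<lambda>j. zs ! l $ j) i = gl.ext l (tm_op_poly (ds ! l) (Ts ! l) (b l) (y l)) i" if l: "l < length ds" for l
      unfolding gl.ext_def
    proof (intro sum.cong refl)
      fix j assume "j \<in> {..<ds ! l}"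
      then show "(if gl.emb l j = i then zs ! l $ j else 0)
          = (if gl.emb l j = i then tm_op_poly (ds ! l) (Ts ! l) (b l) (y l) j else 0)"
        using l len tm_act_index[OF integral_tm_std[OF T] dv, of j l "b l"] by (simp add: zs_def nth y_def)
    qed
    moreover have "MZV_point s ix $ i = (\<Sum>l<length ds. gl.ext l (\<lambda>j. zs ! l $ j) i)"
      unfolding point by (rule gl.glue_vec_index[OF zs i])
    ultimately show ?thesis by simp
  qed
  have dim_pt: "dim_vec (MZV_point s ix :: 'f kbar vec) = gl.D"
    using gl.off_ge[of "length ds"] unfolding point
    by (simp add: glue_vec_def length_concat zs_def gl.D_def gl.off_def interv_sum_list_conv_sum_set_nat
        atLeast0LessThan len nth o_def)
  let ?x = "tm_act (MZV_module s ix) a (MZV_point s ix)"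
  have x: "?x $ i = tm_op_poly gl.D Tg a ?V i" if i: "i < gl.D" for i
    unfolding module using tm_act_index[OF Tg_std dim_pt i] tm_op_poly_cong[OF V i] by simp
  have dim_x: "dim_vec ?x = gl.D" by (simp add: module)
  have small_x: "small gl.D (\<lambda>i. ?x $ i)"
    using assms(9) vabs_vec_less_1_iff[OF dim_x] D_pos by linarith
  have small_V: "small gl.D (tm_op_poly gl.D Tg a ?V)"
    using small_x small_cong[of gl.D "\<lambda>i. ?x $ i", OF x] by simp
  \<comment> \<open>The multipliers are chosen to express the values of \<open>Li_star\<close>, one
    for each summand, so that these values can be recovered from the glued logarithm.\<close>
  have "\<forall>l. \<exists>c. c \<noteq> 0 \<and> small (d l) (tm_op_poly (d l) (T l) c (y l)) \<and>
    Li_star \<iota> (t l) (w l) = (-1) ^ (length (t l) - 1) / \<iota> (A_to_kbar c) *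
      log_coord (d l) (T l) (n - 1) (tm_op_poly (d l) (T l) c (y l))"
    using Li_star_eq[OF t(1,2) w] unfolding d_def T_def y_def t(3) by blast
  then obtain c where c: "\<And>l. c l \<noteq> 0" "\<And>l. small (d l) (tm_op_poly (d l) (T l) (c l) (y l))"
    "\<And>l. Li_star \<iota> (t l) (w l) = (-1) ^ (length (t l) - 1) / \<iota> (A_to_kbar (c l)) *
      log_coord (d l) (T l) (n - 1) (tm_op_poly (d l) (T l) (c l) (y l))"
    by metis
  let ?k = "\<lambda>f. \<iota> (A_to_kbar f)"
  define F where "F jP = ?k (summand_b s jP) * (-1) ^ (length (join_adjacent (+) (snd jP) s) - 1) *
      Li_star \<iota> (join_adjacent (+) (snd jP) s) (join_adjacent (*) (snd jP) (u_tuple s (fst jP)))" for jP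
  have "log_value \<iota> (MZV_module s ix) (map_vec \<iota> ?x) $ (n - 1) = log_coord gl.D Tg (n - 1) (\<lambda>i. ?x $ i)"
    using log_value_index[OF Tg_integral dim_x D_pos] by (simp only: module)
  also have "\<dots> = log_coord gl.D Tg (n - 1) (tm_op_poly gl.D Tg a ?V)"
    by (rule log_coord_cong) (rule x)
  also have "\<dots> = (\<Sum>l<length ds. ?k a * ?k (b l) / ?k (c l) *
        log_coord (ds ! l) (Ts ! l) (n - 1) (tm_op_poly (ds ! l) (Ts ! l) (c l) (y l)))"
    using small_V by (rule log_coord_glued) (use c in \<open>simp_all add: nth\<close>)
  also have "\<dots> = (\<Sum>l<length ix. ?k a * F (ix ! l))"
  proof (rule sum.cong)
    fix l assume l: "l \<in> {..<length ix}"
    \<comment> \<open>The sign attached to the depth in the definition of \<open>zeta_v\<close>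
      cancels the one inside \<open>Li_star\<close>.\<close>
    have "((-1) ^ m * (-1) ^ m :: 'c) = 1" for m by (simp flip: power_mult_distrib)
    then have Li: "log_coord (d l) (T l) (n - 1) (tm_op_poly (d l) (T l) (c l) (y l)) / ?k (c l)
        = (-1) ^ (length (t l) - 1) * Li_star \<iota> (t l) (w l)"
      unfolding c(3) by (simp add: mult.assoc[symmetric])
    have "F (ix ! l) = ?k (b l) * ((-1) ^ (length (t l) - 1) * Li_star \<iota> (t l) (w l))"
      by (simp only: F_def b_def t_def w_def mult.assoc)
    then show "?k a * ?k (b l) / ?k (c l) * log_coord (ds ! l) (Ts ! l) (n - 1) (tm_op_poly (ds ! l) (Ts ! l) (c l) (y l))
        = ?k a * F (ix ! l)"
      using l len unfolding Li[symmetric] by (simp add: nth)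
  qed (simp add: len)
  also have "\<dots> = ?k a * (\<Sum>jP\<in>set ix. F jP)"
    using sum_list_distinct_conv_sum_set[OF assms(6), of F]
    by (simp add: sum_list_sum_nth atLeast0LessThan flip: sum_distrib_left)
  also have "(\<Sum>jP\<in>set ix. F jP) = (\<Sum>j\<in>J_set TYPE('f) s. \<Sum>P\<in>S_set (length s - 1). F (j, P))"
    unfolding assms(7) by (simp add: sum.cartesian_product)
  also have "\<dots> = ?k (Gamma_list s) * zeta_v \<iota> s"
  proof -
    have "?k (Gamma_list s) \<noteq> 0" by (simp add: Gamma_list_nonzero)
    moreover have "F (j, P) = (-1) ^ (length s - 1) * ?k (a_mono j) *
        (-1) ^ (length (join_adjacent (+) P s) - 1) *
        Li_star \<iota> (join_adjacent (+) P s) (join_adjacent (*) P (u_tuple s j))" for j P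
      by (simp add: F_def summand_b_def hom_mult hom_power hom_uminus)
    ultimately show ?thesis by (simp add: zeta_v_def)
  qed
  finally have "log_value \<iota> (MZV_module s ix) (map_vec \<iota> ?x) $ (n - 1) = ?k a * ?k (Gamma_list s) * zeta_v \<iota> s"
    by (simp add: mult.assoc)
  moreover have "log_converges \<iota> (MZV_module s ix) (map_vec \<iota> ?x)"
    using log_converges_small[OF Tg_integral dim_x small_x] by (simp only: module)
  ultimately show ?thesis by (simp add: n_def)
qed

end
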